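(* Let $G=U(n)$ or $G=SO(n)$ with Lie algebra $\mathcal G$, let $\|\cdot\|$ be a unitarily invariant norm on the space $M(n)$ of $n\times n$ matrices, and let $\rho$ be the induced intrinsic metric on $G$. Then: (a) Cosets of one-parameter semigroups, i.e. curves of the form $\gamma(t)=ue^{tx}$ with $u\in G$, $x\in\mathcal G$, are geodesics in $(G,\rho)$. (b) If $\|\cdot\|$ is strictly convex (which happens in particular if $\|\cdot\|=\|\cdot\|_p$ for some $p\in(1,\infty)$), then all geodesics in $(G,\rho)$ are, up to a change of parameter, of the form given in (a) (or arcs of curves of such form). (c) If $\|\cdot\|$ is strictly convex and $u,v\in G$ are such that the spectrum of $u^{-1}v$ does not contain $-1$, then the curve of shortest length (geodesic arc) in $G$ connecting $u$ and $v$ is unique (up to a change of parameter).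
   Context: $M(n)$ denotes the $n\times n$ matrices, complex if $G=U(n)$ and real if $G=SO(n)$; $\mathcal G\subset M(n)$ is the space of skew-Hermitian (resp. real skew-symmetric) matrices. A unitarily invariant norm on $M(n)$ is a norm with $\|uxv\|=\|x\|$ for all unitary (resp. orthogonal) $u,v$ and all $x$; equivalently, $\|x\|=\|(s_k(x))_{k=1}^n\|$ for a symmetric norm on $\mathbf R^n$, where $s_1(x),\dots,s_n(x)$ are the singular numbers of $x$. The Schatten norm is $\|x\|_p=(\operatorname{tr}|x|^p)^{1/p}$. A norm is strictly convex if its unit sphere contains no nondegenerate segment. The length of an absolutely continuous curve $\gamma:[a,b]\to G$ is $\ell(\gamma)=\int_a^b\|\gamma'(t)\|\,dt$, and the intrinsic metric $\rho(u,v)$ is the infimum of lengths of such curves in $G$ connecting $u$ and $v$. A curve in $G$ is a geodesic if it locally realizes the intrinsic distance between its points, i.e. sufficiently short arcs of it have length equal to the $\rho$-distance between their endpoints. Curves are understood up to change of parameter. *)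

theory Defs
  imports "HOL-Analysis.Analysis"
begin

section \<open>Matrices\<close>

definition adjoint_matrix :: "complex^'n^'m \<Rightarrow> complex^'m^'n" where
  "adjoint_matrix A = transpose (map_matrix cnj A)"

definition unitary_matrix :: "complex^'n^'n \<Rightarrow> bool" where
  "unitary_matrix A \<longleftrightarrow> adjoint_matrix A ** A = mat 1 \<and> A ** adjoint_matrix A = mat 1"

definition unitary_group :: "(complex^'n^'n) set" where
  "unitary_group = Collect unitary_matrix"

definition orthogonal_group :: "(real^'n^'n) set" where
  "orthogonal_group = Collect orthogonal_matrix"

definition special_orthogonal_group :: "(real^'n^'n) set" where
  "special_orthogonal_group = {A. orthogonal_matrix A \<and> det A = 1}"

definition skew_hermitian :: "(complex^'n^'n) set" where
  "skew_hermitian = {x. adjoint_matrix x = - x}"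

definition skew_symmetric :: "(real^'n^'n) set" where
  "skew_symmetric = {x. transpose x = - x}"

text \<open>The type \<^typ>\<open>complex^'n^'n\<close> carries entrywise multiplication and no Banach algebra
  structure, so the library constants for powers and exponentials do not apply to matrices.\<close>

definition matrix_exp :: "('a::real_normed_field)^'n^'n \<Rightarrow> 'a^'n^'n" where
  "matrix_exp A = (\<Sum>k. (((**) A ^^ k) (mat 1)) /\<^sub>R fact k)"

definition matrix_spectrum :: "complex^'n^'n \<Rightarrow> complex set" where
  "matrix_spectrum A = {c. \<not> invertible (A - mat c)}"

definition complexify :: "real^'n^'m \<Rightarrow> complex^'n^'m" where
  "complexify = map_matrix complex_of_real"

section \<open>Invariant norms\<close>

definition matrix_norm :: "(('a::real_normed_field)^'n^'n \<Rightarrow> real) \<Rightarrow> bool" where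
  "matrix_norm N \<longleftrightarrow>
     (\<forall>x. 0 \<le> N x) \<and>
     (\<forall>x. N x = 0 \<longleftrightarrow> x = 0) \<and>
     (\<forall>c x. N (map_matrix ((*) c) x) = norm c * N x) \<and>
     (\<forall>x y. N (x + y) \<le> N x + N y)"

text \<open>For a norm on real matrices the invariance is under the full orthogonal group, also when
  the norm is used to measure curves in the special orthogonal group.\<close>

definition invariant_norm ::
    "(('a::real_normed_field)^'n^'n) set \<Rightarrow> ('a^'n^'n \<Rightarrow> real) \<Rightarrow> bool" where
  "invariant_norm U N \<longleftrightarrow>
     matrix_norm N \<and> (\<forall>u\<in>U. \<forall>v\<in>U. \<forall>x. N (u ** x ** v) = N x)"

definition strictly_convex :: "('a::real_vector \<Rightarrow> real) \<Rightarrow> bool" where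
  "strictly_convex N \<longleftrightarrow> \<not> (\<exists>x y. x \<noteq> y \<and> closed_segment x y \<subseteq> {z. N z = 1})"

definition diagonal_matrix :: "('n \<Rightarrow> real) \<Rightarrow> complex^'n^'n" where
  "diagonal_matrix d = (\<chi> i j. if i = j then complex_of_real (d i) else 0)"

text \<open>Functional calculus for Hermitian matrices; by the spectral theorem the matrix \<open>B\<close> below
  exists and does not depend on the chosen diagonalization of \<open>A\<close>.\<close>

definition hermitian_apply :: "(real \<Rightarrow> real) \<Rightarrow> complex^'n^'n \<Rightarrow> complex^'n^'n" where
  "hermitian_apply f A =
     (THE B. \<exists>u d. unitary_matrix u \<and>
        A = u ** diagonal_matrix d ** adjoint_matrix u \<and>
        B = u ** diagonal_matrix (f \<circ> d) ** adjoint_matrix u)"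

definition matrix_abs :: "complex^'n^'n \<Rightarrow> complex^'n^'n" where
  "matrix_abs x = hermitian_apply sqrt (adjoint_matrix x ** x)"

definition schatten_norm :: "real \<Rightarrow> complex^'n^'n \<Rightarrow> real" where
  "schatten_norm p x = Re (trace (hermitian_apply (\<lambda>s. s powr p) (matrix_abs x))) powr (1 / p)"

section \<open>Curves, intrinsic metric and geodesics\<close>

definition absolutely_continuous_on :: "real \<Rightarrow> real \<Rightarrow> (real \<Rightarrow> 'a::real_normed_vector) \<Rightarrow> bool" where
  "absolutely_continuous_on a b f \<longleftrightarrow>
     (\<forall>e>0. \<exists>d>0. \<forall>D S. D division_of S \<and> S \<subseteq> {a..b} \<and> (\<Sum>k\<in>D. measure lborel k) < d \<longrightarrow>
        (\<Sum>k\<in>D. norm (f (Sup k) - f (Inf k))) < e)"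

definition curve_in :: "'a::real_normed_vector set \<Rightarrow> real \<Rightarrow> real \<Rightarrow> (real \<Rightarrow> 'a) \<Rightarrow> bool" where
  "curve_in G a b \<gamma> \<longleftrightarrow> a \<le> b \<and> absolutely_continuous_on a b \<gamma> \<and> \<gamma> ` {a..b} \<subseteq> G"

text \<open>An absolutely continuous curve is differentiable almost everywhere; the unspecified value of
  \<^const>\<open>vector_derivative\<close> on the remaining null set does not affect the integral.\<close>

definition curve_length :: "('a::real_normed_vector \<Rightarrow> real) \<Rightarrow> real \<Rightarrow> real \<Rightarrow> (real \<Rightarrow> 'a) \<Rightarrow> real" where
  "curve_length N a b \<gamma> = integral {a..b} (\<lambda>t. N (vector_derivative \<gamma> (at t)))"

text \<open>A real infimum, meaningful because the groups considered are connected by smooth curves.\<close>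

definition intrinsic_dist :: "'a::real_normed_vector set \<Rightarrow> ('a \<Rightarrow> real) \<Rightarrow> 'a \<Rightarrow> 'a \<Rightarrow> real" where
  "intrinsic_dist G N u v =
     Inf {curve_length N a b \<gamma> | a b \<gamma>. curve_in G a b \<gamma> \<and> \<gamma> a = u \<and> \<gamma> b = v}"

definition shortest_curve ::
    "'a::real_normed_vector set \<Rightarrow> ('a \<Rightarrow> real) \<Rightarrow> 'a \<Rightarrow> 'a \<Rightarrow> real \<Rightarrow> real \<Rightarrow> (real \<Rightarrow> 'a) \<Rightarrow> bool" where
  "shortest_curve G N u v a b \<gamma> \<longleftrightarrow>
     curve_in G a b \<gamma> \<and> \<gamma> a = u \<and> \<gamma> b = v \<and> curve_length N a b \<gamma> = intrinsic_dist G N u v"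

text \<open>Geodesics parametrized by an interval \<open>I\<close> of any kind (compact or not). Short arcs around a
  point are those of small length, not of small parameter range: the notion has to be independent
  of the parametrization, whereas with small parameter ranges a curve that pauses at a point and
  then leaves it in another direction would qualify. For compact \<open>I\<close>, the bound \<open>d\<close> can be chosen
  independently of \<open>t\<close>.\<close>

definition geodesic_on ::
    "'a::real_normed_vector set \<Rightarrow> ('a \<Rightarrow> real) \<Rightarrow> real set \<Rightarrow> (real \<Rightarrow> 'a) \<Rightarrow> bool" where
  "geodesic_on G N I \<gamma> \<longleftrightarrow>
     is_interval I \<and>
     (\<forall>a\<in>I. \<forall>b\<in>I. a \<le> b \<longrightarrow> curve_in G a b \<gamma>) \<and>
     (\<forall>t\<in>I. \<exists>d>0. \<forall>a\<in>I. \<forall>b\<in>I. a \<le> t \<and> t \<le> b \<and> curve_length N a b \<gamma> < d \<longrightarrow>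
        curve_length N a b \<gamma> = intrinsic_dist G N (\<gamma> a) (\<gamma> b))"

text \<open>Parameter changes are nondecreasing and may be constant on subintervals, since absolutely
  continuous curves may be. Two curves agree up to a change of parameter if they are obtained by
  such parameter changes from one curve.\<close>

definition reparametrization_of ::
    "real set \<Rightarrow> (real \<Rightarrow> 'a) \<Rightarrow> real set \<Rightarrow> (real \<Rightarrow> 'a) \<Rightarrow> bool" where
  "reparametrization_of I \<gamma> J \<eta> \<longleftrightarrow>
     (\<exists>\<phi>. continuous_on I \<phi> \<and> mono_on I \<phi> \<and> \<phi> ` I = J \<and> (\<forall>t\<in>I. \<gamma> t = \<eta> (\<phi> t)))"

definition same_up_to_parameter ::
    "real set \<Rightarrow> (real \<Rightarrow> 'a) \<Rightarrow> real set \<Rightarrow> (real \<Rightarrow> 'a) \<Rightarrow> bool" where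
  "same_up_to_parameter I \<gamma> J \<eta> \<longleftrightarrow>
     (\<exists>K \<beta>. reparametrization_of I \<gamma> K \<beta> \<and> reparametrization_of J \<eta> K \<beta>)"

end

theory Submission
  imports Defs
begin

text \<open>Let \<open>len v\<close> be the norm of the principal logarithm of a unitary matrix \<open>v\<close>. The support
  functional of the norm at the absolute value of this logarithm can be chosen positive and
  commuting with \<open>v\<close>. Comparing the spectral decompositions of neighbouring unitary matrices
  through doubly stochastic weights, it shows that \<open>len\<close> grows along a curve at most at the rate of
  its speed. Hence the distance of \<open>u\<close> and \<open>v\<close> is \<open>len (u\<^sup>-\<^sup>1 v)\<close>, and the coset of a one-parameter
  group realizes it. If \<open>-1\<close> is not in the spectrum of \<open>u\<^sup>-\<^sup>1 v\<close>, equality to first order makes a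
  support functional at the logarithm support the last step of a shortest curve as well; for a
  strictly convex norm the two are then parallel, and going back step by step identifies the curve
  with the coset. Short arcs of a geodesic avoid \<open>-1\<close>, so a geodesic is locally, hence globally, a
  coset. Real matrices are treated as the complex ones fixed by conjugation, and strict convexity
  of the Schatten norms comes from the equality case of a tangent inequality for
  \<open>s\<^sub>1\<^sup>p + \<dots> + s\<^sub>n\<^sup>p\<close>.\<close>

subsection \<open>Adjoints and diagonal matrices\<close>

text \<open>The logarithm jumps when an eigenvalue crosses \<open>-1\<close>, and for a real matrix
  its value there is not real. The absolute value \<open>absarg\<close> avoids both defects:
  \<open>\<bar>Arg\<bar>\<close> is Lipschitz on the whole circle and invariant under conjugation,
  so \<open>len\<close> is defined and Lipschitz on the whole group, also for a norm that is
  invariant only under the unitaries of \<open>R\<close>. The price is a kink of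
  \<open>\<bar>Arg\<bar>\<close> at \<open>1\<close> and \<open>-1\<close>. The first-order estimate
  \<open>arg_defect z w C\<close> holds uniformly in \<open>z\<close> for every fixed
  \<open>w\<close>, but uniformly in \<open>w\<close> only for fixed \<open>z \<noteq> -1\<close>.
  The first form yields the growth bound for \<open>len\<close>, and with it the lower bound for
  lengths, on the whole group; the second form yields the functional for the equality case and has
  to avoid \<open>-1\<close>. In both, the constant depends on the eigenvalues of one matrix only.
  The doubly stochastic weights then allow the eigenvectors of the other matrix to be arbitrary, so
  no continuous choice of eigenvectors along a curve is ever made.\<close>

definition cdiag :: "('n \<Rightarrow> complex) \<Rightarrow> complex^'n^'n" where
  "cdiag f = (\<chi> i j. if i = j then f i else 0)"

text \<open>For unitary \<open>U\<close> this is the normal matrix whose eigenvectors are the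
  columns of \<open>U\<close>. Normal matrices are brought to this form so that matrix identities
  become identities for the eigenvalues \<open>f\<close>.\<close>

definition diag_conj :: "complex^'n^'n \<Rightarrow> ('n \<Rightarrow> complex) \<Rightarrow> complex^'n^'n" where
  "diag_conj U f = U ** cdiag f ** adjoint_matrix U"

text \<open>\<open>inner\<close> is only the real part of this Hermitian form; orthonormal columns
  of a unitary matrix involve the imaginary part as well.\<close>

definition hdot :: "complex^'n \<Rightarrow> complex^'n \<Rightarrow> complex" where
  "hdot x y = (\<Sum>i\<in>UNIV. cnj (x $ i) * y $ i)"

lemma adjoint_nth [simp]: "adjoint_matrix A $ i $ j = cnj (A $ j $ i)"
  by (simp add: adjoint_matrix_def transpose_def)

lemma adjoint_adjoint [simp]: "adjoint_matrix (adjoint_matrix A) = A"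
  by (simp add: vec_eq_iff)

lemma adjoint_minus: "adjoint_matrix (- A) = - adjoint_matrix A"
  by (simp add: vec_eq_iff)

lemma adjoint_diff: "adjoint_matrix (A - B) = adjoint_matrix A - adjoint_matrix B"
  by (simp add: vec_eq_iff)

lemma adjoint_scaleR: "adjoint_matrix (c *\<^sub>R A) = c *\<^sub>R adjoint_matrix A"
  by (simp add: vec_eq_iff)

lemma adjoint_mat_1 [simp]: "adjoint_matrix (mat 1) = mat 1"
  by (simp add: vec_eq_iff mat_def)

lemma adjoint_mult: "adjoint_matrix (A ** B) = adjoint_matrix B ** adjoint_matrix A"
  by (simp add: vec_eq_iff matrix_matrix_mult_def mult.commute)

lemma matrix_mult_minus_left: "(- A) ** B = - (A ** (B :: 'a::ring_1^'n^'n))"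
  by (simp add: vec_eq_iff matrix_matrix_mult_def sum_negf)

lemma matrix_mult_minus_right: "A ** (- B) = - (A ** (B :: 'a::ring_1^'n^'n))"
  by (simp add: vec_eq_iff matrix_matrix_mult_def sum_negf)

lemma matrix_mult_diff_left: "(A - B) ** C = A ** C - B ** (C :: 'a::ring_1^'n^'n)"
  by (simp add: vec_eq_iff matrix_matrix_mult_def sum_subtractf algebra_simps)

lemma matrix_mult_diff_right: "A ** (B - C) = A ** B - A ** (C :: 'a::ring_1^'n^'n)"
  by (simp add: vec_eq_iff matrix_matrix_mult_def sum_subtractf algebra_simps)

lemma matrix_mult_scaleR_left:
  "(c *\<^sub>R A) ** B = c *\<^sub>R (A ** (B :: 'a::real_algebra_1^'n^'n))"
  by (simp add: vec_eq_iff matrix_matrix_mult_def scaleR_sum_right)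

lemma matrix_mult_scaleR_right:
  "A ** (c *\<^sub>R B) = c *\<^sub>R (A ** (B :: 'a::real_algebra_1^'n^'n))"
  by (simp add: vec_eq_iff matrix_matrix_mult_def scaleR_sum_right)

lemma matrix_mult_add_left: "(A + B) ** C = A ** C + B ** (C :: 'a::ring_1^'n^'n)"
  by (simp add: vec_eq_iff matrix_matrix_mult_def sum.distrib algebra_simps)

lemma matrix_mult_add_right: "A ** (B + C) = A ** B + A ** (C :: 'a::ring_1^'n^'n)"
  by (simp add: vec_eq_iff matrix_matrix_mult_def sum.distrib algebra_simps)

lemma bounded_bilinear_matrix_mult:
  "bounded_bilinear ((**) :: complex^'n^'n \<Rightarrow> complex^'n^'n \<Rightarrow> complex^'n^'n)"
  apply (rule bilinear_conv_bounded_bilinear [THEN iffD1])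
  unfolding bilinear_def
  by (auto intro!: linearI simp: matrix_mult_add_left matrix_mult_add_right
      matrix_mult_scaleR_left matrix_mult_scaleR_right)

lemma unitary_matrix_mat_1 [simp]: "unitary_matrix (mat 1)"
  by (simp add: unitary_matrix_def)

lemma unitary_matrixI: "adjoint_matrix A ** A = mat 1 \<Longrightarrow> unitary_matrix A"
  unfolding unitary_matrix_def using matrix_left_right_inverse by blast

lemma unitary_matrix_mult:
  assumes "unitary_matrix A" "unitary_matrix B" shows "unitary_matrix (A ** B)"
proof (rule unitary_matrixI)
  have "adjoint_matrix (A ** B) ** (A ** B) = adjoint_matrix B ** (adjoint_matrix A ** A) ** B"
    by (simp add: adjoint_mult matrix_mul_assoc)
  then show "adjoint_matrix (A ** B) ** (A ** B) = mat 1"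
    using assms by (simp add: unitary_matrix_def)
qed

lemma unitary_matrix_adjoint: "unitary_matrix A \<Longrightarrow> unitary_matrix (adjoint_matrix A)"
  by (simp add: unitary_matrix_def)

lemma unitary_cancel:
  assumes "unitary_matrix U"
  shows "adjoint_matrix U ** (U ** X) = X" "U ** (adjoint_matrix U ** X) = X"
    "(X ** U) ** adjoint_matrix U = X" "(X ** adjoint_matrix U) ** U = X"
    "adjoint_matrix U ** U = mat 1" "U ** adjoint_matrix U = mat 1"
  using assms
  by (simp_all add: unitary_matrix_def matrix_mul_assoc)
     (simp_all flip: matrix_mul_assoc)

lemma matrix_inv_unitary: "unitary_matrix U \<Longrightarrow> matrix_inv U = adjoint_matrix U"
  unfolding unitary_matrix_def matrix_inv_def
  by (rule some_equality) (auto, metis matrix_mul_assoc matrix_mul_lid matrix_mul_rid)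

lemma cdiag_mult: "cdiag f ** cdiag g = cdiag (\<lambda>i. f i * g i)"
  by (simp add: vec_eq_iff matrix_matrix_mult_def cdiag_def if_distrib [where f = "\<lambda>x. x * _"] cong: if_cong)

lemma cdiag_adjoint: "adjoint_matrix (cdiag f) = cdiag (\<lambda>i. cnj (f i))"
  by (auto simp add: vec_eq_iff cdiag_def)

lemma diagonal_matrix_eq_cdiag: "diagonal_matrix d = cdiag (\<lambda>i. complex_of_real (d i))"
  by (simp add: vec_eq_iff cdiag_def diagonal_matrix_def)

lemma diag_conj_mult:
  assumes "unitary_matrix U"
  shows "diag_conj U f ** diag_conj U g = diag_conj U (\<lambda>i. f i * g i)"
proof -
  have "diag_conj U f ** diag_conj U g = U ** cdiag f ** ((adjoint_matrix U ** U) ** (cdiag g ** adjoint_matrix U))"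
    by (simp add: diag_conj_def matrix_mul_assoc)
  also have "\<dots> = U ** (cdiag f ** cdiag g) ** adjoint_matrix U"
    using assms by (simp add: unitary_matrix_def matrix_mul_assoc)
  finally show ?thesis by (simp add: diag_conj_def cdiag_mult)
qed

lemma diag_conj_adjoint: "adjoint_matrix (diag_conj U f) = diag_conj U (\<lambda>i. cnj (f i))"
  by (simp add: diag_conj_def adjoint_mult cdiag_adjoint matrix_mul_assoc)

lemma diag_conj_add: "diag_conj U f + diag_conj U g = diag_conj U (\<lambda>i. f i + g i)"
proof -
  have "cdiag (\<lambda>i. f i + g i) = cdiag f + cdiag g"
    by (simp add: vec_eq_iff cdiag_def)
  then show ?thesis
    by (simp add: diag_conj_def matrix_mult_add_left matrix_mult_add_right)
qed

lemma diag_conj_diff: "diag_conj U f - diag_conj U g = diag_conj U (\<lambda>i. f i - g i)"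
proof -
  have "cdiag (\<lambda>i. f i - g i) = cdiag f - cdiag g"
    by (simp add: vec_eq_iff cdiag_def)
  then show ?thesis
    by (simp add: diag_conj_def matrix_mult_diff_left matrix_mult_diff_right)
qed

lemma diag_conj_scaleR: "c *\<^sub>R diag_conj U f = diag_conj U (\<lambda>i. c *\<^sub>R f i)"
proof -
  have "cdiag (\<lambda>i. c *\<^sub>R f i) = c *\<^sub>R cdiag f"
    by (simp add: vec_eq_iff cdiag_def)
  then show ?thesis
    by (simp add: diag_conj_def matrix_mult_scaleR_left matrix_mult_scaleR_right)
qed

lemma diag_conj_uminus: "- diag_conj U f = diag_conj U (\<lambda>i. - f i)"
  using diag_conj_scaleR [of "-1" U f] by simp

lemma diag_conj_1:
  fixes U :: "complex^'n^'n"
  shows "unitary_matrix U \<Longrightarrow> diag_conj U (\<lambda>i. 1) = mat 1"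
proof -
  have "cdiag (\<lambda>i::'n. 1) = mat 1" by (simp add: vec_eq_iff cdiag_def mat_def)
  then show "unitary_matrix U \<Longrightarrow> ?thesis" by (simp add: diag_conj_def unitary_matrix_def)
qed

lemma diag_conj_zero [simp]:
  fixes U :: "complex^'n^'n"
  shows "diag_conj U (\<lambda>i. 0) = 0"
proof -
  have "cdiag (\<lambda>i::'n. 0) = 0" by (simp add: vec_eq_iff cdiag_def)
  then show ?thesis by (simp add: diag_conj_def)
qed

lemma diag_conj_nth: "diag_conj U f $ i $ j = (\<Sum>k\<in>UNIV. U $ i $ k * f k * cnj (U $ j $ k))"
  by (simp add: diag_conj_def matrix_matrix_mult_def cdiag_def if_distrib [where f = "\<lambda>x. _ * x"] cong: if_cong)

lemma diag_conj_inj: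
  assumes "unitary_matrix U" "diag_conj U f = diag_conj U g" shows "f = g"
proof -
  have "adjoint_matrix U ** diag_conj U h ** U = cdiag h" for h
    using assms(1) by (simp add: diag_conj_def unitary_cancel flip: matrix_mul_assoc)
  then have "cdiag f = cdiag g" using assms(2) by metis
  then have "cdiag f $ i $ i = cdiag g $ i $ i" for i by simp
  then show ?thesis by (simp add: cdiag_def fun_eq_iff)
qed

lemma diag_conj_unitary_iff:
  assumes "unitary_matrix U"
  shows "unitary_matrix (diag_conj U f) \<longleftrightarrow> (\<forall>i. cmod (f i) = 1)"
proof -
  have *: "(z * cnj z = 1) = (cmod z = 1)" "(cnj z * z = 1) = (cmod z = 1)" for z
  proof -
    show "(z * cnj z = 1) = (cmod z = 1)"
      unfolding complex_norm_square [symmetric] of_real_eq_1_iff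
      by (simp add: power2_eq_1_iff) (metis norm_ge_zero not_one_le_zero neg_0_le_iff_le)
    then show "(cnj z * z = 1) = (cmod z = 1)" by (simp add: mult.commute)
  qed
  show ?thesis
    unfolding unitary_matrix_def diag_conj_adjoint diag_conj_mult [OF assms]
      diag_conj_1 [OF assms, symmetric]
  proof
    assume "\<forall>i. cmod (f i) = 1"
    then have "(\<lambda>i. cnj (f i) * f i) = (\<lambda>i. 1)" "(\<lambda>i. f i * cnj (f i)) = (\<lambda>i. 1)" using * by auto
    then show "diag_conj U (\<lambda>i. cnj (f i) * f i) = diag_conj U (\<lambda>i. 1) \<and>
      diag_conj U (\<lambda>i. f i * cnj (f i)) = diag_conj U (\<lambda>i. 1)" by simp
  next
    assume "diag_conj U (\<lambda>i. cnj (f i) * f i) = diag_conj U (\<lambda>i. 1) \<and>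
      diag_conj U (\<lambda>i. f i * cnj (f i)) = diag_conj U (\<lambda>i. 1)"
    then show "\<forall>i. cmod (f i) = 1" using * by (auto dest!: diag_conj_inj [OF assms] fun_cong)
  qed
qed

text \<open>With \<open>T = U\<^sup>* V\<close>, both sides say \<open>f i \<cdot> T i j = T i j \<cdot> g j\<close> entrywise, a condition
  that survives applying \<open>\<phi>\<close> to \<open>f\<close> and \<open>g\<close>.\<close>

lemma diag_conj_intertwine:
  fixes U V X :: "complex^'n^'n"
  assumes U: "unitary_matrix U" and V: "unitary_matrix V"
  shows "diag_conj U f ** X = X ** diag_conj V g \<longleftrightarrow>
    (\<forall>i j. f i * (adjoint_matrix U ** X ** V) $ i $ j = (adjoint_matrix U ** X ** V) $ i $ j * g j)"
    (is "?L \<longleftrightarrow> ?R")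
proof -
  let ?T = "adjoint_matrix U ** X ** V"
  have 1: "cdiag f ** ?T = adjoint_matrix U ** (diag_conj U f ** X) ** V"
    by (simp add: diag_conj_def matrix_mul_assoc unitary_cancel(5) [OF U])
  have 2: "?T ** cdiag g = adjoint_matrix U ** (X ** diag_conj V g) ** V"
    by (simp add: diag_conj_def unitary_cancel(5) [OF V] flip: matrix_mul_assoc)
  have "?L \<longleftrightarrow> cdiag f ** ?T = ?T ** cdiag g"
  proof
    assume "cdiag f ** ?T = ?T ** cdiag g"
    then have "U ** (adjoint_matrix U ** (diag_conj U f ** X) ** V) ** adjoint_matrix V =
      U ** (adjoint_matrix U ** (X ** diag_conj V g) ** V) ** adjoint_matrix V"
      unfolding 1 2 by simp
    moreover have "U ** (adjoint_matrix U ** Y ** V) ** adjoint_matrix V = Y" for Y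
      by (simp add: matrix_mul_assoc unitary_cancel(6) [OF U])
         (simp add: unitary_cancel(6) [OF V] flip: matrix_mul_assoc)
    ultimately show ?L by simp
  qed (unfold 1 2, simp)
  also have "\<dots> \<longleftrightarrow> ?R"
  proof -
    have "(cdiag f ** Y) $ i $ j = f i * Y $ i $ j" for Y :: "complex^'n^'n" and i j
      by (simp add: matrix_matrix_mult_def cdiag_def if_distrib [where f = "\<lambda>x. x * _"] cong: if_cong)
    moreover have "(Y ** cdiag g) $ i $ j = Y $ i $ j * g j" for Y :: "complex^'n^'n" and i j
      by (simp add: matrix_matrix_mult_def cdiag_def if_distrib [where f = "\<lambda>x. _ * x"] cong: if_cong)
    ultimately show ?thesis by (simp only: vec_eq_iff)
  qed
  finally show ?thesis .
qed

lemma diag_conj_comp_intertwine: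
  fixes U V X :: "complex^'n^'n"
  assumes "unitary_matrix U" "unitary_matrix V" "diag_conj U f ** X = X ** diag_conj V g"
  shows "diag_conj U (\<lambda>i. \<phi> (f i)) ** X = X ** diag_conj V (\<lambda>i. \<phi> (g i))"
  using assms unfolding diag_conj_intertwine [OF assms(1,2)] by (metis mult.commute mult_cancel_left)

text \<open>Intertwining with \<open>X = mat 1\<close>: the functional calculus does not depend on
  the chosen diagonalization.\<close>

lemma diag_conj_comp_cong:
  assumes "unitary_matrix U" "unitary_matrix V" "diag_conj U f = diag_conj V g"
  shows "diag_conj U (\<lambda>i. \<phi> (f i)) = diag_conj V (\<lambda>i. \<phi> (g i))"
  using diag_conj_comp_intertwine [OF assms(1,2), of f "mat 1" g \<phi>] assms(3) by simp

text \<open>The choice is harmless: by \<open>diag_conj_comp_cong\<close> all candidates agree for a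
  normal matrix, and other matrices get an arbitrary value.\<close>

definition fcalc :: "(complex \<Rightarrow> complex) \<Rightarrow> complex^'n^'n \<Rightarrow> complex^'n^'n" where
  "fcalc \<phi> x = (SOME B. \<exists>U f. unitary_matrix U \<and> x = diag_conj U f \<and> B = diag_conj U (\<lambda>i. \<phi> (f i)))"

lemma fcalc_diag_conj:
  assumes "unitary_matrix U" shows "fcalc \<phi> (diag_conj U f) = diag_conj U (\<lambda>i. \<phi> (f i))"
  unfolding fcalc_def
proof (rule some_equality)
  show "\<exists>V g. unitary_matrix V \<and> diag_conj U f = diag_conj V g \<and>
      diag_conj U (\<lambda>i. \<phi> (f i)) = diag_conj V (\<lambda>i. \<phi> (g i))"
    using assms by blast
qed (use diag_conj_comp_cong [OF assms] in metis)

subsection \<open>Inner products\<close>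

lemma inner_matrix: "inner X Y = Re (\<Sum>i\<in>UNIV. \<Sum>j\<in>UNIV. cnj (X $ i $ j) * Y $ i $ j)"
  for X Y :: "complex^'n^'n"
  by (simp add: inner_vec_def inner_complex_def)

lemma inner_matrix_adjoint: "inner (adjoint_matrix X) (adjoint_matrix Y) = inner X Y"
  for X Y :: "complex^'n^'n"
  unfolding inner_matrix by (subst sum.swap) (simp add: mult.commute)

lemma inner_mult_left: "inner (A ** X) Y = inner X (adjoint_matrix A ** Y)"
  for X Y :: "complex^'n^'n"
proof -
  have "(\<Sum>i\<in>UNIV. \<Sum>j\<in>UNIV. cnj ((A ** X) $ i $ j) * Y $ i $ j)
    = (\<Sum>i\<in>UNIV. \<Sum>j\<in>UNIV. \<Sum>k\<in>UNIV. cnj (A $ i $ k) * cnj (X $ k $ j) * Y $ i $ j)"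
    by (simp add: matrix_matrix_mult_def sum_distrib_right)
  also have "\<dots> = (\<Sum>i\<in>UNIV. \<Sum>k\<in>UNIV. \<Sum>j\<in>UNIV. cnj (A $ i $ k) * cnj (X $ k $ j) * Y $ i $ j)"
    by (rule sum.cong [OF refl], rule sum.swap)
  also have "\<dots> = (\<Sum>k\<in>UNIV. \<Sum>i\<in>UNIV. \<Sum>j\<in>UNIV. cnj (A $ i $ k) * cnj (X $ k $ j) * Y $ i $ j)"
    by (rule sum.swap)
  also have "\<dots> = (\<Sum>k\<in>UNIV. \<Sum>j\<in>UNIV. \<Sum>i\<in>UNIV. cnj (A $ i $ k) * cnj (X $ k $ j) * Y $ i $ j)"
    by (rule sum.cong [OF refl], rule sum.swap)
  also have "\<dots> = (\<Sum>k\<in>UNIV. \<Sum>j\<in>UNIV. cnj (X $ k $ j) * (adjoint_matrix A ** Y) $ k $ j)"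
    by (simp add: matrix_matrix_mult_def sum_distrib_left mult_ac)
  finally show ?thesis by (simp add: inner_matrix)
qed

lemma inner_mult_right: "inner (X ** A) Y = inner X (Y ** adjoint_matrix A)"
  for X Y :: "complex^'n^'n"
proof -
  have "inner (X ** A) Y = inner (adjoint_matrix A ** adjoint_matrix X) (adjoint_matrix Y)"
    by (simp only: inner_matrix_adjoint flip: adjoint_mult)
  also have "\<dots> = inner (adjoint_matrix X) (adjoint_matrix (Y ** adjoint_matrix A))"
    by (simp add: inner_mult_left adjoint_mult)
  finally show ?thesis by (simp only: inner_matrix_adjoint)
qed

lemma norm_unitary_mult:
  assumes "unitary_matrix U" shows "norm (U ** X) = norm X" "norm (X ** U) = norm X"
  using unitary_cancel [OF assms] by (simp_all add: norm_eq_sqrt_inner inner_mult_left [of U] inner_mult_right [of _ U])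

text \<open>The weights \<open>\<bar>(W\<^sup>* V)\<^sub>j\<^sub>i\<bar>\<^sup>2\<close> form a doubly stochastic matrix; they reduce comparisons
  between functions of two non-commuting normal matrices to scalar inequalities.\<close>

definition overlap :: "complex^'n^'n \<Rightarrow> complex^'n^'n \<Rightarrow> 'n \<Rightarrow> 'n \<Rightarrow> real" where
  "overlap W V j i = (cmod ((adjoint_matrix W ** V) $ j $ i))\<^sup>2"

lemma overlap_nonneg: "0 \<le> overlap W V j i"
  by (simp add: overlap_def)

lemma unitary_row_sum: "unitary_matrix T \<Longrightarrow> (\<Sum>i\<in>UNIV. (cmod (T $ j $ i))\<^sup>2) = 1"
proof -
  assume "unitary_matrix T"
  then have "(T ** adjoint_matrix T) $ j $ j = 1" by (simp add: unitary_matrix_def mat_def)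
  then have "complex_of_real (\<Sum>i\<in>UNIV. (cmod (T $ j $ i))\<^sup>2) = 1"
    by (simp add: matrix_matrix_mult_def complex_norm_square del: of_real_power)
  then show ?thesis using of_real_eq_1_iff by blast
qed

lemma overlap_sum:
  assumes "unitary_matrix W" "unitary_matrix V"
  shows "(\<Sum>i\<in>UNIV. overlap W V j i) = 1" "(\<Sum>j\<in>UNIV. overlap W V j i) = 1"
proof -
  show "(\<Sum>i\<in>UNIV. overlap W V j i) = 1"
    unfolding overlap_def by (intro unitary_row_sum unitary_matrix_mult unitary_matrix_adjoint assms)
  have "overlap W V j i = overlap V W i j" for j i
  proof -
    have "(adjoint_matrix W ** V) $ j $ i = cnj ((adjoint_matrix V ** W) $ i $ j)"
      by (simp add: matrix_matrix_mult_def mult.commute)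
    then show ?thesis by (simp add: overlap_def)
  qed
  then show "(\<Sum>j\<in>UNIV. overlap W V j i) = 1"
    by (simp add: overlap_def) (intro unitary_row_sum unitary_matrix_mult unitary_matrix_adjoint assms)
qed

text \<open>Conjugation by \<open>W\<close> makes the first matrix diagonal, so only the diagonal
  entries of the second one in the eigenbasis \<open>W\<close> contribute; these are averages of
  \<open>b\<close> with the weights \<open>overlap\<close>.\<close>

lemma inner_diag_conj:
  assumes "unitary_matrix W" "unitary_matrix V"
  shows "inner (diag_conj W a) (diag_conj V b) =
    (\<Sum>j\<in>UNIV. \<Sum>i\<in>UNIV. overlap W V j i * Re (cnj (a j) * b i))"
proof -
  define T where "T = adjoint_matrix W ** V"
  have "inner (diag_conj W a) (diag_conj V b) = inner (cdiag a) (adjoint_matrix W ** diag_conj V b ** W)"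
    unfolding diag_conj_def [of W] inner_mult_right [of "W ** cdiag a"] inner_mult_left [of W]
    by (simp add: matrix_mul_assoc)
  also have "adjoint_matrix W ** diag_conj V b ** W = diag_conj T b"
    by (simp add: T_def diag_conj_def adjoint_mult matrix_mul_assoc)
  also have "inner (cdiag a) (diag_conj T b) = (\<Sum>j\<in>UNIV. Re (cnj (a j) * diag_conj T b $ j $ j))"
    unfolding inner_matrix by (simp add: cdiag_def if_distrib [where f = cnj] if_distrib [where f = "\<lambda>x. x * _"] cong: if_cong)
  also have "\<dots> = (\<Sum>j\<in>UNIV. \<Sum>i\<in>UNIV. Re (cnj (a j) * (T $ j $ i * b i * cnj (T $ j $ i))))"
    by (simp add: diag_conj_nth sum_distrib_left del: complex_cnj_mult complex_cnj_cnj times_complex.sel)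
  also have "\<dots> = (\<Sum>j\<in>UNIV. \<Sum>i\<in>UNIV. overlap W V j i * Re (cnj (a j) * b i))"
  proof (intro sum.cong refl)
    fix i j
    have "of_real (overlap W V j i) = T $ j $ i * cnj (T $ j $ i)"
      unfolding overlap_def T_def by (rule complex_norm_square)
    then have "cnj (a j) * (T $ j $ i * b i * cnj (T $ j $ i)) = of_real (overlap W V j i) * (cnj (a j) * b i)"
      by simp
    then show "Re (cnj (a j) * (T $ j $ i * b i * cnj (T $ j $ i))) = overlap W V j i * Re (cnj (a j) * b i)"
      by (metis Re_complex_of_real Im_complex_of_real mult_zero_left diff_zero times_complex.sel(1))
  qed
  finally show ?thesis .
qed

text \<open>Expanding the square gives two single sums and one mixed double sum; the unit row and
  column sums of \<open>overlap\<close> spread the single sums over the same double index.\<close>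

lemma norm_diag_conj_diff:
  assumes "unitary_matrix W" "unitary_matrix V"
  shows "(norm (diag_conj W a - diag_conj V b))\<^sup>2 =
    (\<Sum>j\<in>UNIV. \<Sum>i\<in>UNIV. overlap W V j i * (cmod (a j - b i))\<^sup>2)"
proof -
  have 1: "(norm (diag_conj U c))\<^sup>2 = (\<Sum>j\<in>UNIV. (cmod (c j))\<^sup>2)" if "unitary_matrix U" for U :: "complex^'n^'n" and c
  proof -
    have "(norm (diag_conj U c))\<^sup>2 = (\<Sum>j\<in>UNIV. \<Sum>i\<in>UNIV. overlap U U j i * Re (cnj (c j) * c i))"
      unfolding power2_norm_eq_inner by (rule inner_diag_conj [OF that that])
    also have "\<dots> = (\<Sum>j\<in>UNIV. \<Sum>i\<in>UNIV. if j = i then (cmod (c j))\<^sup>2 else 0)"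
      using that unfolding overlap_def unitary_matrix_def
      by (intro sum.cong refl) (auto simp add: mat_def cmod_power2 simp flip: power2_eq_square)
    finally show ?thesis by simp
  qed
  have "(norm (diag_conj W a - diag_conj V b))\<^sup>2 =
    (\<Sum>j\<in>UNIV. (cmod (a j))\<^sup>2) + (\<Sum>i\<in>UNIV. (cmod (b i))\<^sup>2) - 2 * inner (diag_conj W a) (diag_conj V b)"
    unfolding 1 [OF assms(1), of a, symmetric] 1 [OF assms(2), of b, symmetric]
    by (simp add: power2_norm_eq_inner inner_diff_left inner_diff_right inner_commute)
  also have "(\<Sum>j\<in>UNIV. (cmod (a j))\<^sup>2) = (\<Sum>j\<in>UNIV. \<Sum>i\<in>UNIV. overlap W V j i * (cmod (a j))\<^sup>2)"
    using overlap_sum [OF assms] by (simp flip: sum_distrib_right)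
  also have "(\<Sum>i\<in>UNIV. (cmod (b i))\<^sup>2) = (\<Sum>j\<in>UNIV. \<Sum>i\<in>UNIV. overlap W V j i * (cmod (b i))\<^sup>2)"
    using overlap_sum [OF assms] by (subst sum.swap) (simp flip: sum_distrib_right)
  finally show ?thesis
    unfolding inner_diag_conj [OF assms] sum_distrib_left
    by (simp flip: sum.distrib sum_subtractf)
       (intro sum.cong refl, unfold cmod_power2, simp add: power2_eq_square algebra_simps)
qed

lemma norm_diag_conj:
  assumes "unitary_matrix U" shows "cmod (f i) \<le> norm (diag_conj U f)"
proof -
  have "(norm (diag_conj U f))\<^sup>2 = (\<Sum>j\<in>UNIV. (cmod (f j))\<^sup>2)"
    using norm_diag_conj_diff [OF assms assms, of f "\<lambda>i. 0"] overlap_sum [OF assms assms]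
    by (simp flip: sum_distrib_right)
  then have "(cmod (f i))\<^sup>2 \<le> (norm (diag_conj U f))\<^sup>2"
    by (metis (no_types, lifting) finite UNIV_I member_le_sum zero_le_power2)
  then show ?thesis by (rule power2_le_imp_le) simp
qed

subsection \<open>The spectral theorem for commuting Hermitian matrices\<close>

lemma hdot_mult: "hdot (A *v x) y = hdot x (adjoint_matrix A *v y)"
proof -
  have "hdot (A *v x) y = (\<Sum>i\<in>UNIV. \<Sum>j\<in>UNIV. cnj (A $ i $ j) * cnj (x $ j) * y $ i)"
    by (simp add: hdot_def matrix_vector_mult_def sum_distrib_right)
  also have "\<dots> = (\<Sum>j\<in>UNIV. \<Sum>i\<in>UNIV. cnj (A $ i $ j) * cnj (x $ j) * y $ i)"
    by (rule sum.swap)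
  finally show ?thesis by (simp add: hdot_def matrix_vector_mult_def sum_distrib_left mult_ac)
qed

lemma hdot_Re: "Re (hdot x y) = inner x y"
  by (simp add: hdot_def inner_vec_def inner_complex_def)

lemma hdot_i: "hdot x (\<i> *s y) = \<i> * hdot x y"
  by (simp add: hdot_def sum_distrib_left mult_ac)

lemma hdot_scale_right: "hdot x (c *s y) = c * hdot x y"
  by (simp add: hdot_def sum_distrib_left mult_ac)

lemma hdot_scale_left: "hdot (c *s x) y = cnj c * hdot x y"
  by (simp add: hdot_def sum_distrib_left mult_ac)

lemma hdot_add_right: "hdot x (y + z) = hdot x y + hdot x z"
  by (simp add: hdot_def sum.distrib algebra_simps)

lemma hdot_commute: "hdot y x = cnj (hdot x y)"
  by (simp add: hdot_def mult_ac)

lemma hdot_self: "hdot x x = of_real ((norm x)\<^sup>2)"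
proof -
  have "Im (hdot x x) = 0" by (simp add: hdot_def mult.commute)
  moreover have "Re (hdot x x) = (norm x)\<^sup>2" by (simp add: hdot_Re power2_norm_eq_inner)
  ultimately show ?thesis by (simp add: complex_eq_iff del: of_real_power)
qed

text \<open>A complex subspace, encoded as a real subspace stable under \<open>\<i>\<close>, so that
  \<open>subspace\<close> and \<open>dim\<close> over the reals remain applicable.\<close>

definition csubspace :: "(complex^'n) set \<Rightarrow> bool" where
  "csubspace S \<longleftrightarrow> subspace S \<and> (\<forall>x\<in>S. \<i> *s x \<in> S)"

lemma linear_matrix_vector_mult: "linear ((*v) (A :: complex^'n^'n))"
  by (auto intro!: linearI simp: matrix_vector_right_distrib)

text \<open>A maximizer of the Rayleigh quotient is an eigenvector.\<close>

lemma hermitian_eigenvector: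
  fixes H :: "complex^'n^'n"
  assumes H: "adjoint_matrix H = H" and S: "subspace S" "S \<noteq> {0}" and inv: "\<And>x. x \<in> S \<Longrightarrow> H *v x \<in> S"
  obtains w m where "w \<in> S" "w \<noteq> 0" "H *v w = (m::real) *\<^sub>R w"
proof -
  have sym: "inner (H *v x) y = inner x (H *v y)" for x y
    by (metis H hdot_Re hdot_mult)
  have lin: "linear ((*v) H)" by (rule linear_matrix_vector_mult)
  obtain s where s: "s \<in> S" "s \<noteq> 0" using S subspace_0 by blast
  have ne: "s /\<^sub>R norm s \<in> S \<inter> sphere 0 1" using s S by (simp add: subspace_scale)
  have "compact (S \<inter> sphere 0 1)"
    by (simp add: S closed_Int_compact closed_subspace)
  moreover have "continuous_on (S \<inter> sphere 0 1) (\<lambda>x. inner x (H *v x))"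
    using lin by (intro continuous_intros linear_continuous_on) (simp add: linear_conv_bounded_linear)
  ultimately obtain w where w: "w \<in> S" "norm w = 1"
    and max: "\<And>y. y \<in> S \<Longrightarrow> norm y = 1 \<Longrightarrow> inner y (H *v y) \<le> inner w (H *v w)"
    using continuous_attains_sup [of "S \<inter> sphere 0 1" "\<lambda>x. inner x (H *v x)"] ne
    by (metis (no_types, lifting) IntD1 IntD2 IntI empty_iff mem_sphere_0)
  define m where "m = inner w (H *v w)"
  have Q: "inner y (H *v y) \<le> m * inner y y" if "y \<in> S" for y
  proof (cases "y = 0")
    case False
    have "inner (y /\<^sub>R norm y) (H *v (y /\<^sub>R norm y)) \<le> m"
      unfolding m_def using that False S by (intro max) (auto simp: subspace_scale)
    then have "inner y (H *v y) / (norm y * norm y) \<le> m"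
      by (simp add: linear_scale [OF lin] divide_inverse mult_ac)
    then show ?thesis using False
      by (simp add: divide_simps split: if_splits) (simp add: norm_eq_sqrt_inner)
  qed (simp add: linear_0 [OF lin])
  define r where "r = H *v w - m *\<^sub>R w"
  have rS: "r \<in> S" unfolding r_def using w inv S by (simp add: subspace_diff subspace_scale)
  have lin0: "inner r r = 0"
  proof (rule ccontr)
    assume nz: "inner r r \<noteq> 0"
    define q where "q = m * inner r r - inner r (H *v r)"
    have q0: "q \<ge> 0" using Q [OF rS] by (simp add: q_def)
    have ww: "inner w w = 1" using w(2) by (simp add: norm_eq_sqrt_inner)
    have rw: "inner w r = 0"
      unfolding r_def inner_diff_right inner_scaleR_right ww m_def by simp
    have wHr: "inner (H *v w) r = inner r r"
      using rw unfolding r_def inner_diff_left inner_scaleR_left by simp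
    have wHr': "inner w (H *v r) = inner r r" using sym [of w r] wHr by (rule subst)
    \<comment> \<open>Moving \<open>w\<close> by \<open>t\<close> in the direction of the residual
      \<open>r\<close> gains \<open>2 * t * inner r r\<close> to first order, and maximality of
      \<open>w\<close> lets only the second-order term compensate it.\<close>
    have "2 * t * inner r r \<le> t\<^sup>2 * q" for t
    proof -
      have "inner (w + t *\<^sub>R r) (H *v (w + t *\<^sub>R r)) = m + 2 * t * inner r r + t\<^sup>2 * inner r (H *v r)"
        unfolding linear_add [OF lin] linear_scale [OF lin] inner_add_left inner_add_right
          inner_scaleR_left inner_scaleR_right m_def [symmetric] wHr'
          inner_commute [of r "H *v w"] wHr
        by (simp add: power2_eq_square algebra_simps)
      moreover have "inner (w + t *\<^sub>R r) (w + t *\<^sub>R r) = 1 + t\<^sup>2 * inner r r"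
        unfolding inner_add_left inner_add_right inner_scaleR_left inner_scaleR_right
          inner_commute [of r w] rw ww
        by (simp add: power2_eq_square)
      moreover have "w + t *\<^sub>R r \<in> S" by (simp add: w rS S subspace_add subspace_scale)
      ultimately have "m + 2 * t * inner r r + t\<^sup>2 * inner r (H *v r) \<le> m * (1 + t\<^sup>2 * inner r r)"
        using Q by metis
      then show ?thesis by (simp add: q_def algebra_simps)
    qed
    \<comment> \<open>The denominator \<open>q + 1\<close> is positive also for
      \<open>q = 0\<close>; after cancellation the inequality reads
      \<open>2 * (q + 1) \<le> q\<close>.\<close>
    note * = this [of "inner r r / (q + 1)"]
    define a where "a = inner r r"
    have "2 * (a / (q + 1)) * a \<le> (a / (q + 1))\<^sup>2 * q" using * by (simp add: a_def)
    then have "2 * a\<^sup>2 * (q + 1) \<le> a\<^sup>2 * q"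
      using q0 by (simp add: divide_simps power2_eq_square mult.assoc split: if_splits)
    then have "a\<^sup>2 * (2 * (q + 1)) \<le> a\<^sup>2 * q" by (simp only: mult_ac)
    moreover have "a\<^sup>2 > 0" using nz by (simp add: a_def)
    ultimately have "2 * (q + 1) \<le> q" by (simp only: mult_le_cancel_left_pos)
    then have "2 * q + 2 \<le> q" by (simp only: distrib_left)
    then show False using q0 by linarith
  qed
  then have "H *v w = m *\<^sub>R w" by (simp add: r_def)
  moreover have "w \<noteq> 0" using w(2) by auto
  ultimately show ?thesis using that w(1) by blast
qed

text \<open>Induction on the dimension: if some \<open>H\<close> is not a scalar on
  \<open>S\<close>, one of its eigenspaces in \<open>S\<close> is nonzero, strictly smaller, and
  stable under every matrix that commutes with \<open>H\<close>.\<close>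

lemma common_eigenvector:
  fixes \<H> :: "(complex^'n^'n) set"
  assumes H: "\<And>H. H \<in> \<H> \<Longrightarrow> adjoint_matrix H = H"
    and comm: "\<And>H K. H \<in> \<H> \<Longrightarrow> K \<in> \<H> \<Longrightarrow> H ** K = K ** H"
    and S: "csubspace S" "S \<noteq> {0}"
    and inv: "\<And>H x. H \<in> \<H> \<Longrightarrow> x \<in> S \<Longrightarrow> H *v x \<in> S"
  shows "\<exists>w\<in>S. w \<noteq> 0 \<and> (\<forall>H\<in>\<H>. \<exists>c::real. H *v w = c *\<^sub>R w)"
  using S inv
proof (induction "dim S" arbitrary: S rule: less_induct)
  case less
  show ?case
  proof (cases "\<forall>H\<in>\<H>. \<exists>c::real. \<forall>w\<in>S. H *v w = c *\<^sub>R w")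
    case True
    moreover obtain w where "w \<in> S" "w \<noteq> 0" using less.prems subspace_0 csubspace_def by blast
    ultimately show ?thesis by blast
  next
    case False
    then obtain H where HH: "H \<in> \<H>" and no: "\<And>c::real. \<exists>w\<in>S. H *v w \<noteq> c *\<^sub>R w" by blast
    have subS: "subspace S" using less.prems by (simp add: csubspace_def)
    obtain w m where w: "w \<in> S" "w \<noteq> 0" "H *v w = (m::real) *\<^sub>R w"
      using hermitian_eigenvector [OF H [OF HH] subS less.prems(2)] less.prems(3) HH by blast
    define E where "E = {x \<in> S. H *v x = m *\<^sub>R x}"
    have lin: "linear ((*v) K)" for K :: "complex^'n^'n" by (rule linear_matrix_vector_mult)
    have subE: "subspace E" using subS unfolding E_def
      by (auto simp: subspace_def linear_add [OF lin] linear_scale [OF lin] linear_0 [OF lin] algebra_simps)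
    have isc: "K *v (\<i> *s x) = \<i> *s (K *v x)" for K :: "complex^'n^'n" and x
      by (simp add: vec_eq_iff matrix_vector_mult_def sum_distrib_left mult_ac)
    have csE: "csubspace E" using subE less.prems(1) unfolding csubspace_def E_def
      by (auto simp: isc) (simp add: vec_eq_iff scaleR_conv_of_real [where 'a = complex])
    have "E \<subset> S" using no [of m] by (auto simp: E_def)
    then have "dim E < dim S"
      by (metis dim_psubset psubset_imp_subset span_eq_iff subE subS)
    moreover have "E \<noteq> {0}" using w by (auto simp: E_def)
    moreover have "K *v x \<in> E" if "K \<in> \<H>" "x \<in> E" for K x
    proof -
      have "H *v (K *v x) = K *v (H *v x)"
        by (metis comm [OF HH that(1)] matrix_vector_mul_assoc)
      then show ?thesis using that less.prems(3) by (auto simp: E_def linear_scale [OF lin])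
    qed
    ultimately obtain w where "w\<in>E" "w \<noteq> 0" "\<forall>H\<in>\<H>. \<exists>c::real. H *v w = c *\<^sub>R w"
      using less.hyps csE by blast
    then show ?thesis by (auto simp: E_def)
  qed
qed

text \<open>Induction on the number of missing vectors: the orthogonal complement of eigenvectors is
  stable under a Hermitian family, so it contains a common eigenvector. With an empty family this
  completes an orthonormal system, as used for singular values.\<close>

lemma extend_orthonormal_eigenbasis:
  fixes \<H> :: "(complex^'n^'n) set" and e :: "'n \<Rightarrow> complex^'n"
  assumes H: "\<And>H. H \<in> \<H> \<Longrightarrow> adjoint_matrix H = H"
    and comm: "\<And>H K. H \<in> \<H> \<Longrightarrow> K \<in> \<H> \<Longrightarrow> H ** K = K ** H"
    and "\<And>i j. i \<in> J \<Longrightarrow> j \<in> J \<Longrightarrow> hdot (e i) (e j) = (if i = j then 1 else 0)"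
    and "\<And>j H. j \<in> J \<Longrightarrow> H \<in> \<H> \<Longrightarrow> \<exists>c::real. H *v e j = c *\<^sub>R e j"
  shows "\<exists>e'. (\<forall>j\<in>J. e' j = e j) \<and> (\<forall>i j. hdot (e' i) (e' j) = (if i = j then 1 else 0)) \<and>
     (\<forall>j. \<forall>H\<in>\<H>. \<exists>c::real. H *v e' j = c *\<^sub>R e' j)"
  using assms(3,4)
proof (induction "card (- J)" arbitrary: J e)
  case 0
  have "- J = {}" using card_0_eq [of "- J"] 0(1) by (metis finite)
  then have J: "j \<in> J" for j by blast
  show ?case
    by (rule exI [of _ e]) (use 0(2) [OF J J] 0(3) [OF J] in simp)
next
  case (Suc k)
  have "- J \<noteq> {}" using Suc.hyps(2) by (metis card.empty nat.distinct(1))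
  then obtain i0 where i0: "i0 \<notin> J" by blast
  define S where "S = {x. \<forall>j\<in>J. hdot (e j) x = 0}"
  have csS: "csubspace S" unfolding csubspace_def subspace_def S_def
    by (simp add: hdot_add_right hdot_i) (simp add: hdot_def flip: scaleR_sum_right)
  \<comment> \<open>Complex orthogonality to \<open>e j\<close> is real orthogonality to both
    \<open>e j\<close> and \<open>\<i> *s e j\<close>. These are at most \<open>2 * card J\<close>
    real vectors, fewer than the real dimension.\<close>
  define B where "B = e ` J \<union> (\<lambda>j. \<i> *s e j) ` J"
  have "dim (span B) \<le> card B" by (metis B_def dim_le_card' dim_span finite finite_Un finite_imageI)
  also have "\<dots> \<le> 2 * card J"
    unfolding B_def by (rule order_trans [OF card_Un_le]) (simp add: add_mono card_image_le mult_2)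
  also have "card J < CARD('n)" using i0 by (metis UNIV_I finite psubset_card_mono psubsetI subset_UNIV)
  finally have "dim B < DIM(complex^'n)" by simp
  then obtain x where x: "x \<noteq> 0" "\<And>y. y \<in> span B \<Longrightarrow> orthogonal x y"
    using orthogonal_to_subspace_exists by metis
  have "x \<in> S"
  proof -
    have "hdot (e j) x = 0" if "j \<in> J" for j
    proof -
      have "e j \<in> span B" "\<i> *s e j \<in> span B" using that by (auto intro!: span_base simp: B_def)
      with x(2) have "inner (e j) x = 0" "inner (\<i> *s e j) x = 0"
        by (metis orthogonal_def inner_commute)+
      then have "Re (hdot (e j) x) = 0" "Re (hdot (\<i> *s e j) x) = 0" by (simp_all add: hdot_Re)
      then show ?thesis by (simp add: hdot_scale_left complex_eq_iff)
    qed
    then show ?thesis by (simp add: S_def)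
  qed
  with x have Sne: "S \<noteq> {0}" by blast
  have inv: "K *v x \<in> S" if K: "K \<in> \<H>" and "x \<in> S" for K x
  proof -
    have "hdot (e j) (K *v x) = 0" if j: "j \<in> J" for j
    proof -
      obtain c :: real where "K *v e j = c *\<^sub>R e j" using Suc.prems(2) j K by blast
      then have "K *v e j = complex_of_real c *s e j" by (simp add: vec_eq_iff scaleR_conv_of_real [where 'a = complex])
      moreover have "hdot (e j) (K *v x) = hdot (K *v e j) x" by (simp add: hdot_mult H K)
      moreover have "hdot (e j) x = 0" using \<open>x \<in> S\<close> j by (simp add: S_def)
      ultimately show ?thesis by (simp add: hdot_scale_left)
    qed
    then show ?thesis by (simp add: S_def)
  qed
  obtain w where w: "w \<in> S" "w \<noteq> 0" "\<forall>H\<in>\<H>. \<exists>c::real. H *v w = c *\<^sub>R w"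
    using common_eigenvector [OF H comm csS Sne inv] by blast
  define w' where "w' = w /\<^sub>R norm w"
  have w'S: "w' \<in> S" and nw': "norm w' = 1"
    using w csS by (auto simp: w'_def csubspace_def subspace_scale)
  have w'H: "\<exists>c::real. H *v w' = c *\<^sub>R w'" if "H \<in> \<H>" for H
    using w(3) that unfolding w'_def linear_scale [OF linear_matrix_vector_mult]
    by (metis scaleR_left_commute)
  have "k = card (- insert i0 J)"
    using Suc.hyps(2) i0 by (simp add: Compl_insert)
  moreover have "hdot ((e(i0 := w')) i) ((e(i0 := w')) j) = (if i = j then 1 else 0)"
    if "i \<in> insert i0 J" "j \<in> insert i0 J" for i j
  proof -
    have "hdot (e j) w' = 0" "hdot w' (e j) = 0" if "j \<in> J" for j
      using w'S that hdot_commute [of "e j" w'] by (auto simp: S_def)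
    moreover have "hdot w' w' = 1" by (simp add: hdot_self nw')
    ultimately show ?thesis using that Suc.prems(1) i0 by auto
  qed
  moreover have "\<exists>c::real. H *v (e(i0 := w')) j = c *\<^sub>R (e(i0 := w')) j"
    if "j \<in> insert i0 J" "H \<in> \<H>" for j H
    using that Suc.prems(2) w'H by auto
  ultimately obtain e' where "\<forall>j\<in>insert i0 J. e' j = (e(i0 := w')) j"
    "\<forall>i j. hdot (e' i) (e' j) = (if i = j then 1 else 0)" "\<forall>j. \<forall>H\<in>\<H>. \<exists>c::real. H *v e' j = c *\<^sub>R e' j"
    using Suc.hyps(1) [of "insert i0 J" "e(i0 := w')"] by blast
  moreover have "e' j = e j" if "j \<in> J" for j using that i0 calculation(1) by auto
  ultimately show ?case by blast
qed

lemma unitary_matrix_columns: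
  assumes "\<And>i j. hdot (e i) (e j) = (if i = j then 1 else 0)"
  shows "unitary_matrix (\<chi> i j. e j $ i)"
proof (rule unitary_matrixI)
  show "adjoint_matrix (\<chi> i j. e j $ i) ** (\<chi> i j. e j $ i) = mat 1"
    using assms by (simp add: vec_eq_iff matrix_matrix_mult_def hdot_def mat_def)
qed

theorem commuting_hermitian_diagonalization:
  fixes \<H> :: "(complex^'n^'n) set"
  assumes "\<And>H. H \<in> \<H> \<Longrightarrow> adjoint_matrix H = H"
    and "\<And>H K. H \<in> \<H> \<Longrightarrow> K \<in> \<H> \<Longrightarrow> H ** K = K ** H"
  obtains U where "unitary_matrix U"
    "\<And>H. H \<in> \<H> \<Longrightarrow> \<exists>d::'n \<Rightarrow> real. H = diag_conj U (\<lambda>i. of_real (d i))"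
proof -
  obtain e :: "'n \<Rightarrow> complex^'n" where e: "\<forall>i j. hdot (e i) (e j) = (if i = j then 1 else 0)"
    and eig: "\<forall>j. \<forall>H\<in>\<H>. \<exists>c::real. H *v e j = c *\<^sub>R e j"
    using extend_orthonormal_eigenbasis [OF assms, of \<H> "{}"] by auto
  define U :: "complex^'n^'n" where "U = (\<chi> i j. e j $ i)"
  have U: "unitary_matrix U" unfolding U_def using e by (intro unitary_matrix_columns) auto
  moreover have "\<exists>d::'n \<Rightarrow> real. H = diag_conj U (\<lambda>i. of_real (d i))" if "H \<in> \<H>" for H
  proof -
    from eig that have "\<forall>j. \<exists>c::real. H *v e j = c *\<^sub>R e j" by blast
    then obtain d :: "'n \<Rightarrow> real" where d: "\<And>j. H *v e j = d j *\<^sub>R e j" by metis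
    have "H ** U = U ** cdiag (\<lambda>i. of_real (d i))"
    proof -
      have "(H ** U) $ i $ j = (H *v e j) $ i" for i j
        by (simp add: matrix_matrix_mult_def matrix_vector_mult_def U_def)
      moreover have "(U ** cdiag (\<lambda>i. of_real (d i))) $ i $ j = (d j *\<^sub>R e j) $ i" for i j
        by (simp add: matrix_matrix_mult_def cdiag_def U_def if_distrib [where f = "\<lambda>x. _ * x"] cong: if_cong)
           (simp add: scaleR_conv_of_real mult.commute)
      ultimately show ?thesis by (simp add: vec_eq_iff d)
    qed
    then have "H = diag_conj U (\<lambda>i. of_real (d i))"
      using U unfolding diag_conj_def by (metis unitary_cancel(3))
    then show ?thesis by blast
  qed
  ultimately show ?thesis using that by blast
qed

subsection \<open>Absolutely continuous curves\<close>

lemma real_division_element: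
  fixes D :: "real set set"
  assumes "D division_of S" "k \<in> D"
  shows "k = {Inf k..Sup k}" "Inf k \<le> Sup k" "Inf k \<in> S" "Sup k \<in> S"
    "measure lborel k = Sup k - Inf k" "measure lebesgue k = Sup k - Inf k"
proof -
  obtain u v where uv: "k = {u..v}" using division_ofD(4) [OF assms] by (auto simp: cbox_interval)
  have "k \<noteq> {}" "k \<subseteq> S" using division_ofD(2,3) [OF assms] by auto
  then show "k = {Inf k..Sup k}" "Inf k \<le> Sup k" "Inf k \<in> S" "Sup k \<in> S"
    "measure lborel k = Sup k - Inf k" "measure lebesgue k = Sup k - Inf k"
    unfolding uv by auto
qed

lemma absolutely_continuous_on_subinterval:
  assumes "absolutely_continuous_on a b f" "a \<le> c" "d \<le> b"
  shows "absolutely_continuous_on c d f"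
proof -
  have "{c..d} \<subseteq> {a..b}" using assms by auto
  then show ?thesis using assms(1) unfolding absolutely_continuous_on_def by (meson order_trans)
qed

text \<open>Lets the coordinates of a curve, and Lipschitz functions such as \<open>len\<close>
  evaluated along it, inherit absolute continuity.\<close>

lemma absolutely_continuous_on_dominated:
  assumes f: "absolutely_continuous_on a b f"
    and g: "\<And>s t. s \<in> {a..b} \<Longrightarrow> t \<in> {a..b} \<Longrightarrow> norm (g s - g t) \<le> C * norm (f s - f t)"
  shows "absolutely_continuous_on a b g"
  unfolding absolutely_continuous_on_def
proof (intro allI impI)
  fix e :: real assume "e > 0"
  then have "e / (\<bar>C\<bar> + 1) > 0" by simp
  then obtain d where d: "d > 0" "\<And>D S. D division_of S \<Longrightarrow> S \<subseteq> {a..b} \<Longrightarrow> (\<Sum>k\<in>D. measure lborel k) < d \<Longrightarrow>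
        (\<Sum>k\<in>D. norm (f (Sup k) - f (Inf k))) < e / (\<bar>C\<bar> + 1)"
    using f unfolding absolutely_continuous_on_def by metis
  show "\<exists>d>0. \<forall>D S. D division_of S \<and> S \<subseteq> {a..b} \<and> (\<Sum>k\<in>D. measure lborel k) < d \<longrightarrow>
        (\<Sum>k\<in>D. norm (g (Sup k) - g (Inf k))) < e"
  proof (intro exI conjI allI impI)
    fix D S assume D: "D division_of S \<and> S \<subseteq> {a..b} \<and> (\<Sum>k\<in>D. measure lborel k) < d"
    have "(\<Sum>k\<in>D. norm (g (Sup k) - g (Inf k))) \<le> (\<Sum>k\<in>D. (\<bar>C\<bar> + 1) * norm (f (Sup k) - f (Inf k)))"
    proof (rule sum_mono)
      fix k assume "k \<in> D"
      then have "Sup k \<in> {a..b}" "Inf k \<in> {a..b}"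
        using D real_division_element(3,4) [of D S k] by auto
      then have "norm (g (Sup k) - g (Inf k)) \<le> C * norm (f (Sup k) - f (Inf k))" by (rule g)
      also have "\<dots> \<le> (\<bar>C\<bar> + 1) * norm (f (Sup k) - f (Inf k))" by (rule mult_right_mono) auto
      finally show "norm (g (Sup k) - g (Inf k)) \<le> (\<bar>C\<bar> + 1) * norm (f (Sup k) - f (Inf k))" .
    qed
    also have "\<dots> = (\<bar>C\<bar> + 1) * (\<Sum>k\<in>D. norm (f (Sup k) - f (Inf k)))" by (simp add: sum_distrib_left)
    also have "\<dots> < (\<bar>C\<bar> + 1) * (e / (\<bar>C\<bar> + 1))"
      by (rule mult_strict_left_mono) (use d D in auto)
    also have "\<dots> = e" by (simp add: abs_add_one_gt_zero less_imp_neq [symmetric])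
    finally show "(\<Sum>k\<in>D. norm (g (Sup k) - g (Inf k))) < e" .
  qed (rule d)
qed

lemma absolutely_continuous_on_ident: "absolutely_continuous_on a b (\<lambda>t::real. t)"
  unfolding absolutely_continuous_on_def
proof (intro allI impI)
  fix e :: real assume e: "e > 0"
  have "(\<Sum>k\<in>D. norm (Sup k - Inf k)) = (\<Sum>k\<in>D. measure lborel k)" if "D division_of S" for D and S :: "real set"
    by (rule sum.cong) (use real_division_element [OF that] in auto)
  then show "\<exists>d>0. \<forall>D S. D division_of S \<and> S \<subseteq> {a..b} \<and> (\<Sum>k\<in>D. measure lborel k) < d \<longrightarrow>
        (\<Sum>k\<in>D. norm (Sup k - Inf k)) < e"
    using e by (intro exI [of _ e]) auto
qed

lemma absolutely_continuous_on_lipschitz: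
  fixes f :: "real \<Rightarrow> 'a::real_normed_vector"
  assumes "\<And>s t. s \<in> {a..b} \<Longrightarrow> t \<in> {a..b} \<Longrightarrow> norm (f s - f t) \<le> C * \<bar>s - t\<bar>"
  shows "absolutely_continuous_on a b f"
  by (rule absolutely_continuous_on_dominated [OF absolutely_continuous_on_ident]) (use assms in simp)

lemma absolutely_continuous_on_continuous:
  assumes f: "absolutely_continuous_on a b f"
  shows "continuous_on {a..b} f"
  unfolding continuous_on_iff
proof (intro ballI allI impI)
  fix x e assume x: "x \<in> {a..b}" and "(e::real) > 0"
  then obtain d where d: "d > 0" "\<And>D S. D division_of S \<Longrightarrow> S \<subseteq> {a..b} \<Longrightarrow> (\<Sum>k\<in>D. measure lborel k) < d \<Longrightarrow>
        (\<Sum>k\<in>D. norm (f (Sup k) - f (Inf k))) < e"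
    using f unfolding absolutely_continuous_on_def by metis
  have *: "norm (f t - f s) < e" if "s \<le> t" "t - s < d" "s \<in> {a..b}" "t \<in> {a..b}" for s t
    using d(2) [of "{{s..t}}" "{s..t}"] that division_of_self [of s t] by simp
  have "dist (f y) (f x) < e" if "y \<in> {a..b}" "dist y x < d" for y
  proof (cases "x \<le> y")
    case True
    then show ?thesis using * [of x y] that x by (simp add: dist_norm)
  next
    case False
    then have "norm (f x - f y) < e" using * [of y x] that x by (simp add: dist_norm)
    then show ?thesis by (simp add: dist_norm norm_minus_commute)
  qed
  then show "\<exists>d>0. \<forall>x'\<in>{a..b}. dist x' x < d \<longrightarrow> dist (f x') (f x) < e" using d(1) by blast
qed

text \<open>Left endpoints serve as tags, which turns the division into a tagged one, where
  telescoping is known.\<close>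

lemma sum_division_telescope:
  fixes f :: "real \<Rightarrow> 'a::real_normed_vector"
  assumes "a \<le> b" "D division_of {a..b}"
  shows "(\<Sum>k\<in>D. f (Sup k) - f (Inf k)) = f b - f a"
proof -
  let ?p = "(\<lambda>k. (Inf k, k)) ` D"
  have "?p tagged_division_of {a..b}"
  proof (rule tagged_division_ofI)
    show "finite ?p" using assms(2) by (simp add: division_of_finite)
    show "\<Union>{K. \<exists>x. (x, K) \<in> ?p} = {a..b}"
      using division_ofD(6) [OF assms(2)] by (auto simp: image_iff)
    fix x K assume xK: "(x, K) \<in> ?p"
    then have K: "K \<in> D" "x = Inf K" by auto
    show "x \<in> K" using real_division_element(1,2) [OF assms(2) K(1)] K(2) by (metis atLeastAtMost_iff order_refl)
    show "K \<subseteq> {a..b}" "\<exists>a b. K = cbox a b" using division_ofD(2,4) [OF assms(2) K(1)] by auto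
    fix y L assume "(y, L) \<in> ?p" "(x, K) \<noteq> (y, L)"
    then show "interior K \<inter> interior L = {}" using division_ofD(5) [OF assms(2)] K by auto
  qed
  from additive_tagged_division_1 [OF assms(1) this, of f]
  have "sum (\<lambda>(x,K). f (Sup K) - f (Inf K)) ?p = f b - f a" .
  also have "sum (\<lambda>(x,K). f (Sup K) - f (Inf K)) ?p = (\<Sum>k\<in>D. f (Sup k) - f (Inf k))"
    by (subst sum.reindex) (auto simp: inj_on_def)
  finally show ?thesis by simp
qed

text \<open>Truncation at a level \<open>n\<close>: by dominated convergence the excess over
  \<open>n\<close> has integral below \<open>e / 2\<close>, and the truncated part contributes at
  most \<open>n\<close> times the measure of the set.\<close>

lemma integral_small_on_small_sets:
  fixes \<psi> :: "real \<Rightarrow> real"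
  assumes \<psi>: "integrable lborel \<psi>" and nn: "\<And>x. \<psi> x \<ge> 0" and e: "e > 0"
  obtains d where "d > 0" "\<And>A. A \<in> sets borel \<Longrightarrow> emeasure lborel A < ennreal d \<Longrightarrow> (LBINT x:A. \<psi> x) < e"
proof -
  have "(\<lambda>n. integral\<^sup>L lborel (\<lambda>x. min (\<psi> x) (real n))) \<longlonglongrightarrow> integral\<^sup>L lborel \<psi>"
  proof (rule integral_dominated_convergence [where w = \<psi>])
    have "(\<lambda>n. min (\<psi> x) (real n)) \<longlonglongrightarrow> \<psi> x" for x
    proof (rule tendsto_eventually)
      obtain n0 where "\<psi> x \<le> real n0" using real_arch_simple by blast
      then show "\<forall>\<^sub>F n in sequentially. min (\<psi> x) (real n) = \<psi> x"
        unfolding eventually_sequentially by (intro exI [of _ n0]) auto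
    qed
    then show "AE x in lborel. (\<lambda>n. min (\<psi> x) (real n)) \<longlonglongrightarrow> \<psi> x" by simp
  qed (use \<psi> nn in auto)
  then have "\<forall>\<^sub>F n in sequentially. dist (integral\<^sup>L lborel (\<lambda>x. min (\<psi> x) (real n))) (integral\<^sup>L lborel \<psi>) < e / 2"
    by (rule tendstoD) (use e in simp)
  then obtain n where n: "dist (integral\<^sup>L lborel (\<lambda>x. min (\<psi> x) (real n))) (integral\<^sup>L lborel \<psi>) < e / 2"
    unfolding eventually_sequentially by blast
  have im: "integrable lborel (\<lambda>x. min (\<psi> x) (real n))"
    by (rule Bochner_Integration.integrable_bound [OF \<psi>]) (use nn \<psi> in auto)
  define d where "d = e / (2 * (real n + 1))"
  show ?thesis
  proof (rule that [of d])
    show "d > 0" using e by (simp add: d_def)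
    fix A :: "real set" assume A: "A \<in> sets borel" and Ad: "emeasure lborel A < ennreal d"
    have fin: "emeasure lborel A < \<infinity>" using Ad by (metis ennreal_less_top infinity_ennreal_def order.strict_trans)
    have iA: "integrable lborel (\<lambda>x. real n * indicator A x)"
      using A fin by (intro integrable_mult_right integrable_real_indicator) auto
    have "(LBINT x:A. \<psi> x) \<le> integral\<^sup>L lborel (\<lambda>x. (\<psi> x - min (\<psi> x) (real n)) + real n * indicator A x)"
      unfolding set_lebesgue_integral_def
    proof (rule integral_mono)
      show "integrable lborel (\<lambda>x. indicator A x *\<^sub>R \<psi> x)"
        using integrable_mult_indicator [OF _ \<psi>, of A] A by simp
      show "integrable lborel (\<lambda>x. (\<psi> x - min (\<psi> x) (real n)) + real n * indicator A x)"
        using \<psi> im iA by (intro Bochner_Integration.integrable_add Bochner_Integration.integrable_diff)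
    qed (auto simp: indicator_def nn)
    also have "\<dots> = (integral\<^sup>L lborel \<psi> - integral\<^sup>L lborel (\<lambda>x. min (\<psi> x) (real n))) + real n * measure lborel A"
      using \<psi> im iA by simp
    also have "\<dots> < e / 2 + real n * measure lborel A" using n by (simp add: dist_real_def abs_if split: if_splits)
    also have "measure lborel A \<le> d"
      using Ad \<open>d > 0\<close> unfolding measure_def by (intro enn2real_leI) auto
    then have "real n * measure lborel A \<le> real n * d" by (rule mult_left_mono) simp
    also have "real n * d \<le> e / 2" using e by (simp add: d_def field_simps)
    finally show "(LBINT x:A. \<psi> x) < e" by simp
  qed
qed

text \<open>One-sided differentiation for \<open>\<phi>\<close> and for its reflection, glued at
  \<open>x\<close>. Intervals around \<open>x\<close> are needed because the Vitali cover uses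
  intervals that merely contain \<open>x\<close>.\<close>

lemma lebesgue_differentiation_two_sided:
  fixes \<phi> :: "real \<Rightarrow> real"
  assumes \<phi>: "\<And>a b. \<phi> integrable_on {a..b}"
  obtains Z where "negligible Z"
    "\<And>x e. x \<notin> Z \<Longrightarrow> e > 0 \<Longrightarrow> \<exists>d>0. \<forall>s t. s \<le> x \<and> x \<le> t \<and> t - s < d \<longrightarrow>
       \<bar>integral {s..t} \<phi> - \<phi> x * (t - s)\<bar> \<le> e * (t - s)"
proof -
  obtain Z1 where Z1: "negligible Z1" "\<And>x e. \<lbrakk>x \<notin> Z1; 0 < e\<rbrakk> \<Longrightarrow> \<exists>d>0. \<forall>h. 0 < h \<and> h < d \<longrightarrow>
       norm (integral (cbox x (x + h *\<^sub>R One)) \<phi> /\<^sub>R h ^ DIM(real) - \<phi> x) < e"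
    using integrable_ccontinuous_explicit [of \<phi>] \<phi> by (auto simp: cbox_interval)
  have \<phi>': "(\<lambda>x. \<phi> (- x)) integrable_on cbox a b" for a b
    using Henstock_Kurzweil_Integration.integrable_reflect_real [where f = \<phi> and a = "-b" and b = "-a"] \<phi> [of "-b" "-a"] by (simp add: cbox_interval)
  obtain Z2 where Z2: "negligible Z2" "\<And>x e. \<lbrakk>x \<notin> Z2; 0 < e\<rbrakk> \<Longrightarrow> \<exists>d>0. \<forall>h. 0 < h \<and> h < d \<longrightarrow>
       norm (integral (cbox x (x + h *\<^sub>R One)) (\<lambda>x. \<phi> (- x)) /\<^sub>R h ^ DIM(real) - \<phi> (- x)) < e"
    using integrable_ccontinuous_explicit [of "\<lambda>x. \<phi> (- x)"] \<phi>' by auto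
  have Z2': "negligible (uminus ` Z2)"
    by (rule negligible_differentiable_image_negligible [OF _ Z2(1)]) (auto intro!: derivative_intros)
  show ?thesis
  proof (rule that [of "Z1 \<union> uminus ` Z2"])
    show "negligible (Z1 \<union> uminus ` Z2)" using Z1 Z2' by simp
    fix x e :: real assume x: "x \<notin> Z1 \<union> uminus ` Z2" and e: "e > 0"
    have "- x \<notin> Z2" using x by (metis UnI2 image_eqI minus_minus)
    obtain d1 where d1: "d1 > 0" "\<And>h. 0 < h \<Longrightarrow> h < d1 \<Longrightarrow> \<bar>integral {x..x + h} \<phi> / h - \<phi> x\<bar> < e"
      using Z1(2) [of x e] x e by (auto simp: cbox_interval divide_inverse mult.commute)
    obtain d2 where d2: "d2 > 0" "\<And>h. 0 < h \<Longrightarrow> h < d2 \<Longrightarrow> \<bar>integral {-x..-x + h} (\<lambda>x. \<phi> (- x)) / h - \<phi> x\<bar> < e"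
      using Z2(2) [of "-x" e] \<open>- x \<notin> Z2\<close> e by (auto simp: cbox_interval divide_inverse mult.commute)
    show "\<exists>d>0. \<forall>s t. s \<le> x \<and> x \<le> t \<and> t - s < d \<longrightarrow> \<bar>integral {s..t} \<phi> - \<phi> x * (t - s)\<bar> \<le> e * (t - s)"
    proof (intro exI [of _ "min d1 d2"] conjI allI impI)
      show "min d1 d2 > 0" using d1 d2 by simp
      fix s t assume st: "s \<le> x \<and> x \<le> t \<and> t - s < min d1 d2"
      have 1: "\<bar>integral {x..t} \<phi> - \<phi> x * (t - x)\<bar> \<le> e * (t - x)"
      proof (cases "t = x")
        case False
        then have h: "0 < t - x" "t - x < d1" using st by auto
        have "\<bar>integral {x..t} \<phi> / (t - x) - \<phi> x\<bar> < e" using d1(2) [OF h] by simp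
        then have "\<bar>(integral {x..t} \<phi> / (t - x) - \<phi> x)\<bar> * (t - x) \<le> e * (t - x)"
          using h by (intro mult_right_mono) auto
        also have "\<bar>(integral {x..t} \<phi> / (t - x) - \<phi> x)\<bar> * (t - x) = \<bar>(integral {x..t} \<phi> / (t - x) - \<phi> x) * (t - x)\<bar>"
          using h by (simp add: abs_mult)
        also have "(integral {x..t} \<phi> / (t - x) - \<phi> x) * (t - x) = integral {x..t} \<phi> - \<phi> x * (t - x)"
          using h by (simp add: left_diff_distrib)
        finally show ?thesis .
      qed simp
      have 2: "\<bar>integral {s..x} \<phi> - \<phi> x * (x - s)\<bar> \<le> e * (x - s)"
      proof (cases "s = x")
        case False
        then have h: "0 < x - s" "x - s < d2" using st by auto
        have "integral {-x..-s} (\<lambda>x. \<phi> (- x)) = integral {s..x} \<phi>"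
          using integral_reflect_real [where f = \<phi> and a = s and b = x] by simp
        then have "\<bar>integral {s..x} \<phi> / (x - s) - \<phi> x\<bar> < e" using d2(2) [OF h] by simp
        then have "\<bar>(integral {s..x} \<phi> / (x - s) - \<phi> x)\<bar> * (x - s) \<le> e * (x - s)"
          using h by (intro mult_right_mono) auto
        also have "\<bar>(integral {s..x} \<phi> / (x - s) - \<phi> x)\<bar> * (x - s) = \<bar>(integral {s..x} \<phi> / (x - s) - \<phi> x) * (x - s)\<bar>"
          using h by (simp add: abs_mult)
        also have "(integral {s..x} \<phi> / (x - s) - \<phi> x) * (x - s) = integral {s..x} \<phi> - \<phi> x * (x - s)"
          using h by (simp add: left_diff_distrib)
        finally show ?thesis .
      qed simp
      have "integral {s..t} \<phi> = integral {s..x} \<phi> + integral {x..t} \<phi>"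
        using Henstock_Kurzweil_Integration.integral_combine [of s x t \<phi>] \<phi> st by simp
      then show "\<bar>integral {s..t} \<phi> - \<phi> x * (t - s)\<bar> \<le> e * (t - s)"
        using 1 2 by (simp add: algebra_simps abs_le_iff)
    qed
  qed
qed

text \<open>A Vitali covering by intervals on which the slope of \<open>f\<close> does not exceed the mean of \<open>\<phi>\<close>
  by more than \<open>e\<close>; absolute continuity controls the remainder. The slope bound is only needed on
  some arbitrarily short intervals around each point.\<close>

lemma absolutely_continuous_on_le_integral:
  fixes f \<phi> :: "real \<Rightarrow> real"
  assumes f: "absolutely_continuous_on c d f" and cd: "c \<le> d" and \<phi>: "integrable lborel \<phi>"
    and Z: "negligible Z"
    and slope: "\<And>x e \<delta>. x \<in> {c<..<d} - Z \<Longrightarrow> e > 0 \<Longrightarrow> \<delta> > 0 \<Longrightarrow>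
      \<exists>s t. c \<le> s \<and> s \<le> x \<and> x \<le> t \<and> t \<le> d \<and> s < t \<and> t - s < \<delta> \<and> f t - f s \<le> (\<phi> x + e) * (t - s)"
  shows "f d - f c \<le> integral {c..d} \<phi>"
proof (rule field_le_epsilon)
  fix e0 :: real assume e0: "e0 > 0"
  \<comment> \<open>Chosen so that the total error \<open>2 * e * (d - c) + 2 * e\<close> at the end
    is exactly \<open>e0\<close>.\<close>
  define e where "e = e0 / (2 * (d - c) + 2)"
  have e: "e > 0" using e0 cd by (simp add: e_def)
  have ab: "set_integrable lborel {a..b} \<phi>" for a b
    unfolding set_integrable_def using \<phi> by (intro integrable_mult_indicator) auto
  have \<phi>i: "\<phi> integrable_on {a..b}" for a b
    using set_borel_integral_eq_integral(1) [OF ab] .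
  have absi: "integrable lborel (\<lambda>x. \<bar>\<phi> x\<bar>)" using \<phi> by simp
  obtain Z1 where Z1: "negligible Z1" "\<And>x e. x \<notin> Z1 \<Longrightarrow> e > 0 \<Longrightarrow> \<exists>d>0. \<forall>s t. s \<le> x \<and> x \<le> t \<and> t - s < d \<longrightarrow>
       \<bar>integral {s..t} \<phi> - \<phi> x * (t - s)\<bar> \<le> e * (t - s)"
    using lebesgue_differentiation_two_sided [OF \<phi>i] by blast
  \<comment> \<open>The tolerance is \<open>2 * e\<close> because one \<open>e\<close> comes from
    the slope hypothesis and one from replacing \<open>\<phi> x\<close> by the mean of
    \<open>\<phi>\<close> over the interval.\<close>
  define K where "K = {(s, t). c \<le> s \<and> s < t \<and> t \<le> d \<and> f t - f s \<le> integral {s..t} \<phi> + 2 * e * (t - s)}"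
  define m where "m = (\<lambda>p::real\<times>real. (fst p + snd p) / 2)"
  define r where "r = (\<lambda>p::real\<times>real. (snd p - fst p) / 2)"
  have cb: "cball (m p) (r p) = {fst p..snd p}" for p
    by (auto simp: cball_eq_atLeastAtMost m_def r_def field_simps)
  obtain C where C: "countable C" "C \<subseteq> K"
     "pairwise (\<lambda>i j. disjnt (cball (m i) (r i)) (cball (m j) (r j))) C"
     "negligible (({c<..<d} - Z - Z1) - (\<Union>i \<in> C. cball (m i) (r i)))"
  proof (rule Vitali_covering_theorem_cballs [of K r "{c<..<d} - Z - Z1" m])
    show "0 < r i" if "i \<in> K" for i using that by (auto simp: K_def r_def)
    fix x \<delta> :: real assume x: "x \<in> {c<..<d} - Z - Z1" and \<delta>: "0 < \<delta>"
    obtain d1 where d1: "d1 > 0" "\<And>s t. s \<le> x \<and> x \<le> t \<and> t - s < d1 \<Longrightarrow>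
       \<bar>integral {s..t} \<phi> - \<phi> x * (t - s)\<bar> \<le> e * (t - s)"
      using Z1(2) x e by (metis DiffD2)
    obtain s t where st: "c \<le> s" "s \<le> x" "x \<le> t" "t \<le> d" "s < t" "t - s < min \<delta> d1" "f t - f s \<le> (\<phi> x + e) * (t - s)"
      using slope [of x e "min \<delta> d1"] x e \<delta> d1(1) by auto
    have "\<bar>integral {s..t} \<phi> - \<phi> x * (t - s)\<bar> \<le> e * (t - s)" using d1(2) st by simp
    then have "(s, t) \<in> K" using st by (auto simp: K_def algebra_simps)
    then show "\<exists>i. i \<in> K \<and> x \<in> cball (m i) (r i) \<and> r i < \<delta>"
      using st by (intro exI [of _ "(s, t)"]) (auto simp: cb, auto simp: r_def)
  qed auto
  define I where "I = (\<lambda>p::real\<times>real. {fst p..snd p})"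
  have Ccd: "I p \<subseteq> {c..d}" "fst p < snd p" if "p \<in> C" for p
    using that C(2) by (auto simp: I_def K_def)
  obtain \<delta>1 where \<delta>1: "\<delta>1 > 0" "\<And>D S. D division_of S \<Longrightarrow> S \<subseteq> {c..d} \<Longrightarrow> (\<Sum>k\<in>D. measure lborel k) < \<delta>1 \<Longrightarrow>
        (\<Sum>k\<in>D. norm (f (Sup k) - f (Inf k))) < e"
    using f e unfolding absolutely_continuous_on_def by metis
  obtain \<delta>2 where \<delta>2: "\<delta>2 > 0" "\<And>A. A \<in> sets borel \<Longrightarrow> emeasure lborel A < ennreal \<delta>2 \<Longrightarrow> (LBINT x:A. \<bar>\<phi> x\<bar>) < e"
    using integral_small_on_small_sets [OF absi _ e] by auto
  have lmI: "K \<in> lmeasurable" if "K \<in> I ` C" for K using that by (auto simp: I_def)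
  obtain D where D: "D \<subseteq> I ` C" "finite D"
    "measure lebesgue (\<Union>(I ` C)) - min \<delta>1 \<delta>2 < measure lebesgue (\<Union>D)"
  proof (rule measure_countable_Union_approachable [of "I ` C" "min \<delta>1 \<delta>2" "d - c"])
    fix D' assume "D' \<subseteq> I ` C" "finite D'"
    then have "measure lebesgue (\<Union>D') \<le> measure lebesgue {c..d}"
    proof (intro measure_mono_fmeasurable)
      show "\<Union>D' \<subseteq> {c..d}" using Ccd(1) \<open>D' \<subseteq> I ` C\<close> by blast
      show "\<Union>D' \<in> sets lebesgue"
        by (rule sets.finite_Union) (use \<open>finite D'\<close> \<open>D' \<subseteq> I ` C\<close> lmI in \<open>auto intro: fmeasurableD\<close>)
    qed simp
    then show "measure lebesgue (\<Union>D') \<le> d - c" using cd by simp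
  qed (use C(1) \<delta>1 \<delta>2 lmI in auto)
  have "d - c = measure lebesgue (\<Union>(I ` C))"
  proof -
    have sub: "\<Union>(I ` C) \<subseteq> {c..d}" using Ccd by blast
    have "sym_diff (\<Union>(I ` C)) {c..d} \<subseteq> (({c<..<d} - Z - Z1) - (\<Union>i \<in> C. cball (m i) (r i))) \<union> Z \<union> Z1 \<union> {c, d}"
      using sub by (auto simp: cb I_def)
    then have "negligible (sym_diff (\<Union>(I ` C)) {c..d})"
      by (rule negligible_subset [rotated]) (intro negligible_Un C(4) Z Z1(1), simp)
    then have "measure lebesgue (\<Union>(I ` C)) = measure lebesgue {c..d}"
      by (intro measure_negligible_symdiff [symmetric, THEN sym]) (auto intro!: lmI simp: Un_commute)
    then show ?thesis using cd by simp
  qed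
  then have mD: "d - c - min \<delta>1 \<delta>2 < measure lebesgue (\<Union>D)" using D(3) by simp
  have Ddiv: "D division_of \<Union>D"
  proof (rule division_ofI)
    fix k assume "k \<in> D"
    then obtain p where p: "p \<in> C" "k = I p" using D(1) by blast
    show "k \<subseteq> \<Union>D" using \<open>k \<in> D\<close> by blast
    show "k \<noteq> {}" using Ccd(2) [OF p(1)] p by (auto simp: I_def)
    show "\<exists>a b. k = cbox a b" using p by (auto simp: I_def cbox_interval)
    fix l assume "l \<in> D" "k \<noteq> l"
    then obtain q where q: "q \<in> C" "l = I q" using D(1) by blast
    then have "disjnt k l" using C(3) p \<open>k \<noteq> l\<close> unfolding pairwise_def cb I_def by metis
    then show "interior k \<inter> interior l = {}" using interior_subset unfolding disjnt_def by blast
  qed (use D in auto)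
  have "\<Union>D \<subseteq> cbox c d" using D(1) Ccd(1) unfolding cbox_interval by blast
  then obtain q where q: "D \<subseteq> q" "q division_of cbox c d"
    using partial_division_extend_interval [OF Ddiv] by metis
  have qcd: "q division_of {c..d}" using q by (simp add: cbox_interval)
  have finq: "finite q" using q by blast
  \<comment> \<open>The leftover intervals have total length below both thresholds:
    \<open>\<delta>1\<close> bounds the increments of \<open>f\<close> on them,
    \<open>\<delta>2\<close> the integral of \<open>\<phi>\<close>.\<close>
  define R where "R = q - D"
  have Rdiv: "R division_of \<Union>R"
    unfolding R_def using division_of_subset [of q "q - D"] q division_ofD(6) [OF q(2)] by auto
  have Rsub: "\<Union>R \<subseteq> {c..d}" using division_ofD(6) [OF qcd] by (auto simp: R_def)
  have split: "sum g q = sum g D + sum g R" for g :: "real set \<Rightarrow> real"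
    using sum.subset_diff [OF q(1) finq, of g] by (simp add: R_def)
  have len: "(\<Sum>k\<in>q. measure lborel k) = d - c"
    using sum_division_telescope [OF cd qcd, of "\<lambda>x. x"] real_division_element(5) [OF qcd] by simp
  have mUD: "measure lebesgue (\<Union>D) \<le> (\<Sum>k\<in>D. measure lborel k)"
  proof -
    have "measure lebesgue (\<Union>D) \<le> (\<Sum>k\<in>D. measure lebesgue k)"
      using measure_Union_le [of D lebesgue] D lmI by (metis (no_types, lifting) fmeasurableD subsetD)
    also have "\<dots> = (\<Sum>k\<in>D. measure lborel k)"
      using real_division_element(5,6) [OF Ddiv] by (intro sum.cong) auto
    finally show ?thesis .
  qed
  have Rlen: "(\<Sum>k\<in>R. measure lborel k) < min \<delta>1 \<delta>2"
    using split [of "measure lborel"] len mUD mD by linarith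
  have "(\<Sum>k\<in>R. norm (f (Sup k) - f (Inf k))) < e"
    using \<delta>1(2) [OF Rdiv Rsub] Rlen by simp
  moreover have "(\<Sum>k\<in>R. f (Sup k) - f (Inf k)) \<le> (\<Sum>k\<in>R. norm (f (Sup k) - f (Inf k)))"
    by (rule sum_mono) simp
  ultimately have R1: "(\<Sum>k\<in>R. f (Sup k) - f (Inf k)) \<le> e" by linarith
  have R2: "- (\<Sum>k\<in>R. integral k \<phi>) \<le> e"
  proof -
    have finR: "finite R" using finq by (simp add: R_def)
    have Rk: "k = {Inf k..Sup k}" if "k \<in> R" for k using real_division_element(1) [OF Rdiv that] .
    have "emeasure lborel (\<Union>R) \<le> (\<Sum>k\<in>R. emeasure lborel k)"
    proof -
      have "emeasure lborel (\<Union>k\<in>R. k) \<le> (\<Sum>k\<in>R. emeasure lborel k)"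
        by (rule emeasure_subadditive_finite [OF finR]) (use Rk in \<open>metis (no_types, lifting) image_subsetI borel_closed closed_atLeastAtMost sets_lborel\<close>)
      then show ?thesis by simp
    qed
    also have "\<dots> = (\<Sum>k\<in>R. ennreal (measure lborel k))"
    proof (rule sum.cong [OF refl])
      fix k assume k: "k \<in> R"
      have "emeasure lborel {Inf k..Sup k} = ennreal (measure lborel {Inf k..Sup k})"
        by (rule emeasure_eq_ennreal_measure) (simp add: emeasure_lborel_Icc_eq)
      then show "emeasure lborel k = ennreal (measure lborel k)" using Rk [OF k] by simp
    qed
    also have "\<dots> = ennreal (\<Sum>k\<in>R. measure lborel k)" by (simp add: sum_ennreal)
    also have "\<dots> < ennreal \<delta>2" using Rlen \<delta>2(1) by (simp add: ennreal_lessI)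
    finally have em: "emeasure lborel (\<Union>R) < ennreal \<delta>2" .
    have Rb: "\<Union>R \<in> sets borel" using finR Rk
      by (intro sets.finite_Union) (metis borel_closed closed_atLeastAtMost subsetI)+
    have small: "(LBINT x:\<Union>R. \<bar>\<phi> x\<bar>) < e" by (rule \<delta>2(2) [OF Rb em])
    have sR: "set_integrable lborel (\<Union>R) (\<lambda>x. \<bar>\<phi> x\<bar>)"
      unfolding set_integrable_def using absi Rb by (intro integrable_mult_indicator) auto
    have \<phi>a: "(\<lambda>x. \<bar>\<phi> x\<bar>) integrable_on {a..b}" for a b
    proof -
      have "set_integrable lborel {a..b} (\<lambda>x. \<bar>\<phi> x\<bar>)"
        unfolding set_integrable_def using absi by (intro integrable_mult_indicator) auto
      then show ?thesis by (rule set_borel_integral_eq_integral(1))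
    qed
    have "- (\<Sum>k\<in>R. integral k \<phi>) \<le> (\<Sum>k\<in>R. integral k (\<lambda>x. \<bar>\<phi> x\<bar>))"
      unfolding sum_negf [symmetric]
    proof (rule sum_mono)
      fix k assume k: "k \<in> R"
      have "\<bar>integral {Inf k..Sup k} \<phi>\<bar> \<le> integral {Inf k..Sup k} (\<lambda>x. \<bar>\<phi> x\<bar>)"
        using integral_norm_bound_integral [OF \<phi>i \<phi>a] by simp
      then show "- integral k \<phi> \<le> integral k (\<lambda>x. \<bar>\<phi> x\<bar>)" using Rk [OF k] by simp
    qed
    also have "\<dots> = integral (\<Union>R) (\<lambda>x. \<bar>\<phi> x\<bar>)"
      by (rule integral_combine_division_bottomup [OF Rdiv, symmetric]) (use Rk \<phi>a in metis)
    also have "\<dots> = (LBINT x:\<Union>R. \<bar>\<phi> x\<bar>)"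
      by (rule set_borel_integral_eq_integral(2) [OF sR, symmetric])
    finally show ?thesis using small by simp
  qed
  have D1: "(\<Sum>k\<in>D. f (Sup k) - f (Inf k)) \<le> (\<Sum>k\<in>D. integral k \<phi>) + 2 * e * (d - c)"
  proof -
    have "(\<Sum>k\<in>D. f (Sup k) - f (Inf k)) \<le> (\<Sum>k\<in>D. integral k \<phi> + 2 * e * measure lborel k)"
    proof (rule sum_mono)
      fix k assume "k \<in> D"
      then obtain p where p: "p \<in> C" "k = I p" using D(1) by blast
      then have "fst p < snd p" "f (snd p) - f (fst p) \<le> integral {fst p..snd p} \<phi> + 2 * e * (snd p - fst p)"
        using C(2) by (auto simp: K_def)
      then show "f (Sup k) - f (Inf k) \<le> integral k \<phi> + 2 * e * measure lborel k"
        by (simp add: p(2) I_def)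
    qed
    also have "\<dots> = (\<Sum>k\<in>D. integral k \<phi>) + 2 * e * (\<Sum>k\<in>D. measure lborel k)"
      by (simp add: sum.distrib sum_distrib_left)
    also have "(\<Sum>k\<in>D. measure lborel k) \<le> d - c"
      using split [of "measure lborel"] len sum_nonneg [of R "measure lborel"] by simp
    then have "2 * e * (\<Sum>k\<in>D. measure lborel k) \<le> 2 * e * (d - c)" using e by (intro mult_left_mono) auto
    finally show ?thesis by simp
  qed
  have "f d - f c = (\<Sum>k\<in>D. f (Sup k) - f (Inf k)) + (\<Sum>k\<in>R. f (Sup k) - f (Inf k))"
    using sum_division_telescope [OF cd qcd, of f] split by simp
  also have "\<dots> \<le> (\<Sum>k\<in>D. integral k \<phi>) + 2 * e * (d - c) + e" using D1 R1 by linarith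
  also have "\<dots> \<le> (\<Sum>k\<in>q. integral k \<phi>) + 2 * e * (d - c) + 2 * e" using split [of "\<lambda>k. integral k \<phi>"] R2 by linarith
  also have "(\<Sum>k\<in>q. integral k \<phi>) = integral {c..d} \<phi>"
    by (rule integral_combine_division_topdown [OF \<phi>i qcd, symmetric])
  also have "integral {c..d} \<phi> + 2 * e * (d - c) + 2 * e = integral {c..d} \<phi> + e0"
  proof -
    have "2 * (d - c) + 2 \<noteq> 0" using cd by simp
    then have "e * (2 * (d - c) + 2) = e0" by (simp add: e_def)
    then show ?thesis by (simp add: algebra_simps)
  qed
  finally show "f d - f c \<le> integral {c..d} \<phi> + e0" .
qed


text \<open>One \<open>n\<close> beyond \<open>N\<close> is all that can be expected, since the two
  lower limits may be approached along different subsequences. If none existed, then for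
  \<open>Q = 0\<close> the lower limit \<open>P\<close> would be too large, while for
  \<open>Q > 0\<close> eventually \<open>- r n\<close> nearly reaches \<open>Q\<close>, which
  contradicts the assumed lower bound on \<open>r n\<close> because \<open>P\<close> is
  nonnegative.\<close>

lemma liminf_positive_negative_parts:
  fixes r :: "nat \<Rightarrow> real"
  assumes P: "P = liminf (\<lambda>n. ennreal (r n))" "P < \<infinity>"
    and Q: "Q = liminf (\<lambda>n. ennreal (- r n))" "Q < \<infinity>" and e: "e > 0"
  shows "\<exists>n\<ge>N. r n \<le> enn2real P - enn2real Q + e"
proof (rule ccontr)
  assume "\<not> ?thesis"
  then have gt: "r n > enn2real P - enn2real Q + e" if "n \<ge> N" for n using that by (meson not_le)
  show False
  proof (cases "Q = 0")
    case True
    have "ennreal (enn2real P + e) \<le> liminf (\<lambda>n. ennreal (r n))"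
    proof (rule Liminf_bounded, rule eventually_sequentiallyI [of N])
      fix n assume "N \<le> n"
      then show "ennreal (enn2real P + e) \<le> ennreal (r n)" using gt [of n] True by (intro ennreal_leI) simp
    qed
    then have "ennreal (enn2real P + e) \<le> P" using P by simp
    moreover have "P < ennreal (enn2real P + e)"
      using P(2) e by (metis enn2real_nonneg ennreal_enn2real ennreal_lessI infinity_ennreal_def less_add_same_cancel1 add_nonneg_pos)
    ultimately show False by simp
  next
    case False
    define q where "q = enn2real Q"
    have Qq: "Q = ennreal q" and q0: "q > 0"
      using False Q(2) by (auto simp: q_def enn2real_positive_iff top.not_eq_extremum zero_less_iff_neq_zero)
    define e' where "e' = min (e / 2) (q / 2)"
    have e': "e' > 0" "e' < e" "e' < q" using e q0 by (auto simp: e'_def)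
    have "ennreal (q - e') < liminf (\<lambda>n. ennreal (- r n))"
      unfolding Q(1) [symmetric] Qq using e' q0 by (intro ennreal_lessI) auto
    then have ev: "\<forall>\<^sub>F n in sequentially. ennreal (- r n) > ennreal (q - e')" by (rule less_LiminfD)
    then have ev2: "\<forall>\<^sub>F n in sequentially. - r n > q - e'"
      by (rule eventually_mono) (use e' in \<open>auto simp: ennreal_less_iff\<close>)
    then obtain n1 where n1: "\<And>n. n \<ge> n1 \<Longrightarrow> - r n > q - e'" by (auto simp: eventually_sequentially)
    have "- r (max N n1) > q - e'" by (rule n1) simp
    moreover have "r (max N n1) > enn2real P - q + e" using gt [of "max N n1"] by (simp add: q_def)
    moreover have "enn2real P \<ge> 0" by simp
    ultimately show False using e' by linarith
  qed
qed

text \<open>The positive and negative parts of the derivative are produced, by Fatou's lemma, as lower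
  limits of difference quotients along uniform partitions.\<close>

lemma absolutely_continuous_on_short_interval:
  fixes f :: "real \<Rightarrow> real"
  assumes f: "absolutely_continuous_on a b f" and ab: "a < b"
    and BV: "\<And>D. D division_of {a..b} \<Longrightarrow> (\<Sum>k\<in>D. \<bar>f (Sup k) - f (Inf k)\<bar>) \<le> B"
  obtains \<phi> where "integrable lborel \<phi>"
    "\<And>c d. a \<le> c \<Longrightarrow> c \<le> d \<Longrightarrow> d \<le> b \<Longrightarrow> f d - f c = integral {c..d} \<phi>"
proof -
  define h where "h = (\<lambda>n. (b - a) / real (Suc n))"
  define p where "p = (\<lambda>n i. a + real i * h n)"
  have h0: "h n > 0" for n using ab by (simp add: h_def)
  have pS: "p n (Suc i) = p n i + h n" for n i by (simp add: p_def algebra_simps)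
  have pend: "p n 0 = a" "p n (Suc n) = b" for n
    by (simp_all add: p_def h_def)
  have pmono: "p n i \<le> p n j" if "i \<le> j" for n i j
    using that h0 [of n] by (simp add: p_def mult_right_mono)
  \<comment> \<open>The difference quotient of \<open>f\<close> on the cell that contains
    \<open>x\<close>; half-open cells make this cell unique. The partition with index
    \<open>n\<close> has \<open>Suc n\<close> cells of length \<open>h n\<close>.\<close>
  define g where "g = (\<lambda>n x. \<Sum>i\<le>n. (f (p n (Suc i)) - f (p n i)) / h n * indicator {p n i..<p n (Suc i)} x)"
  have g_cell: "g n x = (f (p n (Suc i)) - f (p n i)) / h n" if i: "i \<le> n" and x: "x \<in> {p n i..<p n (Suc i)}" for n x i
  proof -
    have uniq: "j = i" if "x \<in> {p n j..<p n (Suc j)}" for j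
    proof (rule ccontr)
      assume "j \<noteq> i"
      then consider "Suc j \<le> i" | "Suc i \<le> j" by linarith
      then show False using that x pmono [of "Suc j" i n] pmono [of "Suc i" j n] by cases auto
    qed
    have "(f (p n (Suc j)) - f (p n j)) / h n * indicator {p n j..<p n (Suc j)} x
      = (if j = i then (f (p n (Suc i)) - f (p n i)) / h n else 0)" for j
    proof (cases "j = i")
      case True
      then show ?thesis using x by simp
    next
      case False
      then have "x \<notin> {p n j..<p n (Suc j)}" using uniq by blast
      then show ?thesis using False by simp
    qed
    then have "g n x = (\<Sum>j\<le>n. if j = i then (f (p n (Suc i)) - f (p n i)) / h n else 0)"
      unfolding g_def by (intro sum.cong refl)
    then show ?thesis using i by simp
  qed
  have cell: "\<exists>i\<le>n. x \<in> {p n i..<p n (Suc i)}" if x: "a \<le> x" "x < b" for n x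
  proof -
    define i where "i = (LEAST i. x < p n (Suc i))"
    have ex: "x < p n (Suc n)" using x pend by simp
    have 1: "x < p n (Suc i)" unfolding i_def by (rule LeastI [of "\<lambda>i. x < p n (Suc i)", OF ex])
    have 2: "i \<le> n" unfolding i_def by (rule Least_le [of "\<lambda>i. x < p n (Suc i)", OF ex])
    have "p n i \<le> x"
    proof (cases i)
      case 0 then show ?thesis using x pend by simp
    next
      case (Suc j)
      then have "\<not> x < p n (Suc j)" using not_less_Least [of j "\<lambda>i. x < p n (Suc i)"] by (simp add: i_def)
      then show ?thesis using Suc by simp
    qed
    with 1 2 show ?thesis by auto
  qed
  have gm [measurable]: "g n \<in> borel_measurable borel" for n unfolding g_def by measurable
  have var: "(\<Sum>i\<le>n. \<bar>f (p n (Suc i)) - f (p n i)\<bar>) \<le> B" for n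
  proof -
    let ?D = "(\<lambda>i. {p n i..p n (Suc i)}) ` {..n}"
    have lt: "p n i < p n (Suc i)" for i using pS h0 by simp
    have inj: "inj_on (\<lambda>i. {p n i..p n (Suc i)}) {..n}"
    proof (rule inj_onI)
      fix i j assume "{p n i..p n (Suc i)} = {p n j..p n (Suc j)}"
      then have "p n i = p n j" using lt by (metis Icc_eq_Icc less_imp_le)
      then show "i = j" using h0 [of n] by (simp add: p_def)
    qed
    have "?D division_of {a..b}"
    proof (rule division_ofI)
      show "\<Union>?D = {a..b}"
      proof
        show "\<Union>?D \<subseteq> {a..b}"
        proof (intro Union_least)
          fix k assume "k \<in> ?D"
          then obtain i where i: "i \<le> n" "k = {p n i..p n (Suc i)}" by blast
          show "k \<subseteq> {a..b}" using i pmono [of 0 i n] pmono [of "Suc i" "Suc n" n] pend by auto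
        qed
        show "{a..b} \<subseteq> \<Union>?D"
        proof
          fix x assume x: "x \<in> {a..b}"
          show "x \<in> \<Union>?D"
          proof (cases "x = b")
            case True
            then have "x \<in> {p n n..p n (Suc n)}" using pend lt [of n] by simp
            then show ?thesis by blast
          next
            case False
            then obtain i where "i \<le> n" "x \<in> {p n i..<p n (Suc i)}" using cell [of x n] x by auto
            then show ?thesis by force
          qed
        qed
      qed
      fix k assume "k \<in> ?D"
      then obtain i where i: "i \<le> n" "k = {p n i..p n (Suc i)}" by blast
      show "k \<subseteq> {a..b}" using i pmono [of 0 i n] pmono [of "Suc i" "Suc n" n] pend by auto
      show "k \<noteq> {}" "\<exists>a b. k = cbox a b" using i lt [of i] by (auto simp: cbox_interval)
      fix l assume "l \<in> ?D" "k \<noteq> l"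
      then obtain j where j: "l = {p n j..p n (Suc j)}" by blast
      have "i \<noteq> j" using \<open>k \<noteq> l\<close> i j by auto
      then consider "Suc j \<le> i" | "Suc i \<le> j" by linarith
      then show "interior k \<inter> interior l = {}"
        using i j pmono [of "Suc j" i n] pmono [of "Suc i" j n] by cases auto
    qed simp
    from BV [OF this] show ?thesis
      using less_imp_le [OF lt] by (simp add: sum.reindex [OF inj])
  qed
  \<comment> \<open>The integral of \<open>\<bar>g n\<bar>\<close> is at most the variation of
    \<open>f\<close> over the partition, so \<open>B\<close> bounds it uniformly in
    \<open>n\<close>, as Fatou's lemma requires.\<close>
  have int_le: "(\<integral>\<^sup>+x. ennreal (\<bar>g n x\<bar>) \<partial>lborel) \<le> ennreal B" for n
  proof -
    let ?c = "\<lambda>i. \<bar>f (p n (Suc i)) - f (p n i)\<bar> / h n"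
    have "ennreal \<bar>g n x\<bar> \<le> (\<Sum>i\<le>n. ennreal (?c i) * indicator {p n i..<p n (Suc i)} x)" for x
    proof -
      have "\<bar>g n x\<bar> \<le> (\<Sum>i\<le>n. \<bar>(f (p n (Suc i)) - f (p n i)) / h n * indicator {p n i..<p n (Suc i)} x\<bar>)"
        unfolding g_def by (rule sum_abs)
      also have "\<dots> = (\<Sum>i\<le>n. ?c i * indicator {p n i..<p n (Suc i)} x)"
        using h0 [of n] by (intro sum.cong) (auto simp: abs_mult indicator_def)
      finally have "ennreal \<bar>g n x\<bar> \<le> ennreal (\<Sum>i\<le>n. ?c i * indicator {p n i..<p n (Suc i)} x)"
        by (rule ennreal_leI)
      also have "\<dots> = (\<Sum>i\<le>n. ennreal (?c i * indicator {p n i..<p n (Suc i)} x))"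
        using h0 [of n] by (intro sum_ennreal [symmetric]) (auto simp: indicator_def)
      also have "\<dots> = (\<Sum>i\<le>n. ennreal (?c i) * indicator {p n i..<p n (Suc i)} x)"
        by (intro sum.cong) (auto simp: indicator_def)
      finally show ?thesis .
    qed
    then have "(\<integral>\<^sup>+x. ennreal (\<bar>g n x\<bar>) \<partial>lborel)
      \<le> (\<integral>\<^sup>+x. (\<Sum>i\<le>n. ennreal (?c i) * indicator {p n i..<p n (Suc i)} x) \<partial>lborel)"
      by (intro nn_integral_mono)
    also have "\<dots> = (\<Sum>i\<le>n. \<integral>\<^sup>+x. ennreal (?c i) * indicator {p n i..<p n (Suc i)} x \<partial>lborel)"
      by (rule nn_integral_sum) auto
    also have "\<dots> = (\<Sum>i\<le>n. ennreal (?c i) * emeasure lborel {p n i..<p n (Suc i)})"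
      by (intro sum.cong refl nn_integral_cmult_indicator) auto
    also have "\<dots> = (\<Sum>i\<le>n. ennreal \<bar>f (p n (Suc i)) - f (p n i)\<bar>)"
    proof (intro sum.cong refl)
      fix i
      have "ennreal (?c i) * emeasure lborel {p n i..<p n (Suc i)} = ennreal (?c i) * ennreal (h n)"
        using h0 [of n] by (simp add: pS)
      also have "\<dots> = ennreal (?c i * h n)" using h0 [of n] by (intro ennreal_mult [symmetric]) auto
      finally show "ennreal (?c i) * emeasure lborel {p n i..<p n (Suc i)} = ennreal \<bar>f (p n (Suc i)) - f (p n i)\<bar>"
        using h0 [of n] by simp
    qed
    also have "\<dots> = ennreal (\<Sum>i\<le>n. \<bar>f (p n (Suc i)) - f (p n i)\<bar>)" by (simp add: sum_ennreal)
    also have "\<dots> \<le> ennreal B" by (rule ennreal_leI [OF var])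
    finally show ?thesis .
  qed
  define P where "P = (\<lambda>x. liminf (\<lambda>n. ennreal (g n x)))"
  define Q where "Q = (\<lambda>x. liminf (\<lambda>n. ennreal (- g n x)))"
  have Pm [measurable]: "P \<in> borel_measurable borel" and Qm [measurable]: "Q \<in> borel_measurable borel"
    unfolding P_def Q_def by measurable
  have fatou: "(\<integral>\<^sup>+x. liminf (\<lambda>n. ennreal (s * g n x)) \<partial>lborel) \<le> ennreal B" if s: "\<bar>s\<bar> = 1" for s
  proof -
    have "(\<integral>\<^sup>+x. liminf (\<lambda>n. ennreal (s * g n x)) \<partial>lborel) \<le> liminf (\<lambda>n. \<integral>\<^sup>+x. ennreal (s * g n x) \<partial>lborel)"
      by (rule nn_integral_liminf) measurable
    also have "\<dots> \<le> ennreal B"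
    proof (rule Liminf_le)
      have "(\<integral>\<^sup>+x. ennreal (s * g n x) \<partial>lborel) \<le> (\<integral>\<^sup>+x. ennreal (\<bar>g n x\<bar>) \<partial>lborel)" for n
        using s by (intro nn_integral_mono ennreal_leI) (metis abs_ge_self abs_mult mult_1)
      then show "\<forall>\<^sub>F n in sequentially. (\<integral>\<^sup>+x. ennreal (s * g n x) \<partial>lborel) \<le> ennreal B"
        using int_le order_trans by (intro always_eventually) blast
    qed simp
    finally show ?thesis .
  qed
  have fP: "(\<integral>\<^sup>+x. P x \<partial>lborel) < \<infinity>" and fQ: "(\<integral>\<^sup>+x. Q x \<partial>lborel) < \<infinity>"
    using fatou [of 1] fatou [of "-1"] unfolding P_def Q_def
    by (auto simp: less_top [symmetric] top_unique intro: le_less_trans)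
  have aeP: "AE x in lborel. P x \<noteq> \<infinity>" and aeQ: "AE x in lborel. Q x \<noteq> \<infinity>"
    using fP fQ nn_integral_PInf_AE [of P lborel] nn_integral_PInf_AE [of Q lborel] by auto
  define \<phi> where "\<phi> = (\<lambda>x. enn2real (P x) - enn2real (Q x))"
  have ir: "integrable lborel (\<lambda>x. enn2real (W x))"
    if [measurable]: "W \<in> borel_measurable borel" and fW: "(\<integral>\<^sup>+x. W x \<partial>lborel) < \<infinity>" for W :: "real \<Rightarrow> ennreal"
  proof (rule integrableI_bounded)
    have "ennreal (enn2real w) \<le> w" for w by (cases w rule: ennreal_cases) auto
    then have "(\<integral>\<^sup>+x. ennreal (norm (enn2real (W x))) \<partial>lborel) \<le> (\<integral>\<^sup>+x. W x \<partial>lborel)"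
      by (intro nn_integral_mono) simp
    then show "(\<integral>\<^sup>+x. ennreal (norm (enn2real (W x))) \<partial>lborel) < \<infinity>" using fW by (rule le_less_trans)
  qed measurable
  have i\<phi>: "integrable lborel \<phi>" unfolding \<phi>_def using ir [OF Pm fP] ir [OF Qm fQ] by simp
  have "AE x in lborel. P x < \<infinity> \<and> Q x < \<infinity>"
    using aeP aeQ by eventually_elim (simp add: less_top)
  then obtain Z where Z: "Z \<in> null_sets lborel" "{x. \<not> (P x < \<infinity> \<and> Q x < \<infinity>)} \<subseteq> Z"
    by (elim AE_E) (auto simp: null_sets_def)
  have negZ: "negligible Z" using Z(1) by (simp add: negligible_iff_null_sets null_sets_completionI)
  \<comment> \<open>The sign \<open>\<sigma>\<close> covers \<open>f\<close> with
    \<open>\<phi>\<close> and \<open>- f\<close> with \<open>- \<phi>\<close> at once, which gives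
    the two inequalities between the increment and the integral.\<close>
  have slope: "\<exists>s t. c \<le> s \<and> s \<le> x \<and> x \<le> t \<and> t \<le> d \<and> s < t \<and> t - s < \<delta> \<and> \<sigma> * (f t - f s) \<le> (\<sigma> * \<phi> x + e) * (t - s)"
    if cd: "a \<le> c" "d \<le> b" and x: "x \<in> {c<..<d} - Z" and e: "e > 0" and \<delta>: "\<delta> > 0" and \<sigma>: "\<sigma> = 1 \<or> \<sigma> = -1"
    for c d x e \<delta> \<sigma>
  proof -
    have fin: "P x < \<infinity>" "Q x < \<infinity>" using Z x by auto
    define \<rho> where "\<rho> = Min {\<delta>, x - c, d - x}"
    have \<rho>: "\<rho> > 0" "\<rho> \<le> \<delta>" "\<rho> \<le> x - c" "\<rho> \<le> d - x" using x \<delta> by (auto simp: \<rho>_def)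
    obtain N where N: "(b - a) / \<rho> < real N" using reals_Archimedean2 by blast
    have hN: "h n < \<rho>" if "n \<ge> N" for n
    proof -
      have "(b - a) / \<rho> < real (Suc n)" using N that by linarith
      then show ?thesis using \<rho> by (simp add: h_def field_simps)
    qed
    obtain n where n: "n \<ge> N" "\<sigma> * g n x \<le> \<sigma> * \<phi> x + e"
    proof (cases "\<sigma> = 1")
      case True
      then show ?thesis
        using liminf_positive_negative_parts [of "P x" "\<lambda>n. g n x" "Q x" e N] fin e that
        by (auto simp: P_def Q_def \<phi>_def)
    next
      case False
      then have "\<sigma> = -1" using \<sigma> by simp
      then show ?thesis
        using liminf_positive_negative_parts [of "Q x" "\<lambda>n. - g n x" "P x" e N] fin e that
        by (auto simp: P_def Q_def \<phi>_def algebra_simps)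
    qed
    obtain i where i: "i \<le> n" "x \<in> {p n i..<p n (Suc i)}" using cell [of x n] x cd by auto
    have hn: "h n < \<rho>" using hN n by blast
    have "\<sigma> * (f (p n (Suc i)) - f (p n i)) = \<sigma> * g n x * h n"
      using g_cell [OF i] h0 [of n] by simp
    also have "\<dots> \<le> (\<sigma> * \<phi> x + e) * h n" using n h0 [of n] by (intro mult_right_mono) auto
    finally show ?thesis
      using i hn \<rho> pS [of n i] by (intro exI [of _ "p n i"] exI [of _ "p n (Suc i)"]) auto
  qed
  have main: "f d - f c = integral {c..d} \<phi>" if cd: "a \<le> c" "c \<le> d" "d \<le> b" for c d
  proof (rule antisym)
    have acf: "absolutely_continuous_on c d f" by (rule absolutely_continuous_on_subinterval [OF f cd(1,3)])
    show "f d - f c \<le> integral {c..d} \<phi>"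
      by (rule absolutely_continuous_on_le_integral [OF acf cd(2) i\<phi> negZ])
         (use slope [OF cd(1,3), of _ _ _ 1] in auto)
    have acf': "absolutely_continuous_on c d (\<lambda>x. - f x)"
      by (rule absolutely_continuous_on_dominated [OF acf, of _ 1]) (simp add: abs_minus_commute)
    have i\<phi>': "integrable lborel (\<lambda>x. - \<phi> x)" using i\<phi> by simp
    have "(- f d) - (- f c) \<le> integral {c..d} (\<lambda>x. - \<phi> x)"
      by (rule absolutely_continuous_on_le_integral [OF acf' cd(2) i\<phi>' negZ])
         (use slope [OF cd(1,3), of _ _ _ "-1"] in \<open>auto simp: algebra_simps\<close>)
    then show "integral {c..d} \<phi> \<le> f d - f c" by simp
  qed
  show ?thesis by (rule that [OF i\<phi> main])
qed

text \<open>Absolute continuity bounds the variation directly on intervals shorter than some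
  \<open>\<delta>\<close>. There \<open>f\<close> is an indefinite integral, and Bolzano's principle
  glues adjacent intervals.\<close>

theorem absolutely_continuous_on_has_derivative:
  fixes f :: "real \<Rightarrow> real"
  assumes "a \<le> b" and f: "absolutely_continuous_on a b f"
  shows "\<exists>\<phi> Z. negligible Z \<and> \<phi> absolutely_integrable_on {a..b} \<and> integral {a..b} \<phi> = f b - f a \<and>
    (\<forall>t\<in>{a..b} - Z. (f has_real_derivative \<phi> t) (at t))"
proof -
  define W where "W = (\<lambda>c d. \<exists>\<phi> Z. negligible Z \<and> \<phi> absolutely_integrable_on {c..d} \<and>
    integral {c..d} \<phi> = f d - f c \<and> (\<forall>t\<in>{c..d} - Z. (f has_real_derivative \<phi> t) (at t)))"
  obtain \<delta> where \<delta>: "\<delta> > 0" "\<And>D S. D division_of S \<Longrightarrow> S \<subseteq> {a..b} \<Longrightarrow> (\<Sum>k\<in>D. measure lborel k) < \<delta> \<Longrightarrow>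
        (\<Sum>k\<in>D. norm (f (Sup k) - f (Inf k))) < 1"
    using f unfolding absolutely_continuous_on_def by (metis zero_less_one)
  have loc: "W c d" if cd: "a \<le> c" "c \<le> d" "d \<le> b" "d - c < \<delta>" for c d
  proof (cases "c = d")
    case True
    show ?thesis unfolding W_def
      by (rule exI [of _ "\<lambda>x. 0"], rule exI [of _ "{c}"]) (use True in \<open>simp add: set_integrable_def\<close>)
  next
    case False
    then have "c < d" using cd by simp
    have acf: "absolutely_continuous_on c d f" by (rule absolutely_continuous_on_subinterval [OF f cd(1,3)])
    have BV: "(\<Sum>k\<in>D. \<bar>f (Sup k) - f (Inf k)\<bar>) \<le> 1" if D: "D division_of {c..d}" for D
    proof -
      have "(\<Sum>k\<in>D. measure lborel k) = d - c"
        using sum_division_telescope [OF cd(2) D, of "\<lambda>x. x"] real_division_element(5) [OF D] by simp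
      then show ?thesis using \<delta>(2) [OF D] cd by auto
    qed
    obtain \<phi> where \<phi>: "integrable lborel \<phi>"
      "\<And>s t. c \<le> s \<Longrightarrow> s \<le> t \<Longrightarrow> t \<le> d \<Longrightarrow> f t - f s = integral {s..t} \<phi>"
      using absolutely_continuous_on_short_interval [OF acf \<open>c < d\<close> BV] by metis
    have si: "set_integrable lborel {s..t} \<phi>" for s t
      unfolding set_integrable_def using \<phi>(1) by (intro integrable_mult_indicator) auto
    obtain Z where Z: "negligible Z" "\<And>x e. x \<notin> Z \<Longrightarrow> e > 0 \<Longrightarrow> \<exists>d>0. \<forall>s t. s \<le> x \<and> x \<le> t \<and> t - s < d \<longrightarrow>
       \<bar>integral {s..t} \<phi> - \<phi> x * (t - s)\<bar> \<le> e * (t - s)"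
      using lebesgue_differentiation_two_sided [OF set_borel_integral_eq_integral(1) [OF si]] by blast
    \<comment> \<open>The endpoints join the exceptional set: the derivative is two-sided, and the
      integral formula is known only inside \<open>{c..d}\<close>.\<close>
    have "(f has_real_derivative \<phi> t) (at t)" if t: "t \<in> {c..d} - (Z \<union> {c, d})" for t
      unfolding has_field_derivative_def has_derivative_at_alt
    proof (intro conjI allI impI)
      show "bounded_linear ((*) (\<phi> t))" by (rule bounded_linear_mult_right)
      fix e :: real assume "e > 0"
      then obtain d0 where d0: "d0 > 0" "\<And>s u. s \<le> t \<Longrightarrow> t \<le> u \<Longrightarrow> u - s < d0 \<Longrightarrow>
        \<bar>integral {s..u} \<phi> - \<phi> t * (u - s)\<bar> \<le> e * (u - s)" using Z(2) t by (metis DiffD2 UnI1)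
      show "\<exists>d>0. \<forall>y. norm (y - t) < d \<longrightarrow> norm (f y - f t - \<phi> t * (y - t)) \<le> e * norm (y - t)"
      proof (intro exI [of _ "Min {d0, t - c, d - t}"] conjI allI impI)
        show "Min {d0, t - c, d - t} > 0" using d0 t by auto
        fix y assume "norm (y - t) < Min {d0, t - c, d - t}"
        then have y: "\<bar>y - t\<bar> < d0" "c \<le> y" "y \<le> d" by auto
        show "norm (f y - f t - \<phi> t * (y - t)) \<le> e * norm (y - t)"
        proof (cases "t \<le> y")
          case True
          then show ?thesis using d0(2) [of t y] \<phi>(2) [of t y] y t by simp
        next
          case False
          then have "f t - f y = integral {y..t} \<phi>" using \<phi>(2) [of y t] y t by simp
          then have "f y - f t - \<phi> t * (y - t) = - (integral {y..t} \<phi> - \<phi> t * (t - y))"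
            by (simp add: algebra_simps)
          then have "norm (f y - f t - \<phi> t * (y - t)) = \<bar>integral {y..t} \<phi> - \<phi> t * (t - y)\<bar>"
            by (simp only: real_norm_def abs_minus_cancel)
          also have "\<dots> \<le> e * (t - y)" using d0(2) [of y t] y False by simp
          finally show ?thesis using False by simp
        qed
      qed
    qed
    moreover have "\<phi> absolutely_integrable_on {c..d}"
      using si [of c d] unfolding set_integrable_def by (rule integrable_completion [THEN iffD2, rotated]) (use borel_measurable_integrable [OF \<phi>(1)] in simp)
    moreover have "integral {c..d} \<phi> = f d - f c" using \<phi>(2) [of c d] cd by simp
    ultimately show ?thesis
      unfolding W_def using Z(1) by (intro exI [of _ \<phi>] exI [of _ "Z \<union> {c, d}"]) simp
  qed
  have "a \<le> a \<and> b \<le> b \<longrightarrow> W a b" using \<open>a \<le> b\<close>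
  proof (induction rule: Bolzano [where P = "\<lambda>c d. a \<le> c \<and> d \<le> b \<longrightarrow> W c d"])
    case (trans c m d)
    show ?case
    proof
      assume "a \<le> c \<and> d \<le> b"
      then have "W c m" "W m d" using trans by auto
      then obtain \<phi>1 Z1 \<phi>2 Z2 where
        1: "negligible Z1" "\<phi>1 absolutely_integrable_on {c..m}" "integral {c..m} \<phi>1 = f m - f c"
          "\<And>t. t\<in>{c..m} - Z1 \<Longrightarrow> (f has_real_derivative \<phi>1 t) (at t)" and
        2: "negligible Z2" "\<phi>2 absolutely_integrable_on {m..d}" "integral {m..d} \<phi>2 = f d - f m"
          "\<And>t. t\<in>{m..d} - Z2 \<Longrightarrow> (f has_real_derivative \<phi>2 t) (at t)"
        unfolding W_def by metis
      define \<phi> where "\<phi> = (\<lambda>t. if t < m then \<phi>1 t else \<phi>2 t)"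
      have a1: "\<phi> absolutely_integrable_on {c..m}"
        using absolutely_integrable_spike [OF 1(2), of "{m}" \<phi>] by (auto simp: \<phi>_def)
      have a2: "\<phi> absolutely_integrable_on {m..d}"
        using absolutely_integrable_spike [OF 2(2), of "{}" \<phi>] by (auto simp: \<phi>_def)
      have i1: "integral {c..m} \<phi> = f m - f c"
        using integral_spike [of "{m}" "{c..m}" \<phi>1 \<phi>] 1(3) by (auto simp: \<phi>_def)
      have i2: "integral {m..d} \<phi> = f d - f m"
        using integral_spike [of "{}" "{m..d}" \<phi>2 \<phi>] 2(3) by (auto simp: \<phi>_def)
      have cup: "{c..m} \<union> {m..d} = {c..d}" using trans by auto
      have ai: "\<phi> absolutely_integrable_on {c..d}"
        using absolutely_integrable_Un [OF a1 a2] cup by simp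
      moreover have "integral {c..d} \<phi> = f d - f c"
        using Henstock_Kurzweil_Integration.integral_combine [of c m d \<phi>] trans i1 i2
          set_lebesgue_integral_eq_integral(1) [OF ai] by simp
      ultimately show "W c d"
        unfolding W_def using 1 2
        by (intro exI [of _ \<phi>] exI [of _ "Z1 \<union> Z2"]) (auto simp: \<phi>_def)
    qed
  next
    case (local x)
    then show ?case using loc \<delta>(1) by (intro exI [of _ \<delta>]) auto
  qed
  then show ?thesis unfolding W_def by simp
qed


theorem absolutely_continuous_on_has_vector_derivative:
  fixes \<gamma> :: "real \<Rightarrow> 'a::euclidean_space"
  assumes ab: "a \<le> b" and \<gamma>: "absolutely_continuous_on a b \<gamma>"
  obtains \<gamma>' Z where "negligible Z" "\<gamma>' absolutely_integrable_on {a..b}"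
    "\<And>t. t \<in> {a..b} - Z \<Longrightarrow> (\<gamma> has_vector_derivative \<gamma>' t) (at t)"
proof -
  have "\<exists>\<phi> Z. negligible Z \<and> \<phi> absolutely_integrable_on {a..b} \<and>
      integral {a..b} \<phi> = \<gamma> b \<bullet> i - \<gamma> a \<bullet> i \<and>
      (\<forall>t\<in>{a..b} - Z. ((\<lambda>t. \<gamma> t \<bullet> i) has_real_derivative \<phi> t) (at t))" if i: "i \<in> Basis" for i
  proof (rule absolutely_continuous_on_has_derivative [OF ab])
    show "absolutely_continuous_on a b (\<lambda>t. \<gamma> t \<bullet> i)"
      by (rule absolutely_continuous_on_dominated [OF \<gamma>, of _ 1])
         (metis Basis_le_norm i inner_diff_left mult_1 real_norm_def)
  qed
  then obtain \<phi> Z where Z: "\<And>i. i \<in> Basis \<Longrightarrow> negligible (Z i)"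
    and \<phi>: "\<And>i. i \<in> Basis \<Longrightarrow> \<phi> i absolutely_integrable_on {a..b}"
    and d: "\<And>i t. i \<in> Basis \<Longrightarrow> t \<in> {a..b} - Z i \<Longrightarrow> ((\<lambda>t. \<gamma> t \<bullet> i) has_real_derivative \<phi> i t) (at t)"
    by metis
  define \<gamma>' where "\<gamma>' = (\<lambda>t. \<Sum>i\<in>Basis. \<phi> i t *\<^sub>R i)"
  show ?thesis
  proof (rule that [of "\<Union>(Z ` Basis)" \<gamma>'])
    show "negligible (\<Union>(Z ` Basis))" using Z by auto
    have "(\<lambda>t. \<phi> i t *\<^sub>R i) absolutely_integrable_on {a..b}" if "i \<in> Basis" for i
      using absolutely_integrable_linear [OF \<phi> [OF that] bounded_linear_scaleR_left [of i]] by (simp add: o_def)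
    then show "\<gamma>' absolutely_integrable_on {a..b}"
      unfolding \<gamma>'_def by (intro absolutely_integrable_sum) auto
    fix t assume t: "t \<in> {a..b} - \<Union>(Z ` Basis)"
    have "((\<lambda>t. (\<gamma> t \<bullet> i) *\<^sub>R i) has_vector_derivative \<phi> i t *\<^sub>R i) (at t)" if "i \<in> Basis" for i
    proof -
      have "((\<lambda>t. \<gamma> t \<bullet> i) has_real_derivative \<phi> i t) (at t)" using d [OF that] t that by blast
      from has_vector_derivative_scaleR [OF this has_vector_derivative_const [of i]]
      show ?thesis by simp
    qed
    then have "((\<lambda>t. \<Sum>i\<in>Basis. (\<gamma> t \<bullet> i) *\<^sub>R i) has_vector_derivative \<gamma>' t) (at t)"
      unfolding \<gamma>'_def by (intro has_vector_derivative_sum) auto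
    then show "(\<gamma> has_vector_derivative \<gamma>' t) (at t)" by (simp add: euclidean_representation)
  qed
qed

section \<open>Seminorms and the length of curves\<close>

text \<open>Only a seminorm: in the orthogonal case the real norm is carried to complex matrices
  through the real part, which annihilates imaginary matrices.\<close>

locale seminorm =
  fixes N :: "'a::euclidean_space \<Rightarrow> real"
  assumes triangle: "N (x + y) \<le> N x + N y"
    and scale: "N (c *\<^sub>R x) = \<bar>c\<bar> * N x"
begin

lemma zero [simp]: "N 0 = 0"
  using scale [of 0 0] by simp

lemma uminus [simp]: "N (- x) = N x"
  using scale [of "-1" x] by simp

lemma nonneg [simp]: "0 \<le> N x"
  using triangle [of x "- x"] by simp

lemma diff_commute: "N (x - y) = N (y - x)"
  using uminus [of "x - y"] by simp

lemma le_norm: obtains C where "C > 0" "\<And>x. N x \<le> C * norm x"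
proof
  show "(\<Sum>i\<in>Basis. N i) + 1 > 0" by (simp add: add_nonneg_pos sum_nonneg)
  fix x
  have N_sum: "N (sum f S) \<le> (\<Sum>i\<in>S. N (f i))" if "finite S" for f :: "'a \<Rightarrow> 'a" and S
    using that by induction (auto intro: order_trans [OF triangle])
  have "N x = N (\<Sum>i\<in>Basis. (x \<bullet> i) *\<^sub>R i)" by (simp add: euclidean_representation)
  also have "\<dots> \<le> (\<Sum>i\<in>Basis. N ((x \<bullet> i) *\<^sub>R i))" by (rule N_sum) simp
  also have "\<dots> \<le> (\<Sum>i\<in>Basis. norm x * N i)"
    by (intro sum_mono) (simp add: scale mult_right_mono Basis_le_norm)
  also have "\<dots> \<le> ((\<Sum>i\<in>Basis. N i) + 1) * norm x"
    by (simp add: sum_distrib_right [symmetric] distrib_right mult.commute [of "norm x"])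
  finally show "N x \<le> ((\<Sum>i\<in>Basis. N i) + 1) * norm x" .
qed

lemma triangle_diff: "\<bar>N x - N y\<bar> \<le> N (x - y)"
  using triangle [of "x - y" y] triangle [of "y - x" x] diff_commute [of x y] by simp

lemma continuous_on_seminorm: "continuous_on S N"
proof -
  obtain C where C: "C > 0" "\<And>x. N x \<le> C * norm x" by (rule le_norm, rule that)
  have "dist (N x) (N y) \<le> C * dist x y" for x y
    using triangle_diff [of x y] C(2) [of "x - y"] by (simp add: dist_norm)
  then have "C-lipschitz_on UNIV N" using C(1) by (intro lipschitz_onI) auto
  then show ?thesis using lipschitz_on_continuous_on continuous_on_subset by blast
qed

text \<open>The derivative \<open>\<gamma>'\<close> provided by absolute continuity agrees with
  \<open>vector_derivative\<close> off a null set, and a multiple of its integrable norm dominates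
  the speed.\<close>

lemma curve_speed_integrable:
  assumes "a \<le> b" "absolutely_continuous_on a b \<gamma>"
  shows "(\<lambda>t. N (vector_derivative \<gamma> (at t))) absolutely_integrable_on {a..b}"
proof -
  obtain \<gamma>' Z where Z: "negligible Z" and i: "\<gamma>' absolutely_integrable_on {a..b}"
    and d: "\<And>t. t \<in> {a..b} - Z \<Longrightarrow> (\<gamma> has_vector_derivative \<gamma>' t) (at t)"
    by (rule absolutely_continuous_on_has_vector_derivative [OF assms], rule that)
  obtain C where C: "C > 0" "\<And>x. N x \<le> C * norm x" by (rule le_norm, rule that)
  have "(\<lambda>t. N (\<gamma>' t)) absolutely_integrable_on {a..b}"
  proof (rule measurable_bounded_by_integrable_imp_absolutely_integrable)
    have "\<gamma>' \<in> borel_measurable (lebesgue_on {a..b})"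
      using i by (auto simp: absolutely_integrable_measurable)
    moreover have "N \<in> borel_measurable borel"
      by (rule borel_measurable_continuous_onI [OF continuous_on_seminorm])
    ultimately show "(\<lambda>t. N (\<gamma>' t)) \<in> borel_measurable (lebesgue_on {a..b})"
      by (rule measurable_compose)
    show "(\<lambda>t. C * norm (\<gamma>' t)) integrable_on {a..b}"
      using i by (simp add: absolutely_integrable_on_def integrable_on_mult_right)
  qed (use C in auto)
  then show ?thesis
    by (rule absolutely_integrable_spike [OF _ Z]) (use vector_derivative_at [OF d] in simp)
qed

lemma curve_speed_integrable_on:
  assumes "a \<le> b" "absolutely_continuous_on a b \<gamma>"
  shows "(\<lambda>t. N (vector_derivative \<gamma> (at t))) integrable_on {a..b}"
  using curve_speed_integrable [OF assms] by (rule set_lebesgue_integral_eq_integral(1))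

text \<open>A speed that is not integrable has integral \<open>0\<close> by convention, so the bound
  covers every \<open>\<gamma>\<close>.\<close>

lemma curve_length_nonneg: "0 \<le> curve_length N a b \<gamma>"
  unfolding curve_length_def by (cases "(\<lambda>t. N (vector_derivative \<gamma> (at t))) integrable_on {a..b}")
    (auto intro: integral_nonneg simp: not_integrable_integral)

lemma curve_length_refl [simp]: "curve_length N a a \<gamma> = 0"
  by (simp add: curve_length_def)

lemma curve_length_combine:
  assumes "absolutely_continuous_on a b \<gamma>" "a \<le> c" "c \<le> b"
  shows "curve_length N a b \<gamma> = curve_length N a c \<gamma> + curve_length N c b \<gamma>"
  unfolding curve_length_def
  by (rule Henstock_Kurzweil_Integration.integral_combine [symmetric])
     (use assms curve_speed_integrable_on in auto)

lemma continuous_on_curve_length: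
  assumes "a \<le> b" "absolutely_continuous_on a b \<gamma>"
  shows "continuous_on {a..b} (\<lambda>t. curve_length N a t \<gamma>)"
  unfolding curve_length_def
  by (rule indefinite_integral_continuous_1 [OF curve_speed_integrable_on [OF assms]])

lemma curve_length_constant_speed:
  assumes "a \<le> b" "\<And>t. (\<gamma> has_vector_derivative \<gamma>' t) (at t)" "\<And>t. N (\<gamma>' t) = m"
  shows "curve_length N a b \<gamma> = m * (b - a)"
  using assms by (simp add: curve_length_def vector_derivative_at [OF assms(2)])

text \<open>The source of all lower bounds on length. The Lipschitz condition makes \<open>g\<close>
  absolutely continuous, so \<open>g b - g a\<close> is the integral of its derivative, and
  derivative and speed have to be compared only at points where both exist.\<close>

lemma le_curve_length:
  fixes g :: "real \<Rightarrow> real"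
  assumes ab: "a \<le> b" and \<gamma>: "absolutely_continuous_on a b \<gamma>"
    and lip: "\<And>s t. s \<in> {a..b} \<Longrightarrow> t \<in> {a..b} \<Longrightarrow> \<bar>g s - g t\<bar> \<le> C * norm (\<gamma> s - \<gamma> t)"
    and deriv: "\<And>t y D. t \<in> {a<..<b} \<Longrightarrow> (\<gamma> has_vector_derivative y) (at t) \<Longrightarrow>
      (g has_real_derivative D) (at t) \<Longrightarrow> D \<le> N y"
  shows "g b - g a \<le> curve_length N a b \<gamma>"
proof -
  obtain \<gamma>' Z where Z: "negligible Z" and i: "\<gamma>' absolutely_integrable_on {a..b}"
    and d: "\<And>t. t \<in> {a..b} - Z \<Longrightarrow> (\<gamma> has_vector_derivative \<gamma>' t) (at t)"
    by (rule absolutely_continuous_on_has_vector_derivative [OF ab \<gamma>], rule that)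
  have "absolutely_continuous_on a b g"
    by (rule absolutely_continuous_on_dominated [OF \<gamma>]) (use lip in simp)
  then obtain \<phi> Z' where Z': "negligible Z'" and \<phi>: "\<phi> absolutely_integrable_on {a..b}"
    and int: "integral {a..b} \<phi> = g b - g a"
    and d': "\<And>t. t \<in> {a..b} - Z' \<Longrightarrow> (g has_real_derivative \<phi> t) (at t)"
    using absolutely_continuous_on_has_derivative [OF ab] by metis
  let ?Z = "Z \<union> Z' \<union> {a, b}"
  \<comment> \<open>On the exceptional set the derivative is replaced by \<open>0\<close>, which
    nonnegativity of \<open>N\<close> puts below the speed, whatever default
    \<open>vector_derivative\<close> has there.\<close>
  have "integral {a..b} \<phi> = integral {a..b} (\<lambda>t. if t \<in> ?Z then 0 else \<phi> t)"
    by (rule integral_spike [of ?Z]) (use Z Z' in auto)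
  also have "\<dots> \<le> integral {a..b} (\<lambda>t. N (vector_derivative \<gamma> (at t)))"
  proof (rule integral_le)
    show "(\<lambda>t. if t \<in> ?Z then 0 else \<phi> t) integrable_on {a..b}"
      by (rule integrable_spike [OF set_lebesgue_integral_eq_integral(1) [OF \<phi>], of ?Z]) (use Z Z' in auto)
    show "(\<lambda>t. N (vector_derivative \<gamma> (at t))) integrable_on {a..b}"
      by (rule curve_speed_integrable_on [OF ab \<gamma>])
    fix t assume t: "t \<in> {a..b}"
    show "(if t \<in> ?Z then 0 else \<phi> t) \<le> N (vector_derivative \<gamma> (at t))"
    proof (cases "t \<in> ?Z")
      case False
      then have "\<phi> t \<le> N (\<gamma>' t)" using t d d' deriv [of t "\<gamma>' t" "\<phi> t"] by auto
      then show ?thesis using False t vector_derivative_at [OF d, of t] by simp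
    qed simp
  qed
  finally show ?thesis using int by (simp add: curve_length_def)
qed

end

subsection \<open>Scalar inequalities on the unit circle\<close>

lemma cis_Arg_unit: "cmod z = 1 \<Longrightarrow> cis (Arg z) = z"
  using cis_Arg [of z] by (cases "z = 0") (auto simp: sgn_eq)

lemma unit_polar:
  assumes "cmod z = 1"
  obtains a where "z = cis a" "- pi < a" "a \<le> pi" "Arg z = a"
  using that [of "Arg z"] assms cis_Arg_unit mpi_less_Arg Arg_le_pi by metis

text \<open>Jordan's inequality: by concavity \<open>sin\<close> lies above its chord between
  \<open>0\<close> and \<open>pi / 2\<close>.\<close>

lemma sin_ge_chord:
  assumes "0 \<le> x" "x \<le> pi / 2" shows "2 / pi * x \<le> sin x"
proof -
  have "concave_on {0..pi/2} sin"
    by (rule f''_le0_imp_concave [where f' = cos and f'' = "\<lambda>x. - sin x"])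
       (auto intro!: derivative_eq_intros sin_ge_zero)
  from concave_onD [OF this, of "2 / pi * x" 0 "pi / 2"]
  have "2 / pi * x * sin (pi / 2) \<le> sin (2 / pi * x * (pi / 2))"
    using assms by (simp add: field_simps)
  then show ?thesis by simp
qed

lemma cmod_cis_diff: "(cmod (cis a - cis b))\<^sup>2 = 2 - 2 * cos (a - b)"
proof -
  have "(cmod (cis a - cis b))\<^sup>2 = (cos a - cos b)\<^sup>2 + (sin a - sin b)\<^sup>2" by (simp add: cmod_power2)
  also have "\<dots> = ((sin a)\<^sup>2 + (cos a)\<^sup>2) + ((sin b)\<^sup>2 + (cos b)\<^sup>2) - 2 * cos (a - b)"
    unfolding cos_diff by (simp add: power2_eq_square algebra_simps)
  finally show ?thesis by simp
qed

text \<open>Half the chord of an arc \<open>t\<close> is \<open>sin (\<bar>t\<bar> / 2)\<close>, to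
  which Jordan's inequality applies; \<open>2 - 2 * cos t\<close> is the squared chord.\<close>

lemma arc_le_chord:
  assumes "\<bar>t\<bar> \<le> pi" shows "t\<^sup>2 \<le> (pi / 2)\<^sup>2 * (2 - 2 * cos t)"
proof -
  have "2 / pi * \<bar>t / 2\<bar> \<le> sin \<bar>t / 2\<bar>" using assms by (intro sin_ge_chord) auto
  then have "\<bar>t\<bar> \<le> pi * sin \<bar>t / 2\<bar>" by (simp add: field_simps)
  then have "\<bar>t\<bar>\<^sup>2 \<le> (pi * sin \<bar>t / 2\<bar>)\<^sup>2" by (rule power_mono) simp
  also have "\<dots> = pi\<^sup>2 * (sin (t / 2))\<^sup>2" by (simp add: power_mult_distrib abs_if)
  also have "\<dots> = (pi / 2)\<^sup>2 * (2 - 2 * cos (2 * (t / 2)))"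
    unfolding cos_double_sin by (simp add: power_divide)
  finally show ?thesis by simp
qed

text \<open>For positive arguments monotonicity suffices: \<open>1 - cos x\<close> is at most
  \<open>x * x / 2\<close>, hence at most \<open>2 * x\<close> as long as \<open>x \<le> 4\<close>.
  The range covers differences of two angles in \<open>{0..pi}\<close>.\<close>

lemma diff_sin_le_square:
  assumes "t \<le> 4" shows "t - sin t \<le> (t::real)\<^sup>2"
proof (cases "t \<le> 0")
  case True
  then have "t - sin t \<le> 0" using sin_x_ge_neg_x [of "-t"] sin_x_le_x [of "-t"] by simp
  then show ?thesis using zero_le_power2 [of t] by linarith
next
  case False
  have "0\<^sup>2 - 0 + sin 0 \<le> t\<^sup>2 - t + sin t"
  proof (rule DERIV_nonneg_imp_nondecreasing [of 0 t "\<lambda>t. t\<^sup>2 - t + sin t"])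
    fix x assume x: "0 \<le> x" "x \<le> t"
    have "1 - cos x = 2 * (sin (x / 2))\<^sup>2" using cos_double_sin [of "x / 2"] by simp
    also have "(sin (x / 2))\<^sup>2 \<le> (x / 2)\<^sup>2"
      using abs_sin_x_le_abs_x [of "x / 2"] by (simp only: abs_le_square_iff)
    also have "2 * (x / 2)\<^sup>2 = x * x / 2" by (simp add: power2_eq_square)
    also have "x * x \<le> 4 * x" using x assms by (intro mult_right_mono) auto
    finally have "0 \<le> 2 * x - 1 + cos x" by simp
    moreover have "((\<lambda>x. x\<^sup>2 - x + sin x) has_real_derivative (2 * x - 1 + cos x)) (at x)"
      by (auto intro!: derivative_eq_intros)
    ultimately show "\<exists>y. ((\<lambda>x. x\<^sup>2 - x + sin x) has_real_derivative y) (at x) \<and> 0 \<le> y" by blast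
  qed (use False in simp)
  then show ?thesis by simp
qed

lemma abs_Arg_cnj: "\<bar>Arg (cnj z)\<bar> = \<bar>Arg z\<bar>"
  by (simp add: Arg_cnj)

text \<open>Folding the circle onto its upper half by \<open>\<bar>Arg\<bar>\<close> only shortens
  chords, and on the half circle arc and chord are comparable. The jump of \<open>Arg\<close> at
  \<open>-1\<close> disappears in the folding.\<close>

lemma abs_Arg_lipschitz:
  assumes "cmod z = 1" "cmod w = 1"
  shows "(\<bar>Arg z\<bar> - \<bar>Arg w\<bar>)\<^sup>2 \<le> (pi / 2)\<^sup>2 * (cmod (z - w))\<^sup>2"
proof -
  obtain a b where a: "z = cis a" "- pi < a" "a \<le> pi" "Arg z = a" and b: "w = cis b" "- pi < b" "b \<le> pi" "Arg w = b"
    using unit_polar assms by metis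
  have "\<bar>\<bar>a\<bar> - \<bar>b\<bar>\<bar> \<le> pi" using a b by auto
  then have "(\<bar>a\<bar> - \<bar>b\<bar>)\<^sup>2 \<le> (pi / 2)\<^sup>2 * (2 - 2 * cos (\<bar>a\<bar> - \<bar>b\<bar>))" by (rule arc_le_chord)
  also have "cos (a - b) \<le> cos (\<bar>a\<bar> - \<bar>b\<bar>)"
  proof -
    have "sin a * sin b \<le> \<bar>sin a\<bar> * \<bar>sin b\<bar>" by (metis abs_ge_self abs_mult)
    moreover have "\<bar>sin a\<bar> = sin \<bar>a\<bar>" "\<bar>sin b\<bar> = sin \<bar>b\<bar>"
      using a b sin_ge_zero [of "\<bar>a\<bar>"] sin_ge_zero [of "\<bar>b\<bar>"] by (auto simp: abs_if)
    ultimately show ?thesis by (simp add: cos_diff)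
  qed
  then have "(pi / 2)\<^sup>2 * (2 - 2 * cos (\<bar>a\<bar> - \<bar>b\<bar>)) \<le> (pi / 2)\<^sup>2 * (cmod (z - w))\<^sup>2"
    unfolding a(1) b(1) cmod_cis_diff by (intro mult_left_mono) auto
  finally show ?thesis using a b by simp
qed

text \<open>The unit tangent \<open>i z\<close> at \<open>z\<close>, oriented so that \<open>\<bar>Arg\<bar>\<close> increases; at the two real points,
  where \<open>\<bar>Arg\<bar>\<close> has a kink, the normal \<open>z\<close> serves instead.\<close>

definition arg_gradient :: "complex \<Rightarrow> complex" where
  "arg_gradient z = z * (if Im z > 0 then \<i> else if Im z < 0 then - \<i> else 1)"

lemma arg_gradient_cnj: "arg_gradient (cnj z) = cnj (arg_gradient z)"
  by (auto simp: arg_gradient_def)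

lemma cmod_arg_gradient: "cmod (arg_gradient z) = cmod z"
  by (simp add: arg_gradient_def norm_mult)

text \<open>A one-sided Taylor estimate based at \<open>z\<close> with quadratic error.
  \<open>C\<close> is a parameter because it has to be uniform in one of the two points while the
  other is fixed.\<close>

definition arg_defect :: "complex \<Rightarrow> complex \<Rightarrow> real \<Rightarrow> bool" where
  "arg_defect z w C \<longleftrightarrow>
    \<bar>Arg z\<bar> - \<bar>Arg w\<bar> \<le> Re (cnj (arg_gradient z) * (z - w)) + C * (cmod (z - w))\<^sup>2"

lemma arg_defect_mono: "arg_defect z w C \<Longrightarrow> C \<le> C' \<Longrightarrow> arg_defect z w C'"
  unfolding arg_defect_def by (meson add_left_mono mult_right_mono order_trans zero_le_power2)

lemma arg_defect_cnj: "arg_defect (cnj z) (cnj w) C \<longleftrightarrow> arg_defect z w C"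
proof -
  have "cmod (cnj z - cnj w) = cmod (z - w)" by (metis complex_cnj_diff complex_mod_cnj)
  moreover have "Re (cnj (arg_gradient (cnj z)) * (cnj z - cnj w)) = Re (cnj (arg_gradient z) * (z - w))"
    by (simp add: arg_gradient_cnj algebra_simps)
  ultimately show ?thesis by (simp add: arg_defect_def abs_Arg_cnj)
qed

text \<open>On the closed upper half circle the linear term is exactly \<open>sin (a - b)\<close>
  for the two angles, so the error is \<open>a - b - sin (a - b)\<close>.\<close>

lemma arg_defect_same_side:
  assumes z: "cmod z = 1" "Im z > 0" and w: "cmod w = 1" "Im w \<ge> 0"
  shows "arg_defect z w ((pi / 2)\<^sup>2)"
proof -
  obtain a b where a: "z = cis a" "- pi < a" "a \<le> pi" "Arg z = a" and b: "w = cis b" "- pi < b" "b \<le> pi" "Arg w = b"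
    using unit_polar z w by metis
  have ab: "0 \<le> a" "0 \<le> b" using z w a b Arg_less_0 [of z] Arg_less_0 [of w] by auto
  have "Re (cnj (arg_gradient z) * (z - w)) = sin (a - b)"
  proof -
    have "Re (cnj (arg_gradient z) * (z - w)) = Im (z * cnj w)"
      using z by (simp add: arg_gradient_def algebra_simps)
    also have "\<dots> = sin (a - b)" using a b by (simp add: sin_diff)
    finally show ?thesis .
  qed
  moreover have "a - b - sin (a - b) \<le> (a - b)\<^sup>2"
    using a ab pi_less_4 by (intro diff_sin_le_square) linarith
  moreover have "(a - b)\<^sup>2 \<le> (pi / 2)\<^sup>2 * (cmod (z - w))\<^sup>2"
    unfolding a(1) b(1) cmod_cis_diff by (rule arc_le_chord) (use a b ab in auto)
  ultimately show ?thesis unfolding arg_defect_def using a b ab by simp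
qed

text \<open>Across the real axis no expansion is attempted: the points are at distance at least
  \<open>m\<close>, so the quadratic term alone is at least \<open>pi + 2\<close>, where
  \<open>pi\<close> covers the angles and \<open>2\<close> the linear term.\<close>

lemma arg_defect_opposite_side:
  assumes z: "cmod z = 1" "Im z > 0" and w: "cmod w = 1" "Im w < 0"
    and m: "m > 0" "m \<le> \<bar>Im z\<bar> \<or> m \<le> \<bar>Im w\<bar>"
  shows "arg_defect z w ((pi + 2) / m\<^sup>2)"
proof -
  have "\<bar>Im (z - w)\<bar> \<le> cmod (z - w)" by (rule abs_Im_le_cmod)
  then have "m \<le> cmod (z - w)" using z w m by auto
  then have "m\<^sup>2 \<le> (cmod (z - w))\<^sup>2" using m by (intro power_mono) auto
  then have "(pi + 2) / m\<^sup>2 * m\<^sup>2 \<le> (pi + 2) / m\<^sup>2 * (cmod (z - w))\<^sup>2" by (intro mult_left_mono) auto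
  then have 1: "pi + 2 \<le> (pi + 2) / m\<^sup>2 * (cmod (z - w))\<^sup>2" using m by simp
  have "\<bar>Re (cnj (arg_gradient z) * (z - w))\<bar> \<le> cmod (cnj (arg_gradient z) * (z - w))" by (rule abs_Re_le_cmod)
  also have "\<dots> = cmod (z - w)" using z by (simp add: norm_mult cmod_arg_gradient)
  also have "\<dots> \<le> 2" using norm_triangle_ineq4 [of z w] z w by simp
  finally show ?thesis
    using 1 Arg_le_pi [of z] mpi_less_Arg [of z] unfolding arg_defect_def by linarith
qed

lemma arg_defect_1: "cmod w = 1 \<Longrightarrow> arg_defect 1 w 0"
  using complex_Re_le_cmod [of w] by (simp add: arg_defect_def arg_gradient_def)

text \<open>The linear term is \<open>1 + Re w\<close>, nonnegative but of second order near
  \<open>w = -1\<close>, while the left side is of first order there. The constant makes the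
  quadratic term equal to \<open>pi\<close> and blows up as \<open>w\<close> approaches
  \<open>-1\<close>.\<close>

lemma arg_defect_uminus_1:
  assumes "cmod w = 1" "w \<noteq> - 1"
  shows "arg_defect (- 1) w (pi / (cmod (- 1 - w))\<^sup>2)"
proof -
  have "- 1 \<le> Re w" using abs_Re_le_cmod [of w] assms by linarith
  moreover have "\<bar>Arg (-1)\<bar> \<le> pi" using Arg_le_pi mpi_less_Arg by (simp add: abs_le_iff less_imp_le minus_le_iff)
  moreover have "cmod (- 1 - w) \<noteq> 0" using assms by auto
  ultimately show ?thesis by (simp add: arg_defect_def arg_gradient_def)
qed

lemma arg_defect_fixed_target:
  assumes w: "cmod w = 1"
  shows "\<exists>C\<ge>0. \<forall>z. cmod z = 1 \<longrightarrow> arg_defect z w C"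
proof -
  \<comment> \<open>One summand each for points on the same side, on opposite sides, and for
    \<open>z = -1\<close>. When a denominator vanishes, the summand is \<open>0\<close> and its case
    is either void or trivial.\<close>
  define C where "C = (pi / 2)\<^sup>2 + (pi + 2) / (Im w)\<^sup>2 + pi / (cmod (- 1 - w))\<^sup>2"
  have pos: "C \<ge> 0" "(pi / 2)\<^sup>2 \<le> C" "(pi + 2) / \<bar>Im w\<bar>\<^sup>2 \<le> C" "pi / (cmod (- 1 - w))\<^sup>2 \<le> C"
    by (auto simp: C_def)
  have upper: "arg_defect z w' C" if "cmod z = 1" "Im z > 0" "cmod w' = 1" "\<bar>Im w'\<bar> = \<bar>Im w\<bar>" for z w'
  proof (cases "Im w' \<ge> 0")
    case True
    then show ?thesis using arg_defect_mono [OF arg_defect_same_side pos(2)] that by blast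
  next
    case False
    then show ?thesis using arg_defect_mono [OF arg_defect_opposite_side [of z w' "\<bar>Im w\<bar>"] pos(3)] that by auto
  qed
  have "arg_defect z w C" if z: "cmod z = 1" for z
  proof -
    consider "Im z > 0" | "Im z < 0" | "Im z = 0" by linarith
    then show ?thesis
    proof cases
      case 1
      then show ?thesis using upper z w by blast
    next
      case 2
      then have "arg_defect (cnj z) (cnj w) C" using upper [of "cnj z" "cnj w"] z w by simp
      then show ?thesis by (simp add: arg_defect_cnj)
    next
      case 3
      then have "(Re z)\<^sup>2 = 1" using z cmod_power2 [of z] by simp
      then have "z = 1 \<or> z = -1" using 3 by (auto simp: complex_eq_iff power2_eq_1_iff)
      moreover have "arg_defect 1 w C" using arg_defect_mono [OF arg_defect_1 [OF w] pos(1)] .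
      moreover have "arg_defect (-1) w C"
      proof (cases "w = -1")
        case True then show ?thesis by (simp add: arg_defect_def)
      next
        case False then show ?thesis using arg_defect_mono [OF arg_defect_uminus_1 [OF w] pos(4)] by blast
      qed
      ultimately show ?thesis by blast
    qed
  qed
  then show ?thesis using pos by blast
qed

text \<open>\<open>C\<close> has to serve all \<open>w\<close> at once, including those close to
  \<open>-1\<close>; the kink rules this out for \<open>z = -1\<close>.\<close>

lemma arg_defect_fixed_source:
  assumes z: "cmod z = 1" "z \<noteq> -1"
  shows "\<exists>C\<ge>0. \<forall>w. cmod w = 1 \<longrightarrow> arg_defect z w C"
proof -
  define C where "C = (pi / 2)\<^sup>2 + (pi + 2) / (Im z)\<^sup>2"
  have pos: "C \<ge> 0" "(pi / 2)\<^sup>2 \<le> C" "(pi + 2) / \<bar>Im z\<bar>\<^sup>2 \<le> C" by (auto simp: C_def)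
  have upper: "arg_defect z' w C" if "cmod z' = 1" "Im z' > 0" "cmod w = 1" "\<bar>Im z'\<bar> = \<bar>Im z\<bar>" for z' w
  proof (cases "Im w \<ge> 0")
    case True
    then show ?thesis using arg_defect_mono [OF arg_defect_same_side pos(2)] that by blast
  next
    case False
    then show ?thesis using arg_defect_mono [OF arg_defect_opposite_side [of z' w "\<bar>Im z\<bar>"] pos(3)] that by auto
  qed
  have "arg_defect z w C" if w: "cmod w = 1" for w
  proof -
    consider "Im z > 0" | "Im z < 0" | "Im z = 0" by linarith
    then show ?thesis
    proof cases
      case 1
      then show ?thesis using upper z w by blast
    next
      case 2
      then have "arg_defect (cnj z) (cnj w) C" using upper [of "cnj z" "cnj w"] z w by simp
      then show ?thesis by (simp add: arg_defect_cnj)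
    next
      case 3
      then have "(Re z)\<^sup>2 = 1" using z cmod_power2 [of z] by simp
      then have "z = 1" using 3 z by (auto simp: complex_eq_iff power2_eq_1_iff)
      then show ?thesis using arg_defect_mono [OF arg_defect_1 [OF w] pos(1)] by simp
    qed
  qed
  then show ?thesis using pos by blast
qed

subsection \<open>Exponentials\<close>

lemma linear_diag_conj_component:
  "bounded_linear (\<lambda>z. diag_conj (U::complex^'n^'n) (\<lambda>i. if i = k then z else 0))"
proof -
  have "linear (\<lambda>z. diag_conj U (\<lambda>i. if i = k then z else 0))"
    by (rule linearI) (auto simp: diag_conj_add diag_conj_scaleR intro!: arg_cong [of _ _ "diag_conj U"])
  then show ?thesis by (simp add: linear_conv_bounded_linear)
qed

text \<open>A finite sum of bounded linear maps of the single eigenvalues, so that limits and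
  derivatives can be taken eigenvalue by eigenvalue.\<close>

lemma diag_conj_sum: "diag_conj (U::complex^'n^'n) f = (\<Sum>k\<in>UNIV. diag_conj U (\<lambda>i. if i = k then f k else 0))"
  by (simp add: vec_eq_iff diag_conj_nth if_distrib [where f = "\<lambda>x. _ * x"] if_distrib [where f = "\<lambda>x. x * _"] cong: if_cong)

lemma tendsto_diag_conj:
  assumes "\<And>i. ((\<lambda>t. f t i) \<longlongrightarrow> g i) F"
  shows "((\<lambda>t. diag_conj U (f t)) \<longlongrightarrow> diag_conj U g) F"
  unfolding diag_conj_sum [of U "f _"] diag_conj_sum [of U g]
  by (intro tendsto_sum bounded_linear.tendsto [OF linear_diag_conj_component] assms)

lemma has_vector_derivative_diag_conj:
  assumes "\<And>i. ((\<lambda>t. f t i) has_vector_derivative g i) (at t)"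
  shows "((\<lambda>t. diag_conj U (f t)) has_vector_derivative diag_conj U g) (at t)"
  unfolding diag_conj_sum [of U "f _"] diag_conj_sum [of U g]
  by (intro has_vector_derivative_sum bounded_linear.has_vector_derivative [OF linear_diag_conj_component] assms)

lemma matrix_power_diag_conj:
  assumes "unitary_matrix U"
  shows "((**) (diag_conj U f) ^^ k) (mat 1) = diag_conj U (\<lambda>i. f i ^ k)"
  by (induction k) (simp_all add: diag_conj_1 [OF assms] diag_conj_mult [OF assms])

text \<open>Convergence is recorded along with the value, so that it can be transported to real
  matrices by a bounded linear map.\<close>

lemma matrix_exp_sums_diag_conj:
  assumes U: "unitary_matrix U"
  shows "(\<lambda>k. (((**) (diag_conj U f) ^^ k) (mat 1)) /\<^sub>R fact k) sums diag_conj U (\<lambda>i. exp (f i))"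
proof -
  have *: "(\<Sum>k<n. diag_conj U (g k)) = diag_conj U (\<lambda>i. \<Sum>k<n. g k i)" for g :: "nat \<Rightarrow> 'a \<Rightarrow> complex" and n
    by (induction n) (simp_all add: diag_conj_add)
  have "(\<lambda>n. \<Sum>k<n. f i ^ k /\<^sub>R fact k) \<longlonglongrightarrow> exp (f i)" for i
    using exp_converges [of "f i"] by (simp add: sums_def)
  then show ?thesis
    unfolding sums_def matrix_power_diag_conj [OF U] diag_conj_scaleR * by (rule tendsto_diag_conj)
qed

lemma matrix_exp_diag_conj:
  assumes "unitary_matrix U" shows "matrix_exp (diag_conj U f) = diag_conj U (\<lambda>i. exp (f i))"
  unfolding matrix_exp_def using matrix_exp_sums_diag_conj [OF assms] by (rule sums_unique [symmetric])

lemma map_matrix_mult_left: "map_matrix ((*) c) A ** B = map_matrix ((*) c) (A ** B)"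
  for A B :: "complex^'n^'n"
  by (simp add: vec_eq_iff matrix_matrix_mult_def sum_distrib_left mult_ac)

lemma map_matrix_mult_right: "A ** map_matrix ((*) c) B = map_matrix ((*) c) (A ** B)"
  for A B :: "complex^'n^'n"
  by (simp add: vec_eq_iff matrix_matrix_mult_def sum_distrib_left mult_ac)

lemma map_matrix_diag_conj: "map_matrix ((*) c) (diag_conj U f) = diag_conj U (\<lambda>i. c * f i)"
  by (simp add: vec_eq_iff diag_conj_nth sum_distrib_left mult_ac)

lemma map_matrix_adjoint: "adjoint_matrix (map_matrix ((*) c) A) = map_matrix ((*) (cnj c)) (adjoint_matrix A)"
  by (simp add: vec_eq_iff)

text \<open>Commuting normal families are diagonalized through their real and imaginary parts.\<close>

theorem normal_diagonalization:
  fixes \<N> :: "(complex^'n^'n) set"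
  assumes c: "\<And>A B. A \<in> \<N> \<Longrightarrow> B \<in> \<N> \<Longrightarrow> A ** B = B ** A"
    and a: "\<And>A B. A \<in> \<N> \<Longrightarrow> B \<in> \<N> \<Longrightarrow> A ** adjoint_matrix B = adjoint_matrix B ** A"
  obtains U where "unitary_matrix U" "\<And>A. A \<in> \<N> \<Longrightarrow> \<exists>f. A = diag_conj U f"
proof -
  define re where "re = (\<lambda>A::complex^'n^'n. A + adjoint_matrix A)"
  define im where "im = (\<lambda>A::complex^'n^'n. map_matrix ((*) \<i>) (adjoint_matrix A - A))"
  have aa: "adjoint_matrix A ** adjoint_matrix B = adjoint_matrix B ** adjoint_matrix A"
    if "A \<in> \<N>" "B \<in> \<N>" for A B using c [OF that] by (metis adjoint_mult)
  have 1: "X ** Y = Y ** X"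
    if AB: "A \<in> \<N>" "B \<in> \<N>" and X: "X = re A \<or> X = im A" and Y: "Y = re B \<or> Y = im B" for A B X Y
  proof -
    have mm: "map_matrix ((*) \<i>) (P + Q) = map_matrix ((*) \<i>) P + map_matrix ((*) \<i>) Q"
      "map_matrix ((*) \<i>) (P - Q) = map_matrix ((*) \<i>) P - map_matrix ((*) \<i>) Q" for P Q :: "complex^'n^'n"
      by (simp_all add: vec_eq_iff algebra_simps)
    show ?thesis
      using X Y c [OF AB] a [OF AB] a [OF AB(2,1)] aa [OF AB]
      by (auto simp: re_def im_def map_matrix_mult_left map_matrix_mult_right matrix_mult_add_left matrix_mult_add_right
        matrix_mult_diff_left matrix_mult_diff_right mm)
  qed
  have 2: "adjoint_matrix X = X" if "X = re A \<or> X = im A" for X A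
  proof -
    have "adjoint_matrix (re A) = re A" "adjoint_matrix (im A) = im A"
      by (simp_all add: re_def im_def vec_eq_iff algebra_simps)
    then show ?thesis using that by blast
  qed
  obtain U where U: "unitary_matrix U"
    "\<And>H. H \<in> re ` \<N> \<union> im ` \<N> \<Longrightarrow> \<exists>d::'n \<Rightarrow> real. H = diag_conj U (\<lambda>i. of_real (d i))"
    using commuting_hermitian_diagonalization [of "re ` \<N> \<union> im ` \<N>"] 1 2 by (smt (verit) UnE imageE)
  show ?thesis
  proof (rule that [OF U(1)])
    fix A assume "A \<in> \<N>"
    then obtain d e where de: "re A = diag_conj U (\<lambda>i. complex_of_real (d i))" "im A = diag_conj U (\<lambda>i. complex_of_real (e i))"
      using U(2) [of "re A"] U(2) [of "im A"] by blast
    have "A = (1/2) *\<^sub>R (re A + map_matrix ((*) \<i>) (im A))"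
      by (simp add: re_def im_def vec_eq_iff scaleR_conv_of_real [where 'a = complex] algebra_simps)
    then show "\<exists>f. A = diag_conj U f"
      unfolding de map_matrix_diag_conj diag_conj_add diag_conj_scaleR by blast
  qed
qed

lemma unitary_diagonalization:
  assumes "unitary_matrix (v :: complex^'n^'n)"
  obtains U f where "unitary_matrix U" "v = diag_conj U f" "\<And>i. cmod (f i) = 1"
proof -
  obtain U f where U: "unitary_matrix U" "v = diag_conj U f"
  proof (rule normal_diagonalization [of "{v}"])
    fix U assume "unitary_matrix U" "\<And>A. A \<in> {v} \<Longrightarrow> \<exists>f. A = diag_conj U f"
    then show thesis using that by blast
  qed (use assms in \<open>auto simp: unitary_matrix_def\<close>)
  then show ?thesis using that assms diag_conj_unitary_iff by blast
qed

lemma skew_hermitian_diagonalization: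
  assumes "x \<in> skew_hermitian"
  obtains U d where "unitary_matrix U" "x = diag_conj U (\<lambda>i. \<i> * of_real (d i))"
proof -
  have sk: "adjoint_matrix x = - x" using assms by (simp add: skew_hermitian_def)
  obtain U f where U: "unitary_matrix U" "x = diag_conj U f"
  proof (rule normal_diagonalization [of "{x}"])
    fix U assume "unitary_matrix U" "\<And>A. A \<in> {x} \<Longrightarrow> \<exists>f. A = diag_conj U f"
    then show thesis using that by blast
  qed (use sk in \<open>auto simp: matrix_mult_minus_left matrix_mult_minus_right\<close>)
  have "(\<lambda>i. cnj (f i)) = (\<lambda>i. - f i)"
    using sk unfolding U(2) diag_conj_adjoint diag_conj_uminus by (rule diag_conj_inj [OF U(1)])
  then have *: "cnj (f i) = - f i" for i by (rule fun_cong)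
  have "f = (\<lambda>i. \<i> * of_real (Im (f i)))"
  proof
    show "f i = \<i> * of_real (Im (f i))" for i using * [of i] by (simp add: complex_eq_iff)
  qed
  then have "x = diag_conj U (\<lambda>i. \<i> * of_real (Im (f i)))" unfolding U(2) by (rule arg_cong)
  then show ?thesis by (rule that [OF U(1)])
qed

lemma skew_hermitian_diag_conj: "diag_conj U (\<lambda>i. \<i> * of_real (d i)) \<in> skew_hermitian"
  by (simp add: skew_hermitian_def diag_conj_adjoint diag_conj_uminus)

lemma matrix_exp_scaleR_diag_conj:
  assumes "unitary_matrix U"
  shows "matrix_exp (t *\<^sub>R diag_conj U (\<lambda>i. \<i> * of_real (d i))) = diag_conj U (\<lambda>i. cis (t * d i))"
  by (simp add: diag_conj_scaleR matrix_exp_diag_conj [OF assms] cis_conv_exp scaleR_conv_of_real [where 'a = complex] mult_ac)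

text \<open>One diagonalization of \<open>x\<close> serves all \<open>t\<close>, which reduces the
  three claims to scalar facts about \<open>cis (t * r)\<close>.\<close>

lemma matrix_exp_skew:
  fixes x :: "complex^'n^'n"
  assumes x: "x \<in> skew_hermitian"
  shows unitary_matrix_exp: "unitary_matrix (matrix_exp (t *\<^sub>R x))"
    and matrix_exp_add: "matrix_exp ((s + t) *\<^sub>R x) = matrix_exp (s *\<^sub>R x) ** matrix_exp (t *\<^sub>R x)"
    and matrix_exp_derivative:
      "((\<lambda>t. matrix_exp (t *\<^sub>R x)) has_vector_derivative matrix_exp (t *\<^sub>R x) ** x) (at t)"
proof -
  obtain U d where U: "unitary_matrix U" and xd: "x = diag_conj U (\<lambda>i. \<i> * of_real (d i))"
    using skew_hermitian_diagonalization [OF x] .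
  note e = matrix_exp_scaleR_diag_conj [OF U, of _ d, folded xd]
  show "unitary_matrix (matrix_exp (t *\<^sub>R x))" unfolding e diag_conj_unitary_iff [OF U] by simp
  show "matrix_exp ((s + t) *\<^sub>R x) = matrix_exp (s *\<^sub>R x) ** matrix_exp (t *\<^sub>R x)"
    unfolding e diag_conj_mult [OF U] by (simp add: cis_mult distrib_right)
  have "((\<lambda>t. cis (t * r)) has_vector_derivative cis (t * r) * (\<i> * of_real r)) (at t)" for r
  proof -
    have "((\<lambda>t. exp (\<i> * of_real (t * r))) has_vector_derivative (\<i> * of_real r) * exp (\<i> * of_real (t * r))) (at t)"
    proof -
      have "((\<lambda>t. \<i> * complex_of_real (t * r)) has_vector_derivative \<i> * of_real r) (at t)"
        by (auto intro!: derivative_eq_intros)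
      moreover have "(exp has_field_derivative exp (\<i> * of_real (t * r))) (at (\<i> * of_real (t * r)))"
        by (rule DERIV_exp)
      ultimately show ?thesis
        using field_vector_diff_chain_at [of "\<lambda>t. \<i> * complex_of_real (t * r)" "\<i> * of_real r" t exp "exp (\<i> * of_real (t * r))"]
        by (simp add: o_def)
    qed
    then show ?thesis by (simp add: cis_conv_exp mult_ac)
  qed
  then show "((\<lambda>t. matrix_exp (t *\<^sub>R x)) has_vector_derivative matrix_exp (t *\<^sub>R x) ** x) (at t)"
    unfolding e unfolding xd diag_conj_mult [OF U] by (intro has_vector_derivative_diag_conj)
qed

lemma matrix_exp_0: "matrix_exp (0 :: complex^'n^'n) = mat 1"
  using matrix_exp_diag_conj [of "mat 1" "\<lambda>i::'n. 0"] by (simp add: diag_conj_1)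

subsection \<open>Support functionals\<close>

text \<open>Hahn-Banach in finite dimension: a hyperplane separates the open unit ball of
  \<open>N\<close> from \<open>A /\<^sub>R N A\<close>, and projecting its normal vector to
  \<open>R\<close> keeps all values on \<open>R\<close>.\<close>

lemma (in seminorm) support_functional:
  assumes R: "subspace R" and A: "A \<in> R"
  shows "\<exists>k\<in>R. (\<forall>z\<in>R. inner k z \<le> N z) \<and> inner k A = N A"
proof (cases "N A = 0")
  case True
  then show ?thesis using subspace_0 [OF R] by (intro bexI [of _ 0]) auto
next
  case False
  then have NA: "N A > 0" using nonneg [of A] by linarith
  have "convex {x. N x < 1}"
  proof (rule convexI)
    fix x y and u v :: real assume h: "x \<in> {x. N x < 1}" "y \<in> {x. N x < 1}" "0 \<le> u" "0 \<le> v" "u + v = 1"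
    have "N (u *\<^sub>R x + v *\<^sub>R y) \<le> u * N x + v * N y"
      using triangle [of "u *\<^sub>R x" "v *\<^sub>R y"] h by (simp add: scale)
    also have "\<dots> < 1" using convex_bound_lt [of "N x" 1 "N y" u v] h by simp
    finally show "u *\<^sub>R x + v *\<^sub>R y \<in> {x. N x < 1}" by simp
  qed
  moreover have "{x. N x < 1} \<inter> {A /\<^sub>R N A} = {}" using NA by (auto simp: scale)
  moreover have "0 \<in> {x. N x < 1}" by simp
  ultimately obtain a b where a: "a \<noteq> 0" "\<And>x. N x < 1 \<Longrightarrow> inner a x \<le> b" "inner a (A /\<^sub>R N A) \<ge> b"
    using separating_hyperplane_sets [of "{x. N x < 1}" "{A /\<^sub>R N A}"] by (metis empty_iff insert_iff mem_Collect_eq convex_singleton)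
  \<comment> \<open>A small multiple of the normal vector \<open>a\<close> lies in the open ball,
    which shows that the separating level \<open>b\<close> is positive.\<close>
  define e where "e = 1 / (N a + 1)"
  have Na: "N a + 1 > 0" using nonneg [of a] by linarith
  then have "e > 0" "N (e *\<^sub>R a) < 1" by (auto simp: e_def scale)
  then have "inner a (e *\<^sub>R a) \<le> b" using a(2) by blast
  moreover have "inner a (e *\<^sub>R a) > 0" using a(1) \<open>e > 0\<close> by simp
  ultimately have b: "b > 0" by linarith
  define c where "c = inner a (A /\<^sub>R N A)"
  have c: "c \<ge> b" "c > 0" using a(3) b by (auto simp: c_def)
  have le: "inner a z \<le> c * N z" for z
  proof (rule field_le_epsilon)
    fix d :: real assume d: "d > 0"
    \<comment> \<open>Scaling by \<open>t > N z\<close> rather than by \<open>N z\<close> also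
      treats vectors with \<open>N z = 0\<close>.\<close>
    define t where "t = N z + d / c"
    have t: "t > N z" "t > 0" using d c nonneg [of z] by (auto simp: t_def add_nonneg_pos)
    then have "inner a (z /\<^sub>R t) \<le> b" using a(2) [of "z /\<^sub>R t"] by (simp add: scale field_simps)
    then have "inner a z \<le> b * t" using t by (simp add: field_simps)
    also have "\<dots> \<le> c * t" using c t by (intro mult_right_mono) auto
    also have "\<dots> = c * N z + d" using c by (simp add: t_def distrib_left)
    finally show "inner a z \<le> c * N z + d" .
  qed
  obtain k w where k: "k \<in> span R" and w: "\<And>y. y \<in> span R \<Longrightarrow> orthogonal w y" and kw: "a /\<^sub>R c = k + w"
    using orthogonal_subspace_decomp_exists [of R "a /\<^sub>R c"] by blast
  have kz: "inner k z = inner a z / c" if "z \<in> R" for z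
  proof -
    have "inner (a /\<^sub>R c) z = inner k z + inner w z" by (simp add: kw inner_add_left)
    moreover have "inner w z = 0" using w [OF span_base [OF that]] by (simp add: orthogonal_def)
    ultimately show ?thesis by (simp add: divide_inverse mult.commute)
  qed
  have "k \<in> R" using k R by (metis span_eq_iff)
  moreover have "inner k z \<le> N z" if "z \<in> R" for z
    using kz [OF that] le [of z] c by (simp add: pos_divide_le_eq mult.commute)
  moreover have "inner k A = N A" using kz [OF A] NA c by (simp add: c_def field_simps)
  ultimately show ?thesis by blast
qed

text \<open>The support functional of least Euclidean norm is unique, hence inherits every symmetry of
  the problem.\<close>

lemma (in seminorm) minimal_support_functional:
  assumes R: "subspace R" and A: "A \<in> R"
  obtains k where "k \<in> R" "\<And>z. z \<in> R \<Longrightarrow> inner k z \<le> N z" "inner k A = N A"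
    "\<forall>l\<in>R. norm l = norm k \<longrightarrow> (\<forall>z\<in>R. inner l z \<le> N z) \<longrightarrow> inner l A = N A \<longrightarrow> l = k"
proof -
  define K where "K = R \<inter> (\<Inter>z\<in>R. {k. inner k z \<le> N z}) \<inter> {k. inner k A = N A}"
  have hs: "{k. inner k z \<le> r} = {k. inner z k \<le> r}" "{k. inner k z = r} = {k. inner z k = r}" for z r
    by (simp_all add: inner_commute)
  have cl: "closed K" unfolding K_def hs
    by (intro closed_Int closed_INT ballI closed_subspace R closed_halfspace_le closed_hyperplane)
  have cv: "convex K" unfolding K_def hs
    by (intro convex_Int convex_INT subspace_imp_convex R convex_halfspace_le convex_hyperplane)
  have "K \<noteq> {}" using support_functional [OF assms] by (auto simp: K_def)
  then have kK: "closest_point K 0 \<in> K" and min: "\<forall>y\<in>K. dist 0 (closest_point K 0) \<le> dist 0 y"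
    using closest_point_exists [OF cl, of 0] by blast+
  have "l = closest_point K 0"
    if l: "l \<in> R" "norm l = norm (closest_point K 0)" "\<And>z. z \<in> R \<Longrightarrow> inner l z \<le> N z" "inner l A = N A" for l
  proof (rule any_closest_point_unique [OF cv cl _ kK _ min])
    show "l \<in> K" using l by (auto simp: K_def)
    show "\<forall>z\<in>K. dist 0 l \<le> dist 0 z" using min l(2) by simp
  qed
  then show ?thesis using that [of "closest_point K 0"] kK by (auto simp: K_def)
qed

subsection \<open>The length function of an invariant norm\<close>

definition absarg :: "complex^'n^'n \<Rightarrow> complex^'n^'n" where
  "absarg v = fcalc (\<lambda>z. of_real \<bar>Arg z\<bar>) v"

definition mlog :: "complex^'n^'n \<Rightarrow> complex^'n^'n" where
  "mlog v = fcalc (\<lambda>z. \<i> * of_real (Arg z)) v"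

text \<open>Unitary without the eigenvalue \<open>-1\<close>. One diagonalization is asked for;
  \<open>regular_diag_conj\<close> shows that every other one has the same property.\<close>

definition regular :: "complex^'n^'n \<Rightarrow> bool" where
  "regular v \<longleftrightarrow> (\<exists>U f. unitary_matrix U \<and> v = diag_conj U f \<and> (\<forall>i. cmod (f i) = 1 \<and> f i \<noteq> - 1))"

text \<open>The domain on which \<open>mlog\<close> inverts \<open>matrix_exp\<close>.\<close>

definition small :: "complex^'n^'n \<Rightarrow> bool" where
  "small x \<longleftrightarrow> (\<exists>U d. unitary_matrix U \<and> x = diag_conj U (\<lambda>i. \<i> * of_real (d i)) \<and> (\<forall>i. \<bar>d i\<bar> < pi))"

lemma absarg_diag_conj: "unitary_matrix U \<Longrightarrow> absarg (diag_conj U f) = diag_conj U (\<lambda>i. of_real \<bar>Arg (f i)\<bar>)"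
  unfolding absarg_def by (rule fcalc_diag_conj)

lemma mlog_diag_conj: "unitary_matrix U \<Longrightarrow> mlog (diag_conj U f) = diag_conj U (\<lambda>i. \<i> * of_real (Arg (f i)))"
  unfolding mlog_def by (rule fcalc_diag_conj)

lemma small_skew: "small x \<Longrightarrow> x \<in> skew_hermitian"
  unfolding small_def using skew_hermitian_diag_conj by blast

lemma small_scaleR:
  assumes "small x" "\<bar>s\<bar> \<le> 1" shows "small (s *\<^sub>R x)"
proof -
  obtain U d where U: "unitary_matrix U" "x = diag_conj U (\<lambda>i. \<i> * of_real (d i))" "\<And>i. \<bar>d i\<bar> < pi"
    using assms(1) unfolding small_def by blast
  have "s *\<^sub>R x = diag_conj U (\<lambda>i. \<i> * of_real (s * d i))"
    unfolding U(2) diag_conj_scaleR by (simp add: scaleR_conv_of_real [where 'a = complex] mult_ac)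
  moreover have "\<bar>s * d i\<bar> < pi" for i
    using mult_right_mono [OF assms(2), of "\<bar>d i\<bar>"] U(3) [of i] by (simp add: abs_mult)
  ultimately show ?thesis unfolding small_def using U(1) by (intro exI conjI) auto
qed

lemma small_if_norm:
  assumes "x \<in> skew_hermitian" "norm x < pi" shows "small x"
proof -
  obtain U d where U: "unitary_matrix U" "x = diag_conj U (\<lambda>i. \<i> * of_real (d i))"
    using skew_hermitian_diagonalization [OF assms(1)] .
  have "\<bar>d i\<bar> < pi" for i
    using norm_diag_conj [OF U(1), of "\<lambda>i. \<i> * of_real (d i)" i] assms(2) unfolding U(2) by (simp add: norm_mult)
  then show ?thesis using U unfolding small_def by blast
qed

text \<open>The functional calculus with the indicator of \<open>-1\<close> does not depend on the
  diagonalization and vanishes for one, hence for all.\<close>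

lemma regular_diag_conj:
  assumes "regular v" "unitary_matrix W" "v = diag_conj W f" shows "f i \<noteq> - 1"
proof -
  obtain U g where U: "unitary_matrix U" "v = diag_conj U g" "\<And>i. g i \<noteq> - 1"
    using assms(1) unfolding regular_def by blast
  have "diag_conj W (\<lambda>i. if f i = - 1 then 1 else 0) = diag_conj U (\<lambda>i. if g i = - 1 then 1 else 0)"
    using diag_conj_comp_cong [OF assms(2) U(1), of f g "\<lambda>z. if z = - 1 then 1 else 0"] assms(3) U(2) by simp
  also have "\<dots> = diag_conj W (\<lambda>i. 0)" using U(3) by simp
  finally have "(\<lambda>i. if f i = - 1 then 1 else 0) = (\<lambda>i. 0 :: complex)" by (rule diag_conj_inj [OF assms(2)])
  then show ?thesis by (metis zero_neq_one)
qed

text \<open>An eigenvalue \<open>-1\<close> has distance \<open>2\<close> from \<open>1\<close>, and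
  the norm dominates every eigenvalue of \<open>v - mat 1\<close>.\<close>

lemma regular_near_1:
  assumes "unitary_matrix v" "norm (v - mat 1) < 2" shows "regular v"
proof -
  obtain U f where U: "unitary_matrix U" "v = diag_conj U f" "\<And>i. cmod (f i) = 1"
    by (rule unitary_diagonalization [OF assms(1)], rule that)
  have "v - mat 1 = diag_conj U (\<lambda>i. f i - 1)"
    by (simp add: U(2) diag_conj_1 [OF U(1), symmetric] diag_conj_diff)
  then have *: "cmod (f i - 1) < 2" for i
    using norm_diag_conj [OF U(1), of "\<lambda>i. f i - 1" i] assms(2) by simp
  have "f i \<noteq> - 1" for i
  proof
    assume "f i = - 1"
    then have "cmod (f i - 1) = 2" by simp
    then show False using * [of i] by simp
  qed
  then show ?thesis using U unfolding regular_def by blast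
qed

lemma inner_diag_conj_same:
  assumes "unitary_matrix W"
  shows "inner (diag_conj W a) (diag_conj W b) = (\<Sum>j\<in>UNIV. Re (cnj (a j) * b j))"
proof -
  have "overlap W W j i = (if j = i then 1 else 0)" for i j
    using assms by (simp add: overlap_def unitary_matrix_def mat_def)
  then show ?thesis
    unfolding inner_diag_conj [OF assms assms] by (simp add: if_distrib [where f = "\<lambda>x. x * _"] cong: if_cong)
qed

text \<open>Both squared norms are sums over the same weights \<open>overlap\<close>, so the scalar
  Lipschitz bound carries over with its constant.\<close>

lemma absarg_lipschitz:
  assumes "unitary_matrix u" "unitary_matrix v"
  shows "norm (absarg u - absarg v) \<le> pi / 2 * norm (u - v)"
proof -
  obtain U f where U: "unitary_matrix U" "u = diag_conj U f" "\<And>i. cmod (f i) = 1"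
    by (rule unitary_diagonalization [OF assms(1)], rule that)
  obtain V g where V: "unitary_matrix V" "v = diag_conj V g" "\<And>i. cmod (g i) = 1"
    by (rule unitary_diagonalization [OF assms(2)], rule that)
  have "(norm (absarg u - absarg v))\<^sup>2 =
    (\<Sum>j\<in>UNIV. \<Sum>i\<in>UNIV. overlap U V j i * (cmod (of_real \<bar>Arg (f j)\<bar> - of_real \<bar>Arg (g i)\<bar>))\<^sup>2)"
    unfolding U(2) V(2) absarg_diag_conj [OF U(1)] absarg_diag_conj [OF V(1)]
    by (rule norm_diag_conj_diff [OF U(1) V(1)])
  also have "\<dots> \<le> (\<Sum>j\<in>UNIV. \<Sum>i\<in>UNIV. overlap U V j i * ((pi / 2)\<^sup>2 * (cmod (f j - g i))\<^sup>2))"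
  proof (intro sum_mono mult_left_mono overlap_nonneg)
    fix i j
    have "(cmod (of_real \<bar>Arg (f j)\<bar> - of_real \<bar>Arg (g i)\<bar>))\<^sup>2 = (\<bar>Arg (f j)\<bar> - \<bar>Arg (g i)\<bar>)\<^sup>2"
      by (metis norm_of_real of_real_diff power2_abs)
    also have "\<dots> \<le> (pi / 2)\<^sup>2 * (cmod (f j - g i))\<^sup>2" by (rule abs_Arg_lipschitz [OF U(3) V(3)])
    finally show "(cmod (of_real \<bar>Arg (f j)\<bar> - of_real \<bar>Arg (g i)\<bar>))\<^sup>2 \<le> (pi / 2)\<^sup>2 * (cmod (f j - g i))\<^sup>2" .
  qed
  also have "\<dots> = (pi / 2)\<^sup>2 * (norm (u - v))\<^sup>2"
    unfolding U(2) V(2) norm_diag_conj_diff [OF U(1) V(1)] by (simp add: sum_distrib_left mult_ac)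
  also have "\<dots> = (pi / 2 * norm (u - v))\<^sup>2" by (simp only: power_mult_distrib)
  finally show ?thesis by (rule power2_le_imp_le) simp
qed

section \<open>Growth of the length function on the unitaries of a matrix algebra\<close>

text \<open>\<open>R\<close> stands for all complex matrices or for the real ones.
  \<open>calculus_R\<close> asks \<open>\<phi>\<close> to commute with conjugation because such
  functions preserve real matrices; the scalar functions applied inside \<open>R\<close> are chosen
  with this symmetry.\<close>

locale invariant_geometry = seminorm M for M :: "complex^'n^'n \<Rightarrow> real" +
  fixes R :: "(complex^'n^'n) set"
  assumes subspace_R: "subspace R" and one_R: "mat 1 \<in> R"
    and mult_R: "x \<in> R \<Longrightarrow> y \<in> R \<Longrightarrow> x ** y \<in> R"
    and adjoint_R: "x \<in> R \<Longrightarrow> adjoint_matrix x \<in> R"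
    and calculus_R: "unitary_matrix U \<Longrightarrow> diag_conj U f \<in> R \<Longrightarrow> (\<And>z. \<phi> (cnj z) = cnj (\<phi> z)) \<Longrightarrow>
      diag_conj U (\<lambda>i. \<phi> (f i)) \<in> R"
    and definite: "x \<in> R \<Longrightarrow> M x = 0 \<Longrightarrow> x = 0"
    and invariant: "a \<in> R \<Longrightarrow> unitary_matrix a \<Longrightarrow> b \<in> R \<Longrightarrow> unitary_matrix b \<Longrightarrow> x \<in> R \<Longrightarrow> M (a ** x ** b) = M x"
begin

definition len :: "complex^'n^'n \<Rightarrow> real" where
  "len v = M (absarg v)"

definition bound :: real where
  "bound = (SOME C. C > 0 \<and> (\<forall>x. M x \<le> C * norm x))"

lemma bound: "bound > 0" "M x \<le> bound * norm x"
proof -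
  have "\<exists>C. C > 0 \<and> (\<forall>x. M x \<le> C * norm x)" using le_norm by metis
  then have "bound > 0 \<and> (\<forall>x. M x \<le> bound * norm x)" unfolding bound_def by (rule someI_ex)
  then show "bound > 0" "M x \<le> bound * norm x" by auto
qed

lemma invariant_left: "a \<in> R \<Longrightarrow> unitary_matrix a \<Longrightarrow> x \<in> R \<Longrightarrow> M (a ** x) = M x"
  using invariant [of a "mat 1" x] one_R by simp

lemma diff_R: "x \<in> R \<Longrightarrow> y \<in> R \<Longrightarrow> x - y \<in> R"
  by (rule subspace_diff [OF subspace_R])

lemma add_R: "x \<in> R \<Longrightarrow> y \<in> R \<Longrightarrow> x + y \<in> R"
  by (rule subspace_add [OF subspace_R])

lemma scale_R: "x \<in> R \<Longrightarrow> c *\<^sub>R x \<in> R"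
  by (rule subspace_scale [OF subspace_R])

lemma absarg_R: "unitary_matrix v \<Longrightarrow> v \<in> R \<Longrightarrow> absarg v \<in> R"
proof -
  assume v: "unitary_matrix v" "v \<in> R"
  obtain U f where U: "unitary_matrix U" "v = diag_conj U f" by (rule unitary_diagonalization [OF v(1)], rule that)
  show "absarg v \<in> R" unfolding U(2) absarg_diag_conj [OF U(1)]
    by (rule calculus_R [OF U(1)]) (use v U abs_Arg_cnj in auto)
qed

lemma exp_R:
  assumes "x \<in> R" "x \<in> skew_hermitian" shows "matrix_exp (t *\<^sub>R x) \<in> R"
proof -
  obtain U d where U: "unitary_matrix U" "x = diag_conj U (\<lambda>i. \<i> * of_real (d i))"
    using skew_hermitian_diagonalization [OF assms(2)] .
  have "diag_conj U (\<lambda>i. t *\<^sub>R (\<i> * of_real (d i))) \<in> R"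
    using scale_R [OF assms(1), of t] by (simp add: U(2) diag_conj_scaleR)
  then show ?thesis unfolding U(2) diag_conj_scaleR matrix_exp_diag_conj [OF U(1)]
    by (rule calculus_R [OF U(1)]) (simp add: exp_cnj)
qed

lemma len_lipschitz:
  assumes "unitary_matrix u" "unitary_matrix v"
  shows "\<bar>len u - len v\<bar> \<le> bound * (pi / 2) * norm (u - v)"
proof -
  have "\<bar>len u - len v\<bar> \<le> M (absarg u - absarg v)" unfolding len_def by (rule triangle_diff)
  also have "\<dots> \<le> bound * norm (absarg u - absarg v)" by (rule bound)
  also have "\<dots> \<le> bound * (pi / 2 * norm (u - v))"
    using absarg_lipschitz [OF assms] bound(1) by (intro mult_left_mono) auto
  finally show ?thesis by simp
qed

text \<open>By minimality the support functional at \<open>absarg v\<close> commutes with \<open>v\<close> and vanishes on the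
  kernel of \<open>absarg v\<close>; testing it on unitaries of \<open>R\<close> near and far from \<open>1\<close> shows that it is
  Hermitian and positive.\<close>

lemma support_certificate:
  assumes v: "v \<in> R" "unitary_matrix v"
  obtains W f \<kappa> where "unitary_matrix W" "v = diag_conj W f" "\<And>j. cmod (f j) = 1" "\<And>j. 0 \<le> \<kappa> j"
    "diag_conj W (\<lambda>j. of_real (\<kappa> j)) \<in> R"
    "\<And>z. z \<in> R \<Longrightarrow> inner (diag_conj W (\<lambda>j. of_real (\<kappa> j))) z \<le> M z"
    "inner (diag_conj W (\<lambda>j. of_real (\<kappa> j))) (absarg v) = len v"
proof -
  obtain U f0 where U: "unitary_matrix U" and vU: "v = diag_conj U f0" and f0: "\<And>i. cmod (f0 i) = 1"
    by (rule unitary_diagonalization [OF v(2)], rule that)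
  define A where "A = absarg v"
  have AU: "A = diag_conj U (\<lambda>i. of_real \<bar>Arg (f0 i)\<bar>)" by (simp add: A_def vU absarg_diag_conj [OF U])
  have AR: "A \<in> R" unfolding A_def using absarg_R v by blast
  have Aad: "adjoint_matrix A = A" by (simp add: AU diag_conj_adjoint)
  obtain k where kR: "k \<in> R" and kle: "\<And>z. z \<in> R \<Longrightarrow> inner k z \<le> M z" and kA: "inner k A = M A"
    and kmin': "\<forall>l\<in>R. norm l = norm k \<longrightarrow> (\<forall>z\<in>R. inner l z \<le> M z) \<longrightarrow> inner l A = M A \<longrightarrow> l = k"
    by (rule minimal_support_functional [OF subspace_R AR], rule that)
  have kmin: "l = k" if "l \<in> R" "norm l = norm k" "\<And>z. z \<in> R \<Longrightarrow> inner l z \<le> M z" "inner l A = M A" for l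
    using kmin' that by blast
  \<comment> \<open>If \<open>A\<close> is fixed by the adjoints of \<open>a\<close> and
    \<open>b\<close>, then \<open>a ** k ** b\<close> is again a support functional at
    \<open>A\<close> with the same Euclidean norm, hence equal to \<open>k\<close>.\<close>
  have sym: "a ** k ** b = k" if a: "a \<in> R" "unitary_matrix a" and b: "b \<in> R" "unitary_matrix b"
    and ab: "adjoint_matrix a ** A ** adjoint_matrix b = A" for a b
  proof (rule kmin)
    have *: "inner (a ** k ** b) z = inner k (adjoint_matrix a ** z ** adjoint_matrix b)" for z
      by (simp add: inner_mult_right [of "a ** k"] inner_mult_left [of a] matrix_mul_assoc)
    show "a ** k ** b \<in> R" using a b kR mult_R by blast
    show "norm (a ** k ** b) = norm k" by (simp add: norm_unitary_mult [of a] norm_unitary_mult [of b] a b)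
    show "inner (a ** k ** b) A = M A" unfolding * ab by (rule kA)
    fix z assume z: "z \<in> R"
    have "inner (a ** k ** b) z \<le> M (adjoint_matrix a ** z ** adjoint_matrix b)"
      unfolding * using a b z by (intro kle mult_R adjoint_R)
    also have "\<dots> = M z" using a b z by (intro invariant adjoint_R unitary_matrix_adjoint)
    finally show "inner (a ** k ** b) z \<le> M z" .
  qed
  have kv: "v ** k = k ** v"
  proof -
    have "cnj (f0 i) * of_real \<bar>Arg (f0 i)\<bar> * f0 i = of_real \<bar>Arg (f0 i)\<bar>" for i
    proof -
      have "f0 i * cnj (f0 i) = 1" using complex_norm_square [of "f0 i"] f0 by simp
      then show ?thesis by (metis mult.commute mult.left_commute mult.right_neutral)
    qed
    then have "(\<lambda>i. cnj (f0 i) * of_real \<bar>Arg (f0 i)\<bar> * f0 i) = (\<lambda>i. of_real \<bar>Arg (f0 i)\<bar>)" by (rule ext)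
    then have "adjoint_matrix v ** A ** v = A"
      unfolding vU AU diag_conj_adjoint diag_conj_mult [OF U] by (rule arg_cong)
    then have "v ** k ** adjoint_matrix v = k"
      using v by (intro sym adjoint_R unitary_matrix_adjoint) auto
    then show ?thesis by (metis unitary_cancel(4) v(2))
  qed
  \<comment> \<open>\<open>s\<close> reflects the kernel of \<open>A\<close>, the eigenspace of
    \<open>v\<close> for the eigenvalue \<open>1\<close>. It fixes \<open>A\<close>, so minimality
    gives \<open>k ** s = k\<close>, and \<open>k\<close> vanishes on that kernel.\<close>
  define \<sigma> where "\<sigma> = (\<lambda>z::complex. if z = 1 then - 1 else 1 :: complex)"
  define s where "s = diag_conj U (\<lambda>i. \<sigma> (f0 i))"
  have sR: "s \<in> R" unfolding s_def
    by (rule calculus_R [OF U]) (use v vU in \<open>auto simp: \<sigma>_def\<close>)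
  have s_unit: "unitary_matrix s" unfolding s_def diag_conj_unitary_iff [OF U] by (simp add: \<sigma>_def)
  have s_ad: "adjoint_matrix s = s" unfolding s_def diag_conj_adjoint
    by (intro arg_cong [of _ _ "diag_conj U"] ext) (simp add: \<sigma>_def)
  have "(\<lambda>i. \<sigma> (f0 i) * of_real \<bar>Arg (f0 i)\<bar>) = (\<lambda>i. of_real \<bar>Arg (f0 i)\<bar>)"
    by (auto simp: \<sigma>_def)
  then have sA: "s ** A = A" "A ** s = A"
    by (simp_all add: s_def AU diag_conj_mult [OF U] mult.commute)
  have ks: "k ** s = k" and sk: "s ** k = k"
    using sym [of "mat 1" s] sym [of s "mat 1"] one_R sR s_unit sA s_ad by simp_all
  have AkA: "A ** k = k ** A"
    unfolding AU by (rule diag_conj_comp_intertwine [OF U U]) (use kv vU in simp)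
  \<comment> \<open>The matrices \<open>matrix_exp (t *\<^sub>R y) ** A\<close> all have norm
    \<open>M A\<close>, so \<open>k\<close> is maximal among them at \<open>t = 0\<close>. The
    vanishing derivative makes \<open>k ** A\<close> orthogonal to the skew-Hermitian part of
    \<open>R\<close>.\<close>
  have orth: "inner (k ** A) y = 0" if y: "y \<in> R" "y \<in> skew_hermitian" for y
  proof -
    have lin: "bounded_linear (\<lambda>X. inner k (X ** A))"
      using bounded_linear_compose [OF bounded_linear_inner_right
          bounded_bilinear.bounded_linear_left [OF bounded_bilinear_matrix_mult]] .
    have "((\<lambda>t. inner k (matrix_exp (t *\<^sub>R y) ** A)) has_vector_derivative inner k (matrix_exp (0 *\<^sub>R y) ** y ** A)) (at 0)"
      by (rule bounded_linear.has_vector_derivative [OF lin matrix_exp_derivative [OF y(2)]])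
    then have "((\<lambda>t. inner k (matrix_exp (t *\<^sub>R y) ** A)) has_real_derivative inner k (y ** A)) (at 0)"
      by (simp add: matrix_exp_0 has_real_derivative_iff_has_vector_derivative)
    moreover have "inner k (matrix_exp (t *\<^sub>R y) ** A) \<le> inner k (matrix_exp (0 *\<^sub>R y) ** A)" for t
    proof -
      have e: "matrix_exp (t *\<^sub>R y) \<in> R" "unitary_matrix (matrix_exp (t *\<^sub>R y))"
        using exp_R y unitary_matrix_exp by blast+
      have "inner k (matrix_exp (t *\<^sub>R y) ** A) \<le> M (matrix_exp (t *\<^sub>R y) ** A)"
        using e AR by (intro kle mult_R)
      also have "\<dots> = M A" using e AR by (intro invariant_left)
      finally show ?thesis by (simp add: matrix_exp_0 kA)
    qed
    ultimately have "inner k (y ** A) = 0"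
      using DERIV_local_max [of "\<lambda>t. inner k (matrix_exp (t *\<^sub>R y) ** A)" "inner k (y ** A)" 0 1] by simp
    then show ?thesis by (simp add: inner_mult_right Aad)
  qed
  have k_ad: "adjoint_matrix k = k"
  proof -
    define y where "y = k ** A - adjoint_matrix (k ** A)"
    have yR: "y \<in> R" unfolding y_def using kR AR by (intro diff_R mult_R adjoint_R)
    have y_ad: "adjoint_matrix y = - y" by (simp add: y_def adjoint_diff)
    then have y_sk: "y \<in> skew_hermitian" by (simp add: skew_hermitian_def)
    have "inner (adjoint_matrix (k ** A)) y = inner (k ** A) (adjoint_matrix y)"
      by (metis inner_matrix_adjoint adjoint_adjoint)
    also have "\<dots> = 0" using orth [OF yR y_sk] y_ad by simp
    finally have "inner y y = 0" using orth [OF yR y_sk] by (simp add: y_def inner_diff_left)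
    then have "k ** A = adjoint_matrix (k ** A)" by (simp add: y_def)
    also have "\<dots> = adjoint_matrix k ** A"
    proof -
      have "adjoint_matrix (k ** A) = adjoint_matrix (A ** k)" by (simp add: AkA)
      then show ?thesis by (simp add: adjoint_mult Aad)
    qed
    finally have DA: "(k - adjoint_matrix k) ** A = 0" by (simp add: matrix_mult_diff_left)
    have "adjoint_matrix k ** s = adjoint_matrix (s ** k)" by (simp add: adjoint_mult s_ad)
    then have Ds: "(k - adjoint_matrix k) ** s = k - adjoint_matrix k"
      by (simp add: matrix_mult_diff_left ks sk)
    \<comment> \<open>\<open>A + (mat 1 - s)\<close> is invertible, with eigenvalue
      \<open>\<bar>Arg\<bar> > 0\<close> off the kernel of \<open>A\<close> and \<open>2\<close> on
      it, and \<open>k - adjoint_matrix k\<close> annihilates it.\<close>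
    define g where "g = (\<lambda>i. complex_of_real \<bar>Arg (f0 i)\<bar> + (1 - \<sigma> (f0 i)))"
    have "diag_conj U g = A + (mat 1 - s)"
      by (simp add: g_def AU s_def diag_conj_add diag_conj_diff diag_conj_1 [OF U, symmetric])
    then have Dg: "(k - adjoint_matrix k) ** diag_conj U g = 0"
      by (simp add: matrix_mult_add_right matrix_mult_diff_right DA Ds)
    have gn: "g i \<noteq> 0" for i
    proof (cases "f0 i = 1")
      case True then show ?thesis by (simp add: g_def \<sigma>_def)
    next
      case False
      then have "Arg (f0 i) \<noteq> 0" using cis_Arg_unit [OF f0, of i] by auto
      then show ?thesis using False by (simp add: g_def \<sigma>_def)
    qed
    have "diag_conj U g ** diag_conj U (\<lambda>i. inverse (g i)) = mat 1"
      using gn by (simp add: diag_conj_mult [OF U] diag_conj_1 [OF U])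
    then have "k - adjoint_matrix k = (k - adjoint_matrix k) ** diag_conj U g ** diag_conj U (\<lambda>i. inverse (g i))"
      by (simp flip: matrix_mul_assoc)
    then show ?thesis by (simp add: Dg)
  qed
  obtain W where W: "unitary_matrix W" and dW: "\<And>B. B \<in> {v, k} \<Longrightarrow> \<exists>f. B = diag_conj W f"
  proof (rule normal_diagonalization [of "{v, k}"])
    fix A B assume AB: "A \<in> {v, k}" "B \<in> {v, k}"
    show "A ** B = B ** A" using AB kv by auto
    have "adjoint_matrix v ** k = k ** adjoint_matrix v"
      by (metis adjoint_mult k_ad kv)
    then show "A ** adjoint_matrix B = adjoint_matrix B ** A"
      using AB kv k_ad v(2) by (auto simp: unitary_matrix_def)
  qed blast
  obtain f where vW: "v = diag_conj W f" using dW [of v] by blast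
  obtain g where kW: "k = diag_conj W g" using dW [of k] by blast
  have f1: "cmod (f j) = 1" for j using v(2) unfolding vW diag_conj_unitary_iff [OF W] by blast
  have "(\<lambda>i. cnj (g i)) = g"
    using k_ad unfolding kW diag_conj_adjoint by (rule diag_conj_inj [OF W])
  then have "cnj (g j) = g j" for j by (rule fun_cong)
  then have g_real: "g = (\<lambda>j. of_real (Re (g j)))" by (auto simp: fun_eq_iff complex_eq_iff)
  define \<kappa> where "\<kappa> = (\<lambda>j. Re (g j))"
  have g\<kappa>: "g = (\<lambda>j. of_real (\<kappa> j))" unfolding \<kappa>_def by (rule g_real)
  have k\<kappa>: "k = diag_conj W (\<lambda>j. of_real (\<kappa> j))" using kW g\<kappa> by simp
  have AW: "A = diag_conj W (\<lambda>i. of_real \<bar>Arg (f i)\<bar>)" by (simp add: A_def vW absarg_diag_conj [OF W])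
  have sW: "s = diag_conj W (\<lambda>i. \<sigma> (f i))"
    unfolding s_def by (rule diag_conj_comp_cong [OF U W]) (use vU vW in simp)
  have \<kappa>0: "\<kappa> j = 0" if "f j = 1" for j
  proof -
    have "(\<lambda>j. of_real (\<kappa> j) * \<sigma> (f j)) = (\<lambda>j. of_real (\<kappa> j))"
      using ks unfolding k\<kappa> sW diag_conj_mult [OF W] by (rule diag_conj_inj [OF W])
    then have "of_real (\<kappa> j) * \<sigma> (f j) = complex_of_real (\<kappa> j)" by (rule fun_cong)
    then show ?thesis using that by (simp add: \<sigma>_def)
  qed
  have "0 \<le> \<kappa> j" for j
  proof (rule ccontr)
    assume neg: "\<not> 0 \<le> \<kappa> j"
    \<comment> \<open>\<open>n\<close> is the sign of \<open>k\<close>, a unitary of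
      \<open>R\<close>. Multiplying by it keeps the norm of \<open>A\<close> but replaces
      \<open>\<kappa>\<close> by \<open>\<bar>\<kappa>\<bar>\<close>, a strict gain at
      \<open>j\<close>, where \<open>Arg (f j)\<close> is nonzero by
      \<open>\<kappa>0\<close>.\<close>
    define \<nu> where "\<nu> = (\<lambda>z. if Re z < 0 then - 1 else 1 :: complex)"
    define n where "n = diag_conj W (\<lambda>j. \<nu> (of_real (\<kappa> j)))"
    have nR: "n \<in> R" unfolding n_def
      by (rule calculus_R [OF W]) (use kR k\<kappa> in \<open>auto simp: \<nu>_def\<close>)
    have n_unit: "unitary_matrix n" unfolding n_def diag_conj_unitary_iff [OF W] by (simp add: \<nu>_def)
    have "inner k (n ** A) \<le> M (n ** A)" using nR AR by (intro kle mult_R)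
    also have "\<dots> = inner k A" using invariant_left [OF nR n_unit AR] kA by simp
    finally have "inner k (n ** A) \<le> inner k A" .
    moreover have "inner k (n ** A) = (\<Sum>j\<in>UNIV. \<bar>\<kappa> j\<bar> * \<bar>Arg (f j)\<bar>)"
      unfolding k\<kappa> n_def AW diag_conj_mult [OF W] inner_diag_conj_same [OF W]
      by (intro sum.cong) (auto simp: \<nu>_def)
    moreover have "inner k A = (\<Sum>j\<in>UNIV. \<kappa> j * \<bar>Arg (f j)\<bar>)"
      unfolding k\<kappa> AW inner_diag_conj_same [OF W] by simp
    moreover have "(\<Sum>j\<in>UNIV. \<kappa> j * \<bar>Arg (f j)\<bar>) < (\<Sum>j\<in>UNIV. \<bar>\<kappa> j\<bar> * \<bar>Arg (f j)\<bar>)"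
    proof (rule sum_strict_mono_ex1)
      have "f j \<noteq> 1" using \<kappa>0 neg by auto
      then have "Arg (f j) \<noteq> 0" using cis_Arg_unit [OF f1, of j] by auto
      then show "\<exists>a\<in>UNIV. \<kappa> a * \<bar>Arg (f a)\<bar> < \<bar>\<kappa> a\<bar> * \<bar>Arg (f a)\<bar>"
        using neg by (intro bexI [of _ j]) (auto simp: not_le mult_less_0_iff)
    qed (auto intro: mult_right_mono)
    ultimately show False by simp
  qed
  then show ?thesis
    using that [OF W vW f1, of \<kappa>] kR kle kA unfolding k\<kappa> len_def A_def by blast
qed

lemma dominated_functional_norm:
  assumes "k \<in> R" "\<And>z. z \<in> R \<Longrightarrow> inner k z \<le> M z" shows "norm k \<le> bound"
proof (cases "k = 0")
  case False
  have "norm k * norm k = inner k k" by (simp add: norm_eq_sqrt_inner)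
  also have "\<dots> \<le> bound * norm k" using assms bound(2) [of k] by (meson order_trans)
  finally show ?thesis using False by simp
qed (use bound(1) in simp)

text \<open>All comparisons between the two spectral
  decompositions are weighted by the doubly stochastic matrix \<open>overlap W V\<close>.\<close>

lemma len_first_order:
  assumes v: "v \<in> R" "unitary_matrix v"
  obtains W f k where "unitary_matrix W" "v = diag_conj W f" "\<And>j. cmod (f j) = 1"
    "k \<in> R" "\<And>z. z \<in> R \<Longrightarrow> inner k z \<le> M z"
    "(\<forall>j. f j \<noteq> - 1) \<longrightarrow> inner k (v ** mlog v) = len v"
    "\<forall>V g C. unitary_matrix V \<longrightarrow> diag_conj V g \<in> R \<longrightarrow> 0 \<le> C \<longrightarrow>
      (\<forall>i j. arg_defect (f j) (g i) C) \<longrightarrow>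
      len v - len (diag_conj V g) \<le> inner k (v - diag_conj V g) + C * bound * (norm (v - diag_conj V g))\<^sup>2"
proof -
  obtain W f \<kappa> where W: "unitary_matrix W" and vW: "v = diag_conj W f" and f1: "\<And>j. cmod (f j) = 1"
    and \<kappa>: "\<And>j. 0 \<le> \<kappa> j" and kR: "diag_conj W (\<lambda>j. of_real (\<kappa> j)) \<in> R"
    and kle: "\<And>z. z \<in> R \<Longrightarrow> inner (diag_conj W (\<lambda>j. of_real (\<kappa> j))) z \<le> M z"
    and kA: "inner (diag_conj W (\<lambda>j. of_real (\<kappa> j))) (absarg v) = len v"
    by (rule support_certificate [OF v], rule that)
  define k where "k = diag_conj W (\<lambda>j. of_real (\<kappa> j))"
  \<comment> \<open>The unitary \<open>q\<close> turns the positive functional at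
    \<open>absarg v\<close> into one on tangent directions at \<open>v\<close>; it lies in
    \<open>R\<close> because \<open>arg_gradient\<close> commutes with conjugation.\<close>
  define q where "q = diag_conj W (\<lambda>j. arg_gradient (f j))"
  have qR: "q \<in> R" unfolding q_def
    by (rule calculus_R [OF W]) (use v vW arg_gradient_cnj in auto)
  have q_unit: "unitary_matrix q" unfolding q_def diag_conj_unitary_iff [OF W] by (simp add: cmod_arg_gradient f1)
  have qk: "q ** k = diag_conj W (\<lambda>j. arg_gradient (f j) * of_real (\<kappa> j))"
    by (simp add: q_def k_def diag_conj_mult [OF W])
  have \<kappa>_le: "\<kappa> j \<le> bound" for j
    using norm_diag_conj [OF W, of "\<lambda>j. of_real (\<kappa> j)" j] dominated_functional_norm [OF kR kle] \<kappa>
    by (simp add: k_def)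
  show ?thesis
  proof (rule that [OF W vW f1]; (intro allI impI)?)
    show "q ** k \<in> R" using qR kR mult_R by (simp add: k_def)
    fix z assume z: "z \<in> R"
    have "inner (q ** k) z = inner k (adjoint_matrix q ** z)" by (rule inner_mult_left)
    also have "\<dots> \<le> M (adjoint_matrix q ** z)" unfolding k_def using qR z by (intro kle mult_R adjoint_R)
    also have "\<dots> = M z" using qR q_unit z by (intro invariant_left adjoint_R unitary_matrix_adjoint)
    finally show "inner (q ** k) z \<le> M z" .
  next
    assume nz: "\<forall>j. f j \<noteq> - 1"
    have "Re (cnj (arg_gradient (f j) * of_real (\<kappa> j)) * (f j * (\<i> * of_real (Arg (f j))))) =
      Re (cnj (of_real (\<kappa> j)) * of_real \<bar>Arg (f j)\<bar>)" for j
    proof -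
      have fc: "cnj (f j) * f j = 1" using complex_norm_square [of "f j"] f1 [of j] by (simp add: mult.commute)
      consider "Im (f j) > 0" | "Im (f j) < 0" | "Im (f j) = 0" by linarith
      then have "cnj (arg_gradient (f j)) * (f j * (\<i> * of_real (Arg (f j)))) = of_real \<bar>Arg (f j)\<bar>"
      proof cases
        case 1
        then have "Arg (f j) > 0" using Arg_pos_iff by blast
        then show ?thesis using 1 fc by (simp add: arg_gradient_def) (simp add: algebra_simps)
      next
        case 2
        then have "Arg (f j) < 0" using Arg_neg_iff by blast
        then show ?thesis using 2 fc by (simp add: arg_gradient_def) (simp add: algebra_simps)
      next
        case 3
        then have "(Re (f j))\<^sup>2 = 1" using f1 [of j] cmod_power2 [of "f j"] by simp
        then have "f j = 1" using 3 spec [OF nz, of j] by (auto simp: complex_eq_iff power2_eq_1_iff)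
        then show ?thesis by simp
      qed
      then have "cnj (arg_gradient (f j) * of_real (\<kappa> j)) * (f j * (\<i> * of_real (Arg (f j)))) =
         cnj (of_real (\<kappa> j)) * of_real \<bar>Arg (f j)\<bar>"
        by (simp add: mult_ac)
      then show ?thesis by (rule arg_cong)
    qed
    then have "inner (q ** k) (v ** mlog v) = inner k (absarg v)"
      unfolding qk unfolding k_def vW mlog_diag_conj [OF W] absarg_diag_conj [OF W] diag_conj_mult [OF W] inner_diag_conj_same [OF W]
      by (intro sum.cong refl)
    then show "inner (q ** k) (v ** mlog v) = len v" using kA by (simp add: k_def)
  next
    fix V g C assume V: "unitary_matrix V" and uR: "diag_conj V g \<in> R" and C: "0 \<le> C"
      and df: "\<forall>i j. arg_defect (f j) (g i) C"
    let ?p = "overlap W V"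
    have u: "absarg (diag_conj V g) = diag_conj V (\<lambda>i. of_real \<bar>Arg (g i)\<bar>)" by (rule absarg_diag_conj [OF V])
    \<comment> \<open>The unit row sums of \<open>overlap\<close> let the term with \<open>W\<close>
      alone be written with the weights of the mixed term.\<close>
    have spl: "inner (diag_conj W a) (diag_conj W b - diag_conj V c) =
      (\<Sum>j\<in>UNIV. \<Sum>i\<in>UNIV. ?p j i * Re (cnj (a j) * (b j - c i)))" for a b c
    proof -
      have "inner (diag_conj W a) (diag_conj W b) = (\<Sum>j\<in>UNIV. \<Sum>i\<in>UNIV. ?p j i * Re (cnj (a j) * b j))"
        unfolding inner_diag_conj_same [OF W] using overlap_sum [OF W V] by (simp flip: sum_distrib_right)
      then show ?thesis
        unfolding inner_diff_right inner_diag_conj [OF W V]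
        by (simp only: right_diff_distrib minus_complex.sel flip: sum_subtractf)
    qed
    \<comment> \<open>\<open>k\<close> attains the norm at \<open>absarg v\<close> and stays below
      it at the other matrix, so two noncommuting matrices are compared through one linear
      functional.\<close>
    have "len v - len (diag_conj V g) \<le> inner k (absarg v - absarg (diag_conj V g))"
    proof -
      have g1: "\<bar>Arg (cnj z)\<bar> = \<bar>Arg z\<bar>" for z by (rule abs_Arg_cnj)
      have "absarg (diag_conj V g) \<in> R"
        unfolding u by (rule calculus_R [OF V uR]) (simp add: g1)
      then have "inner k (absarg (diag_conj V g)) \<le> len (diag_conj V g)" unfolding k_def len_def by (rule kle)
      then show ?thesis using kA by (simp add: k_def inner_diff_right)
    qed
    also have "\<dots> = (\<Sum>j\<in>UNIV. \<Sum>i\<in>UNIV. ?p j i * (\<kappa> j * (\<bar>Arg (f j)\<bar> - \<bar>Arg (g i)\<bar>)))"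
      unfolding k_def vW absarg_diag_conj [OF W] u spl by simp
    also have "\<dots> \<le> (\<Sum>j\<in>UNIV. \<Sum>i\<in>UNIV. ?p j i * (Re (cnj (arg_gradient (f j) * of_real (\<kappa> j)) * (f j - g i))
        + C * bound * (cmod (f j - g i))\<^sup>2))"
    proof (intro sum_mono mult_left_mono overlap_nonneg)
      fix i j
      \<comment> \<open>Here positivity of the certificate enters: the one-sided scalar estimate is
        multiplied by \<open>\<kappa> j\<close>.\<close>
      have "\<kappa> j * (\<bar>Arg (f j)\<bar> - \<bar>Arg (g i)\<bar>) \<le>
        \<kappa> j * (Re (cnj (arg_gradient (f j)) * (f j - g i)) + C * (cmod (f j - g i))\<^sup>2)"
        using spec [OF spec [OF df], of j i] \<kappa> [of j] unfolding arg_defect_def by (intro mult_left_mono)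
      also have "\<dots> = Re (cnj (arg_gradient (f j) * of_real (\<kappa> j)) * (f j - g i)) + \<kappa> j * (C * (cmod (f j - g i))\<^sup>2)"
        by (simp add: algebra_simps)
      also have "\<kappa> j * (C * (cmod (f j - g i))\<^sup>2) \<le> bound * (C * (cmod (f j - g i))\<^sup>2)"
        using \<kappa>_le C by (intro mult_right_mono) auto
      finally show "\<kappa> j * (\<bar>Arg (f j)\<bar> - \<bar>Arg (g i)\<bar>) \<le>
        Re (cnj (arg_gradient (f j) * of_real (\<kappa> j)) * (f j - g i)) + C * bound * (cmod (f j - g i))\<^sup>2"
        by (simp add: mult_ac)
    qed
    also have "\<dots> = inner (q ** k) (v - diag_conj V g) + C * bound * (norm (v - diag_conj V g))\<^sup>2"
      unfolding qk vW spl norm_diag_conj_diff [OF W V]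
      by (simp only: distrib_left sum.distrib sum_distrib_left mult.left_commute)
    finally show "len v - len (diag_conj V g) \<le> inner (q ** k) (v - diag_conj V g) + C * bound * (norm (v - diag_conj V g))\<^sup>2" .
  qed
qed

text \<open>The functional is taken at the moving point \<open>v\<close>, whose eigenvalues are
  unrestricted. The constant comes from the eigenvalues of the fixed \<open>u\<close> through
  \<open>arg_defect_fixed_target\<close>.\<close>

lemma len_upper_estimate:
  assumes u: "u \<in> R" "unitary_matrix u"
  shows "\<exists>C. \<forall>v\<in>R. unitary_matrix v \<longrightarrow> len v \<le> len u + M (v - u) + C * (norm (v - u))\<^sup>2"
proof -
  obtain V g where V: "unitary_matrix V" and uV: "u = diag_conj V g" and g1: "\<And>i. cmod (g i) = 1"
    by (rule unitary_diagonalization [OF u(2)], rule that)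
  obtain c where c: "\<And>i. c i \<ge> 0" "\<And>i z. cmod z = 1 \<Longrightarrow> arg_defect z (g i) (c i)"
    using arg_defect_fixed_target [OF g1] by metis
  have "len v \<le> len u + M (v - u) + sum c UNIV * bound * (norm (v - u))\<^sup>2" if v: "v \<in> R" "unitary_matrix v" for v
  proof -
    obtain W f k where "unitary_matrix W" "v = diag_conj W f" and f1: "\<And>j. cmod (f j) = 1"
      and kR: "k \<in> R" and kle: "\<And>z. z \<in> R \<Longrightarrow> inner k z \<le> M z"
      and "(\<forall>j. f j \<noteq> - 1) \<longrightarrow> inner k (v ** mlog v) = len v"
      and est: "\<forall>V g C. unitary_matrix V \<longrightarrow> diag_conj V g \<in> R \<longrightarrow> 0 \<le> C \<longrightarrow>
      (\<forall>i j. arg_defect (f j) (g i) C) \<longrightarrow>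
      len v - len (diag_conj V g) \<le> inner k (v - diag_conj V g) + C * bound * (norm (v - diag_conj V g))\<^sup>2"
      by (rule len_first_order [OF v], rule that)
    have "arg_defect (f j) (g i) (sum c UNIV)" for i j
      using arg_defect_mono [OF c(2) [OF f1]] member_le_sum [of i UNIV c] c(1) by simp
    then have "len v - len u \<le> inner k (v - u) + sum c UNIV * bound * (norm (v - u))\<^sup>2"
      using est V u c(1) sum_nonneg [of UNIV c] unfolding uV by blast
    moreover have "inner k (v - u) \<le> M (v - u)" using u v by (intro kle diff_R)
    ultimately show ?thesis by linarith
  qed
  then show ?thesis by blast
qed

text \<open>The functional now sits at the fixed \<open>v\<close> and serves all \<open>u\<close>,
  so it can be compared with a derivative at \<open>v\<close>. The constant comes from
  \<open>arg_defect_fixed_source\<close>, hence from \<open>regular v\<close>.\<close>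

lemma len_lower_estimate:
  assumes v: "v \<in> R" "unitary_matrix v" and reg: "regular v"
  obtains k C where "k \<in> R" "\<And>z. z \<in> R \<Longrightarrow> inner k z \<le> M z" "inner k (v ** mlog v) = len v"
    "\<And>u. u \<in> R \<Longrightarrow> unitary_matrix u \<Longrightarrow> len v - len u \<le> inner k (v - u) + C * (norm (v - u))\<^sup>2"
proof -
  obtain W f k where W: "unitary_matrix W" and vW: "v = diag_conj W f" and f1: "\<And>j. cmod (f j) = 1"
    and kR: "k \<in> R" and kle: "\<And>z. z \<in> R \<Longrightarrow> inner k z \<le> M z"
    and klog: "(\<forall>j. f j \<noteq> - 1) \<longrightarrow> inner k (v ** mlog v) = len v"
    and est: "\<forall>V g C. unitary_matrix V \<longrightarrow> diag_conj V g \<in> R \<longrightarrow> 0 \<le> C \<longrightarrow>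
      (\<forall>i j. arg_defect (f j) (g i) C) \<longrightarrow>
      len v - len (diag_conj V g) \<le> inner k (v - diag_conj V g) + C * bound * (norm (v - diag_conj V g))\<^sup>2"
    by (rule len_first_order [OF v], rule that)
  have fn: "f j \<noteq> - 1" for j by (rule regular_diag_conj [OF reg W vW])
  obtain c where c: "\<And>j. c j \<ge> 0" "\<And>j w. cmod w = 1 \<Longrightarrow> arg_defect (f j) w (c j)"
    using arg_defect_fixed_source [OF f1 fn] by metis
  show ?thesis
  proof (rule that [OF kR kle mp [OF klog]])
    show "\<forall>j. f j \<noteq> - 1" using fn by blast
  next
    fix u assume u: "u \<in> R" "unitary_matrix u"
    obtain V g where V: "unitary_matrix V" and uV: "u = diag_conj V g" and g1: "\<And>i. cmod (g i) = 1"
      by (rule unitary_diagonalization [OF u(2)], rule that)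
    have "arg_defect (f j) (g i) (sum c UNIV)" for i j
      using arg_defect_mono [OF c(2) [OF g1]] member_le_sum [of j UNIV c] c(1) by simp
    then show "len v - len u \<le> inner k (v - u) + sum c UNIV * bound * (norm (v - u))\<^sup>2"
      using est V u c(1) sum_nonneg [of UNIV c] unfolding uV by blast
  qed
qed

lemma small_exp:
  assumes x: "x \<in> R" and sm: "small x"
  shows "regular (matrix_exp x)" "mlog (matrix_exp x) = x" "len (matrix_exp x) = M x"
    "matrix_exp x \<in> R" "unitary_matrix (matrix_exp x)"
proof -
  obtain U d where U: "unitary_matrix U" and xU: "x = diag_conj U (\<lambda>i. \<i> * of_real (d i))" and d: "\<And>i. \<bar>d i\<bar> < pi"
    using sm unfolding small_def by blast
  have e: "matrix_exp x = diag_conj U (\<lambda>i. cis (d i))"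
    using matrix_exp_scaleR_diag_conj [OF U, of 1 d] by (simp add: xU)
  have ar: "Arg (cis (d i)) = d i" for i using d [of i] by (intro Arg_cis) auto
  have "cis (d i) \<noteq> - 1" for i
  proof
    assume "cis (d i) = - 1"
    then have "Arg (cis (d i)) = pi" by (metis Arg_eq_pi Re_complex_of_real Im_complex_of_real of_real_1 of_real_minus neg_less_0_iff_less zero_less_one)
    then show False using ar d [of i] by simp
  qed
  then show "regular (matrix_exp x)" unfolding regular_def e using U by (intro exI conjI) auto
  show "mlog (matrix_exp x) = x" unfolding e mlog_diag_conj [OF U] ar by (rule xU [symmetric])
  show "matrix_exp x \<in> R" "unitary_matrix (matrix_exp x)"
    using exp_R [OF x small_skew [OF sm], of 1] unitary_matrix_exp [OF small_skew [OF sm], of 1] by simp_all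
  then have aR: "absarg (matrix_exp x) \<in> R" by (intro absarg_R)
  \<comment> \<open>Polar decomposition of \<open>x\<close>: a unitary of \<open>R\<close> that
    carries the absolute value to \<open>x\<close>. The value \<open>1\<close> at eigenvalue
    \<open>0\<close> keeps it unitary.\<close>
  define \<phi> where "\<phi> = (\<lambda>z. if Im z > 0 then \<i> else if Im z < 0 then - \<i> else 1)"
  define j where "j = diag_conj U (\<lambda>i. \<phi> (\<i> * of_real (d i)))"
  have jR: "j \<in> R" unfolding j_def
    by (rule calculus_R [OF U]) (use x xU in \<open>auto simp: \<phi>_def\<close>)
  have j_unit: "unitary_matrix j" unfolding j_def diag_conj_unitary_iff [OF U] by (simp add: \<phi>_def)
  have "j ** absarg (matrix_exp x) = diag_conj U (\<lambda>i. \<phi> (\<i> * of_real (d i)) * of_real \<bar>d i\<bar>)"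
    unfolding e absarg_diag_conj [OF U] ar j_def diag_conj_mult [OF U] ..
  also have "\<dots> = x"
    unfolding xU by (intro arg_cong [of _ _ "diag_conj U"] ext) (auto simp: \<phi>_def abs_if)
  finally have "j ** absarg (matrix_exp x) = x" .
  then show "len (matrix_exp x) = M x" unfolding len_def using invariant_left [OF jR j_unit aR] by simp
qed

lemma regular_mlog:
  assumes v: "v \<in> R" "unitary_matrix v" and reg: "regular v"
  shows "small (mlog v)" "mlog v \<in> R" "matrix_exp (mlog v) = v" "M (mlog v) = len v"
proof -
  obtain U f where U: "unitary_matrix U" and vU: "v = diag_conj U f" and f: "\<And>i. cmod (f i) = 1" "\<And>i. f i \<noteq> - 1"
    using reg unfolding regular_def by blast
  have m: "mlog v = diag_conj U (\<lambda>i. \<i> * of_real (Arg (f i)))" unfolding vU by (rule mlog_diag_conj [OF U])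
  have "Arg (f i) \<noteq> pi" for i
  proof
    assume "Arg (f i) = pi"
    then show False using cis_Arg_unit [OF f(1), of i] f(2) [of i] by simp
  qed
  then have "Arg (f i) < pi" for i using Arg_le_pi [of "f i"] by (simp add: less_le)
  then have "\<bar>Arg (f i)\<bar> < pi" for i using mpi_less_Arg [of "f i"] by (metis abs_less_iff minus_less_iff)
  then show sm: "small (mlog v)" unfolding small_def m using U by (intro exI conjI allI) auto
  show e: "matrix_exp (mlog v) = v"
    unfolding m matrix_exp_diag_conj [OF U] cis_conv_exp [symmetric] cis_Arg_unit [OF f(1)] by (rule vU [symmetric])
  have fr: "Arg (f i) = 0" if "f i \<in> \<real>" for i
  proof -
    have "Im (f i) = 0" using that by (simp add: complex_is_Real_iff)
    moreover then have "(Re (f i))\<^sup>2 = 1" using f(1) [of i] cmod_power2 [of "f i"] by simp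
    ultimately have "f i = 1" using f(2) [of i] by (auto simp: complex_eq_iff power2_eq_1_iff)
    then show ?thesis by simp
  qed
  \<comment> \<open>On the negative real axis \<open>\<i> * of_real (Arg z)\<close> does not commute
    with conjugation. Setting it to \<open>0\<close> on all reals restores the symmetry and changes
    nothing here, since \<open>1\<close> is the only possible real eigenvalue of
    \<open>v\<close>.\<close>
  define \<phi> where "\<phi> = (\<lambda>z. if z \<in> \<real> then 0 else \<i> * of_real (Arg z))"
  have "mlog v = diag_conj U (\<lambda>i. \<phi> (f i))"
    unfolding m by (intro arg_cong [of _ _ "diag_conj U"] ext) (auto simp: \<phi>_def fr)
  also have "\<dots> \<in> R"
  proof (rule calculus_R [OF U, of f \<phi>])
    have "cnj z \<in> \<real> \<longleftrightarrow> z \<in> \<real>" for z by (simp add: complex_is_Real_iff)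
    then show "\<phi> (cnj z) = cnj (\<phi> z)" for z by (simp add: \<phi>_def Arg_cnj)
  qed (use v vU in simp)
  finally show mR: "mlog v \<in> R" .
  show "M (mlog v) = len v" using small_exp(3) [OF mR sm] e by simp
qed

text \<open>\<open>M\<close> attains a positive minimum on the compact unit sphere of
  \<open>R\<close>, where it is definite.\<close>

lemma definite_lower_bound: obtains c where "c > 0" "\<And>x. x \<in> R \<Longrightarrow> c * norm x \<le> M x"
proof -
  have "compact (R \<inter> sphere 0 1)"
    by (simp add: subspace_R closed_Int_compact closed_subspace)
  moreover have "mat 1 /\<^sub>R norm (mat 1 :: complex^'n^'n) \<in> R \<inter> sphere 0 1"
  proof -
    have "(mat 1 :: complex^'n^'n) \<noteq> 0" by (simp add: vec_eq_iff mat_def)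
    then show ?thesis using scale_R [OF one_R] by simp
  qed
  ultimately obtain w where w: "w \<in> R" "norm w = 1" and min: "\<And>y. y \<in> R \<Longrightarrow> norm y = 1 \<Longrightarrow> M w \<le> M y"
    using continuous_attains_inf [of "R \<inter> sphere 0 1" M] continuous_on_seminorm
    by (metis (no_types, lifting) Int_iff empty_iff mem_sphere_0)
  show ?thesis
  proof (rule that [of "M w"])
    have "M w \<noteq> 0" using w definite [of w] by auto
    then show "M w > 0" by (simp add: less_le)
    fix x assume x: "x \<in> R"
    show "M w * norm x \<le> M x"
    proof (cases "x = 0")
      case False
      then have "M w \<le> M (x /\<^sub>R norm x)" using x scale_R by (intro min) auto
      then show ?thesis using False by (simp add: scale field_simps)
    qed simp
  qed
qed

lemma len_nonneg: "0 \<le> len v"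
  by (simp add: len_def)

lemma len_eq_0:
  assumes v: "v \<in> R" "unitary_matrix v" and 0: "len v = 0" shows "v = mat 1"
proof -
  obtain U f where U: "unitary_matrix U" "v = diag_conj U f" "\<And>i. cmod (f i) = 1"
    by (rule unitary_diagonalization [OF v(2)], rule that)
  have "absarg v = 0" using definite [OF absarg_R] v 0 by (simp add: len_def)
  then have "diag_conj U (\<lambda>i. of_real \<bar>Arg (f i)\<bar>) = diag_conj U (\<lambda>i. 0)"
    unfolding U(2) absarg_diag_conj [OF U(1)] by simp
  then have "(\<lambda>i. complex_of_real \<bar>Arg (f i)\<bar>) = (\<lambda>i. 0)" by (rule diag_conj_inj [OF U(1)])
  then have "complex_of_real \<bar>Arg (f i)\<bar> = 0" for i by (rule fun_cong)
  then have "Arg (f i) = 0" for i by simp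
  then have "f i = 1" for i using cis_Arg_unit [OF U(3), of i] by simp
  then have "f = (\<lambda>i. 1)" by (rule ext)
  then show ?thesis using U diag_conj_1 [OF U(1)] by simp
qed

lemma len_mat_1 [simp]: "len (mat 1) = 0"
  using absarg_diag_conj [of "mat 1" "\<lambda>i::'n. 1"] diag_conj_1 [of "mat 1 :: complex^'n^'n"] by (simp add: len_def)

text \<open>An eigenvalue \<open>-1\<close> makes the norm of \<open>absarg v\<close> at least
  \<open>pi\<close>, hence \<open>len v\<close> at least \<open>c * pi\<close>.\<close>

lemma short_regular: obtains r where "r > 0" "\<And>v. v \<in> R \<Longrightarrow> unitary_matrix v \<Longrightarrow> len v < r \<Longrightarrow> regular v"
proof -
  obtain c where c: "c > 0" "\<And>x. x \<in> R \<Longrightarrow> c * norm x \<le> M x" by (rule definite_lower_bound, rule that)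
  show ?thesis
  proof (rule that [of "c * pi"])
    show "c * pi > 0" using c by simp
    fix v assume v: "v \<in> R" "unitary_matrix v" and l: "len v < c * pi"
    obtain U f where U: "unitary_matrix U" "v = diag_conj U f" "\<And>i. cmod (f i) = 1"
      by (rule unitary_diagonalization [OF v(2)], rule that)
    have "c * norm (absarg v) < c * pi" using c(2) [OF absarg_R] v l by (fastforce simp: len_def)
    then have "norm (absarg v) < pi" using c(1) by simp
    then have lt: "\<bar>Arg (f i)\<bar> < pi" for i
      using norm_diag_conj [OF U(1), of "\<lambda>i. of_real \<bar>Arg (f i)\<bar>" i]
      unfolding U(2) absarg_diag_conj [OF U(1)] by simp
    have "f i \<noteq> - 1" for i
    proof
      assume "f i = - 1"
      then have "Arg (f i) = pi" using Arg_of_real [of "-1"] by simp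
      then show False using lt [of i] by simp
    qed
    then show "regular v" unfolding regular_def using U by blast
  qed
qed

text \<open>The upper estimate based at \<open>\<gamma> t\<close> is divided by
  \<open>h > 0\<close>; as \<open>h\<close> tends to \<open>0\<close> the quadratic term
  vanishes.\<close>

lemma len_derivative_le:
  assumes \<gamma>: "\<And>s. s \<in> {a..b} \<Longrightarrow> \<gamma> s \<in> R \<and> unitary_matrix (\<gamma> s)" and t: "t \<in> {a<..<b}"
    and d: "(\<gamma> has_vector_derivative y) (at t)" and D: "((\<lambda>s. len (\<gamma> s)) has_real_derivative D) (at t)"
  shows "D \<le> M y"
proof -
  obtain C where C: "\<And>v. v \<in> R \<Longrightarrow> unitary_matrix v \<Longrightarrow>
      len v \<le> len (\<gamma> t) + M (v - \<gamma> t) + C * (norm (v - \<gamma> t))\<^sup>2"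
    using len_upper_estimate [of "\<gamma> t"] \<gamma> [of t] t by auto
  have D': "((\<lambda>h. (len (\<gamma> (t + h)) - len (\<gamma> t)) / h) \<longlongrightarrow> D) (at_right 0)"
    using D unfolding DERIV_def by (rule filterlim_mono) (auto intro: at_le)
  have d': "((\<lambda>h. (\<gamma> (t + h) - \<gamma> t) /\<^sub>R h) \<longlongrightarrow> y) (at_right 0)"
  proof -
    have "(\<gamma> has_derivative (\<lambda>h. h *\<^sub>R y)) (at t)" using d by (simp add: has_vector_derivative_def)
    then have "((\<lambda>h. norm (\<gamma> (t + h) - \<gamma> t - h *\<^sub>R y) / norm h) \<longlongrightarrow> 0) (at 0)" by (simp add: has_derivative_at)
    then have "((\<lambda>h. norm (\<gamma> (t + h) - \<gamma> t - h *\<^sub>R y) / norm h) \<longlongrightarrow> 0) (at_right 0)"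
      by (rule filterlim_mono) (auto intro: at_le)
    moreover have "\<forall>\<^sub>F h in at_right 0. norm (\<gamma> (t + h) - \<gamma> t - h *\<^sub>R y) / norm h = norm ((\<gamma> (t + h) - \<gamma> t) /\<^sub>R h - y)"
      unfolding eventually_at_right_field
    proof (intro exI [of _ 1] conjI allI impI)
      fix h :: real assume "0 < h" "h < 1"
      then have "(\<gamma> (t + h) - \<gamma> t) /\<^sub>R h - y = (\<gamma> (t + h) - \<gamma> t - h *\<^sub>R y) /\<^sub>R h"
        by (simp add: scaleR_diff_right)
      then show "norm (\<gamma> (t + h) - \<gamma> t - h *\<^sub>R y) / norm h = norm ((\<gamma> (t + h) - \<gamma> t) /\<^sub>R h - y)"
        by (simp add: divide_inverse mult.commute)
    qed simp
    ultimately have "((\<lambda>h. norm ((\<gamma> (t + h) - \<gamma> t) /\<^sub>R h - y)) \<longlongrightarrow> 0) (at_right 0)"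
      by (rule Lim_transform_eventually)
    then show ?thesis by (simp add: tendsto_norm_zero_iff LIM_zero_iff)
  qed
  have id0: "((\<lambda>h::real. h) \<longlongrightarrow> 0) (at_right 0)" by (rule tendsto_ident_at)
  have Mlim: "((\<lambda>h. M ((\<gamma> (t + h) - \<gamma> t) /\<^sub>R h)) \<longlongrightarrow> M y) (at_right 0)"
    using continuous_on_tendsto_compose [OF continuous_on_seminorm [of UNIV] d'] by simp
  have rhs: "((\<lambda>h. M ((\<gamma> (t + h) - \<gamma> t) /\<^sub>R h) + C * (h * (norm ((\<gamma> (t + h) - \<gamma> t) /\<^sub>R h))\<^sup>2)) \<longlongrightarrow> M y + C * (0 * (norm y)\<^sup>2)) (at_right 0)"
    by (intro tendsto_intros Mlim d' id0)
  have "D \<le> M y + C * (0 * (norm y)\<^sup>2)"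
  proof (rule tendsto_le [OF _ rhs D'])
    show "\<forall>\<^sub>F h in at_right 0. (len (\<gamma> (t + h)) - len (\<gamma> t)) / h \<le>
       M ((\<gamma> (t + h) - \<gamma> t) /\<^sub>R h) + C * (h * (norm ((\<gamma> (t + h) - \<gamma> t) /\<^sub>R h))\<^sup>2)"
      unfolding eventually_at_right_field
    proof (intro exI [of _ "b - t"] conjI allI impI)
      show "b - t > 0" using t by simp
      fix h assume h: "0 < h" "h < b - t"
      define w where "w = (\<gamma> (t + h) - \<gamma> t) /\<^sub>R h"
      have hw: "\<gamma> (t + h) - \<gamma> t = h *\<^sub>R w" using h by (simp add: w_def)
      have "len (\<gamma> (t + h)) - len (\<gamma> t) \<le> M (h *\<^sub>R w) + C * (norm (h *\<^sub>R w))\<^sup>2"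
        using C [of "\<gamma> (t + h)"] \<gamma> [of "t + h"] h t unfolding hw by auto
      also have "\<dots> = (M w + C * (h * (norm w)\<^sup>2)) * h"
        using h by (simp add: scale power2_eq_square algebra_simps)
      finally show "(len (\<gamma> (t + h)) - len (\<gamma> t)) / h \<le> M ((\<gamma> (t + h) - \<gamma> t) /\<^sub>R h) + C * (h * (norm ((\<gamma> (t + h) - \<gamma> t) /\<^sub>R h))\<^sup>2)"
        using h by (simp add: pos_divide_le_eq w_def)
    qed
  qed simp
  then show ?thesis by simp
qed

lemma exp_curve_lipschitz:
  fixes x :: "complex^'n^'n"
  assumes x: "x \<in> skew_hermitian"
  shows "norm (matrix_exp (s *\<^sub>R x) - matrix_exp (t *\<^sub>R x)) \<le> norm x * \<bar>s - t\<bar>"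
proof -
  have "norm (matrix_exp (s *\<^sub>R x) - matrix_exp (t *\<^sub>R x)) \<le> norm x * norm (s - t)"
  proof (rule differentiable_bound [OF convex_UNIV])
    show "((\<lambda>t. matrix_exp (t *\<^sub>R x)) has_derivative (\<lambda>h. h *\<^sub>R (matrix_exp (t *\<^sub>R x) ** x))) (at t within UNIV)" for t
      using matrix_exp_derivative [OF x, of t] by (simp add: has_vector_derivative_def)
    show "onorm (\<lambda>h. h *\<^sub>R (matrix_exp (t *\<^sub>R x) ** x)) \<le> norm x" for t
    proof (rule onorm_le)
      fix h :: real
      have "norm (matrix_exp (t *\<^sub>R x) ** x) = norm x"
        by (rule norm_unitary_mult [OF unitary_matrix_exp [OF x]])
      then show "norm (h *\<^sub>R (matrix_exp (t *\<^sub>R x) ** x)) \<le> norm x * norm h" by (simp add: mult.commute)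
    qed
  qed auto
  then show ?thesis by simp
qed

text \<open>A triangle inequality for \<open>len\<close>: along
  \<open>w ** matrix_exp (t *\<^sub>R y)\<close> the speed is constantly \<open>M y\<close>, which
  bounds the growth of \<open>len\<close>.\<close>

lemma len_mult_exp:
  assumes w: "w \<in> R" "unitary_matrix w" and y: "y \<in> R" "y \<in> skew_hermitian" and r: "0 \<le> r"
  shows "len (w ** matrix_exp (r *\<^sub>R y)) \<le> len w + r * M y"
proof -
  let ?\<gamma> = "\<lambda>t. w ** matrix_exp (t *\<^sub>R y)"
  have \<gamma>R: "?\<gamma> t \<in> R" "unitary_matrix (?\<gamma> t)" for t
    using w y exp_R unitary_matrix_exp mult_R unitary_matrix_mult by blast+
  have der: "(?\<gamma> has_vector_derivative w ** (matrix_exp (t *\<^sub>R y) ** y)) (at t)" for t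
    by (rule bounded_linear.has_vector_derivative [OF bounded_bilinear.bounded_linear_right [OF bounded_bilinear_matrix_mult] matrix_exp_derivative [OF y(2)]])
  have ac: "absolutely_continuous_on 0 r ?\<gamma>"
  proof (rule absolutely_continuous_on_lipschitz [where C = "norm y"])
    fix s t
    have "norm (?\<gamma> s - ?\<gamma> t) = norm (matrix_exp (s *\<^sub>R y) - matrix_exp (t *\<^sub>R y))"
      using norm_unitary_mult(1) [OF w(2)] by (metis matrix_mult_diff_right)
    then show "norm (?\<gamma> s - ?\<gamma> t) \<le> norm y * \<bar>s - t\<bar>" using exp_curve_lipschitz [OF y(2)] by simp
  qed
  have "len (?\<gamma> r) - len (?\<gamma> 0) \<le> curve_length M 0 r ?\<gamma>"
  proof (rule le_curve_length [OF r ac, where C = "bound * (pi / 2)"])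
    show "\<bar>len (?\<gamma> s) - len (?\<gamma> t)\<bar> \<le> bound * (pi / 2) * norm (?\<gamma> s - ?\<gamma> t)" for s t
      by (rule len_lipschitz [OF \<gamma>R(2) \<gamma>R(2)])
    show "D \<le> M z" if "t \<in> {0<..<r}" "(?\<gamma> has_vector_derivative z) (at t)" "((\<lambda>s. len (?\<gamma> s)) has_real_derivative D) (at t)" for t z D
      by (rule len_derivative_le [OF _ that]) (use \<gamma>R in blast)
  qed
  also have "curve_length M 0 r ?\<gamma> = M y * (r - 0)"
  proof (rule curve_length_constant_speed [OF r der])
    show "M (w ** (matrix_exp (t *\<^sub>R y) ** y)) = M y" for t
      using w y exp_R unitary_matrix_exp mult_R invariant_left by metis
  qed
  finally show ?thesis by (simp add: matrix_exp_0 mult.commute)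
qed

text \<open>Where the triangle inequality for the intrinsic metric is an equality, a support functional
  at \<open>z\<close> is also one at \<open>y\<close>.\<close>

lemma split_parallel:
  assumes strict: "\<And>x y. x \<in> R \<Longrightarrow> y \<in> R \<Longrightarrow> M x = 1 \<Longrightarrow> M y = 1 \<Longrightarrow> M (x + y) \<ge> 2 \<Longrightarrow> x = y"
    and z: "z \<in> R" "small z" and y: "y \<in> R" "y \<in> skew_hermitian" and w: "w \<in> R" "unitary_matrix w"
    and eq: "matrix_exp z = w ** matrix_exp y" and len: "len w + M y \<le> M z" and y0: "y \<noteq> 0"
  shows "y /\<^sub>R M y = z /\<^sub>R M z"
proof -
  define v where "v = matrix_exp z"
  note ze = small_exp [OF z, folded v_def]
  obtain k C where kR: "k \<in> R" and kle: "\<And>z. z \<in> R \<Longrightarrow> inner k z \<le> M z" and kz: "inner k (v ** mlog v) = len v"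
    and est: "\<And>u. u \<in> R \<Longrightarrow> unitary_matrix u \<Longrightarrow> len v - len u \<le> inner k (v - u) + C * (norm (v - u))\<^sup>2"
    by (rule len_lower_estimate [OF ze(4,5,1)], rule that)
  define u where "u = (\<lambda>s. v ** matrix_exp ((- s) *\<^sub>R y))"
  have uR: "u s \<in> R" "unitary_matrix (u s)" for s
    unfolding u_def using ze y exp_R unitary_matrix_exp mult_R unitary_matrix_mult by blast+
  have uw: "u s = w ** matrix_exp ((1 - s) *\<^sub>R y)" for s
    unfolding u_def v_def eq using matrix_exp_add [OF y(2), of 1 "- s"] by (simp add: matrix_mul_assoc)
  \<comment> \<open>The hypothesis leaves no slack in the triangle inequality, so stepping back from
    \<open>v\<close> by \<open>s\<close> lowers \<open>len\<close> by at least
    \<open>s * M y\<close>; the lower estimate bounds this loss through \<open>k\<close>.\<close>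
  have dec: "s * M y \<le> inner k (v - u s) + C * (norm (v - u s))\<^sup>2" if "0 \<le> s" "s \<le> 1" for s
  proof -
    have "len (u s) \<le> len w + (1 - s) * M y" unfolding uw using that by (intro len_mult_exp w y) simp
    then have "s * M y \<le> len v - len (u s)" using len ze(3) by (simp add: algebra_simps)
    also have "\<dots> \<le> inner k (v - u s) + C * (norm (v - u s))\<^sup>2" by (rule est [OF uR])
    finally show ?thesis .
  qed
  \<comment> \<open>\<open>F\<close> is nonnegative on the unit interval and vanishes at
    \<open>0\<close>, so its derivative there, \<open>inner k (v ** y) - M y\<close>, is
    nonnegative; the quadratic term does not contribute.\<close>
  define F where "F = (\<lambda>s. inner k (v - u s) + C * (inner (v - u s) (v - u s)) - s * M y)"
  have u0: "u 0 = v" by (simp add: u_def matrix_exp_0)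
  have ud: "(u has_derivative (\<lambda>h. - (h *\<^sub>R (v ** y)))) (at 0)"
  proof -
    have "((\<lambda>s. matrix_exp (s *\<^sub>R (- y))) has_vector_derivative matrix_exp (0 *\<^sub>R (- y)) ** (- y)) (at 0)"
      using y(2) by (intro matrix_exp_derivative) (simp add: skew_hermitian_def adjoint_minus)
    then have "((\<lambda>s. matrix_exp ((- s) *\<^sub>R y)) has_vector_derivative (- y)) (at 0)"
      by (simp add: matrix_exp_0)
    then have "(u has_vector_derivative v ** (- y)) (at 0)" unfolding u_def
      by (rule bounded_linear.has_vector_derivative [OF bounded_bilinear.bounded_linear_right [OF bounded_bilinear_matrix_mult]])
    then show ?thesis by (simp add: has_vector_derivative_def matrix_mult_minus_right)
  qed
  have "(F has_derivative (\<lambda>h. h * (inner k (v ** y) - M y))) (at 0)"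
    unfolding F_def
    by (rule derivative_eq_intros ud refl)+ (auto simp: u0 algebra_simps fun_eq_iff)
  then have "(F has_real_derivative (inner k (v ** y) - M y)) (at 0)"
    by (simp add: has_field_derivative_def mult_commute_abs)
  then have lim: "((\<lambda>h. (F (0 + h) - F 0) / h) \<longlongrightarrow> inner k (v ** y) - M y) (at_right 0)"
    unfolding DERIV_def by (rule filterlim_mono) (auto intro: at_le)
  have "0 \<le> inner k (v ** y) - M y"
  proof (rule tendsto_lowerbound [OF lim])
    show "\<forall>\<^sub>F h in at_right 0. 0 \<le> (F (0 + h) - F 0) / h"
      unfolding eventually_at_right_field
    proof (intro exI [of _ 1] conjI allI impI)
      fix h :: real assume h: "0 < h" "h < 1"
      then have "0 \<le> F h" using dec [of h] by (simp add: F_def power2_norm_eq_inner)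
      moreover have "F 0 = 0" by (simp add: F_def u0)
      ultimately show "0 \<le> (F (0 + h) - F 0) / h" using h by simp
    qed simp
  qed simp
  then have ky: "M y \<le> inner k (v ** y)" by simp
  have kz': "inner k (v ** z) = M z" using kz ze(2,3) by simp
  have "M y \<noteq> 0" using y0 definite [OF y(1)] by blast
  then have My: "M y > 0" by (simp add: less_le)
  then have Mz: "M z > 0" using len len_nonneg [of w] by linarith
  \<comment> \<open>The same functional has value at least \<open>1\<close> on both normalized
    vectors, translated by \<open>v\<close>, so their sum has norm at least \<open>2\<close> and
    strict convexity applies.\<close>
  have "2 \<le> M (y /\<^sub>R M y + z /\<^sub>R M z)"
  proof -
    let ?s = "y /\<^sub>R M y + z /\<^sub>R M z"
    have sR: "?s \<in> R" using y z by (intro add_R scale_R)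
    have "2 \<le> inverse (M y) * inner k (v ** y) + inverse (M z) * inner k (v ** z)"
      using ky kz' My Mz by (simp add: field_simps)
    also have "\<dots> = inner k (v ** ?s)"
      by (simp add: matrix_mult_add_right matrix_mult_scaleR_right inner_add_right)
    also have "\<dots> \<le> M (v ** ?s)" using ze sR by (intro kle mult_R)
    also have "\<dots> = M ?s" using ze sR by (intro invariant_left)
    finally show ?thesis .
  qed
  then show ?thesis using y z My Mz by (intro strict scale_R) (auto simp: scale)
qed

end

subsection \<open>Geodesics\<close>

text \<open>Curves run in a Euclidean space that \<open>\<iota>\<close> embeds as the matrix algebra \<open>R\<close>; this covers
  complex matrices (\<open>\<iota>\<close> the identity) and real ones (\<open>\<iota>\<close> the complexification) at once.\<close>

locale curve_geometry = invariant_geometry M R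
  for M :: "complex^'n^'n \<Rightarrow> real" and R +
  fixes \<iota> :: "'v::euclidean_space \<Rightarrow> complex^'n^'n" and \<pi> :: "complex^'n^'n \<Rightarrow> 'v" and G :: "'v set"
  assumes \<iota>_lin: "bounded_linear \<iota>" and \<pi>_lin: "bounded_linear \<pi>"
    and \<pi>_\<iota>: "\<pi> (\<iota> v) = v" and \<iota>_\<pi>: "x \<in> R \<Longrightarrow> \<iota> (\<pi> x) = x" and \<iota>_R: "\<iota> v \<in> R"
    and G_unitary: "u \<in> G \<Longrightarrow> unitary_matrix (\<iota> u)" and G_ne: "G \<noteq> {}"
    and G_exp: "u \<in> G \<Longrightarrow> x \<in> R \<Longrightarrow> x \<in> skew_hermitian \<Longrightarrow> \<pi> (\<iota> u ** matrix_exp x) \<in> G"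
begin

definition N :: "'v \<Rightarrow> real" where "N v = M (\<iota> v)"

definition coset :: "'v \<Rightarrow> 'v \<Rightarrow> real \<Rightarrow> 'v" where
  "coset u x t = \<pi> (\<iota> u ** matrix_exp (t *\<^sub>R \<iota> x))"

text \<open>The adjoint inverts the unitary \<open>\<iota> u\<close>, so this represents the
  left-invariant difference of \<open>u\<close> and \<open>v\<close>.\<close>

definition gap :: "'v \<Rightarrow> 'v \<Rightarrow> complex^'n^'n" where
  "gap u v = adjoint_matrix (\<iota> u) ** \<iota> v"

sublocale sp: seminorm N
  by unfold_locales
     (simp_all add: N_def bounded_linear.linear [OF \<iota>_lin, THEN linear_add] triangle
       bounded_linear.linear [OF \<iota>_lin, THEN linear_scale] scale)

lemma \<iota>_diff: "\<iota> (u - v) = \<iota> u - \<iota> v"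
  by (rule linear_diff [OF bounded_linear.linear [OF \<iota>_lin]])

lemma \<iota>_inj: "\<iota> u = \<iota> v \<Longrightarrow> u = v"
  by (metis \<pi>_\<iota>)

lemma \<iota>_coset:
  assumes "u \<in> G" "\<iota> x \<in> skew_hermitian"
  shows "\<iota> (coset u x t) = \<iota> u ** matrix_exp (t *\<^sub>R \<iota> x)"
  unfolding coset_def by (intro \<iota>_\<pi> mult_R \<iota>_R exp_R assms)

lemma coset_G: "u \<in> G \<Longrightarrow> \<iota> x \<in> skew_hermitian \<Longrightarrow> coset u x t \<in> G"
  unfolding coset_def
  by (rule G_exp) (auto intro: scale_R \<iota>_R simp: skew_hermitian_def adjoint_scaleR)

lemma coset_derivative:
  assumes "u \<in> G" "\<iota> x \<in> skew_hermitian"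
  shows "(coset u x has_vector_derivative \<pi> (\<iota> u ** (matrix_exp (t *\<^sub>R \<iota> x) ** \<iota> x))) (at t)"
  unfolding coset_def
  by (intro bounded_linear.has_vector_derivative [OF \<pi>_lin]
      bounded_linear.has_vector_derivative [OF bounded_bilinear.bounded_linear_right [OF bounded_bilinear_matrix_mult]]
      matrix_exp_derivative assms)

lemma coset_speed:
  assumes "u \<in> G" "\<iota> x \<in> skew_hermitian"
  shows "N (\<pi> (\<iota> u ** (matrix_exp (t *\<^sub>R \<iota> x) ** \<iota> x))) = N x"
proof -
  let ?e = "matrix_exp (t *\<^sub>R \<iota> x)"
  have e: "?e \<in> R" "unitary_matrix ?e" using exp_R [OF \<iota>_R assms(2)] unitary_matrix_exp [OF assms(2)] by auto
  have eR: "?e ** \<iota> x \<in> R" using e \<iota>_R mult_R by blast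
  have "M (\<iota> u ** (?e ** \<iota> x)) = M (\<iota> x)"
    using invariant_left [OF \<iota>_R G_unitary [OF assms(1)] eR] invariant_left [OF e \<iota>_R] by simp
  moreover have "\<iota> u ** (?e ** \<iota> x) \<in> R" using eR \<iota>_R mult_R by blast
  ultimately show ?thesis by (simp add: N_def \<iota>_\<pi>)
qed

lemma coset_curve_in:
  assumes "u \<in> G" "\<iota> x \<in> skew_hermitian" "a \<le> b"
  shows "curve_in G a b (coset u x)"
proof -
  obtain B where B0: "B \<ge> 0" and B: "\<And>y. norm (\<pi> y) \<le> norm y * B"
    using bounded_linear.nonneg_bounded [OF \<pi>_lin] by blast
  have "absolutely_continuous_on a b (coset u x)"
  proof (rule absolutely_continuous_on_lipschitz [where C = "B * norm (\<iota> x)"])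
    fix s t
    have "coset u x s - coset u x t = \<pi> (\<iota> u ** (matrix_exp (s *\<^sub>R \<iota> x) - matrix_exp (t *\<^sub>R \<iota> x)))"
      by (simp add: coset_def linear_diff [OF bounded_linear.linear [OF \<pi>_lin]] matrix_mult_diff_right)
    also have "norm \<dots> \<le> norm (matrix_exp (s *\<^sub>R \<iota> x) - matrix_exp (t *\<^sub>R \<iota> x)) * B"
      using B norm_unitary_mult(1) [OF G_unitary [OF assms(1)]] by metis
    also have "\<dots> \<le> (norm (\<iota> x) * \<bar>s - t\<bar>) * B"
      by (rule mult_right_mono [OF exp_curve_lipschitz [OF assms(2)] B0])
    finally show "norm (coset u x s - coset u x t) \<le> B * norm (\<iota> x) * \<bar>s - t\<bar>" by (simp add: mult_ac)
  qed
  then show ?thesis unfolding curve_in_def using coset_G assms by blast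
qed

lemma coset_length:
  assumes "u \<in> G" "\<iota> x \<in> skew_hermitian" "a \<le> b"
  shows "curve_length N a b (coset u x) = N x * (b - a)"
  by (rule sp.curve_length_constant_speed [OF assms(3) coset_derivative [OF assms(1,2)] coset_speed [OF assms(1,2)]])

lemma gap_R: "u \<in> G \<Longrightarrow> v \<in> G \<Longrightarrow> gap u v \<in> R" "u \<in> G \<Longrightarrow> v \<in> G \<Longrightarrow> unitary_matrix (gap u v)"
  unfolding gap_def by (auto intro: mult_R adjoint_R \<iota>_R unitary_matrix_mult unitary_matrix_adjoint G_unitary)

lemma gap_mult: "u \<in> G \<Longrightarrow> \<iota> u ** gap u v = \<iota> v"
  unfolding gap_def by (rule unitary_cancel(2) [OF G_unitary])

lemma gap_eq: "u \<in> G \<Longrightarrow> \<iota> v = \<iota> u ** y \<Longrightarrow> gap u v = y"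
  unfolding gap_def by (simp add: unitary_cancel(1) [OF G_unitary])

lemma gap_refl: "u \<in> G \<Longrightarrow> gap u u = mat 1"
  unfolding gap_def by (rule unitary_cancel(5) [OF G_unitary])

text \<open>Left translation by the adjoint of \<open>\<iota> u\<close> preserves speed, so the
  growth bound for \<open>len\<close> applies to the translated curve.\<close>

lemma len_gap_le:
  assumes u: "u \<in> G" and \<gamma>: "curve_in G a b \<gamma>"
  shows "len (gap u (\<gamma> b)) \<le> len (gap u (\<gamma> a)) + curve_length N a b \<gamma>"
proof -
  have ab: "a \<le> b" and ac: "absolutely_continuous_on a b \<gamma>" and G: "\<And>t. t \<in> {a..b} \<Longrightarrow> \<gamma> t \<in> G"
    using \<gamma> unfolding curve_in_def by auto
  obtain B where B: "\<And>y. norm (\<iota> y) \<le> norm y * B" using bounded_linear.bounded [OF \<iota>_lin] by blast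
  have "len (gap u (\<gamma> b)) - len (gap u (\<gamma> a)) \<le> curve_length N a b \<gamma>"
  proof (rule sp.le_curve_length [OF ab ac, where C = "bound * (pi / 2) * B"])
    fix s t assume st: "s \<in> {a..b}" "t \<in> {a..b}"
    have "\<bar>len (gap u (\<gamma> s)) - len (gap u (\<gamma> t))\<bar> \<le> bound * (pi / 2) * norm (gap u (\<gamma> s) - gap u (\<gamma> t))"
      using st by (intro len_lipschitz gap_R u G)
    also have "norm (gap u (\<gamma> s) - gap u (\<gamma> t)) = norm (\<iota> (\<gamma> s - \<gamma> t))"
      unfolding gap_def \<iota>_diff matrix_mult_diff_right [symmetric]
      by (rule norm_unitary_mult(1) [OF unitary_matrix_adjoint [OF G_unitary [OF u]]])
    also have "bound * (pi / 2) * norm (\<iota> (\<gamma> s - \<gamma> t)) \<le> bound * (pi / 2) * (norm (\<gamma> s - \<gamma> t) * B)"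
      using bound(1) by (intro mult_left_mono B) auto
    finally show "\<bar>len (gap u (\<gamma> s)) - len (gap u (\<gamma> t))\<bar> \<le> bound * (pi / 2) * B * norm (\<gamma> s - \<gamma> t)"
      by (simp add: mult_ac)
  next
    fix t y D assume t: "t \<in> {a<..<b}" and d: "(\<gamma> has_vector_derivative y) (at t)"
      and D: "((\<lambda>t. len (gap u (\<gamma> t))) has_real_derivative D) (at t)"
    have d': "((\<lambda>t. gap u (\<gamma> t)) has_vector_derivative gap u y) (at t)"
      unfolding gap_def
      by (intro bounded_linear.has_vector_derivative [OF bounded_bilinear.bounded_linear_right [OF bounded_bilinear_matrix_mult]]
          bounded_linear.has_vector_derivative [OF \<iota>_lin] d)
    have "D \<le> M (gap u y)"
      by (rule len_derivative_le [OF _ t d' D]) (use gap_R u G in blast)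
    also have "\<dots> = N y"
      unfolding gap_def N_def using u by (intro invariant_left adjoint_R \<iota>_R unitary_matrix_adjoint G_unitary)
    finally show "D \<le> N y" .
  qed
  then show ?thesis by simp
qed

lemma len_gap_le_length: "curve_in G a b \<gamma> \<Longrightarrow> len (gap (\<gamma> a) (\<gamma> b)) \<le> curve_length N a b \<gamma>"
  using len_gap_le [of "\<gamma> a" a b \<gamma>] gap_refl [of "\<gamma> a"] by (auto simp: curve_in_def image_subset_iff)

lemma intrinsic_dist_le: "curve_in G a b \<gamma> \<Longrightarrow> intrinsic_dist G N (\<gamma> a) (\<gamma> b) \<le> curve_length N a b \<gamma>"
  unfolding intrinsic_dist_def
  by (rule cInf_lower) (auto intro!: bdd_belowI [of _ 0] sp.curve_length_nonneg)

text \<open>The given curve makes the set of lengths nonempty, as a real infimum requires.\<close>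

lemma intrinsic_dist_ge:
  assumes "curve_in G a b \<gamma>" shows "len (gap (\<gamma> a) (\<gamma> b)) \<le> intrinsic_dist G N (\<gamma> a) (\<gamma> b)"
  unfolding intrinsic_dist_def
proof (rule cInf_greatest)
  fix l assume "l \<in> {curve_length N c d \<eta> |c d \<eta>. curve_in G c d \<eta> \<and> \<eta> c = \<gamma> a \<and> \<eta> d = \<gamma> b}"
  then show "len (gap (\<gamma> a) (\<gamma> b)) \<le> l" using len_gap_le_length by force
qed (use assms in blast)

lemma skew_\<pi>: "x \<in> R \<Longrightarrow> x \<in> skew_hermitian \<Longrightarrow> \<iota> (\<pi> x) \<in> skew_hermitian"
  by (simp add: \<iota>_\<pi>)

text \<open>The coset through \<open>mlog (gap u v)\<close> has length \<open>len (gap u v)\<close>,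
  which is also a lower bound for every connecting curve.\<close>

lemma regular_connection:
  assumes u: "u \<in> G" and v: "v \<in> G" and reg: "regular (gap u v)"
  shows "coset u (\<pi> (mlog (gap u v))) 0 = u" "coset u (\<pi> (mlog (gap u v))) 1 = v"
    "curve_in G 0 1 (coset u (\<pi> (mlog (gap u v))))"
    "curve_length N 0 1 (coset u (\<pi> (mlog (gap u v)))) = len (gap u v)"
    "intrinsic_dist G N u v = len (gap u v)"
proof -
  let ?z = "mlog (gap u v)"
  note z = regular_mlog [OF gap_R [OF u v] reg]
  have sk: "\<iota> (\<pi> ?z) \<in> skew_hermitian" using z small_skew skew_\<pi> by blast
  show 0: "coset u (\<pi> ?z) 0 = u"
    by (rule \<iota>_inj) (simp add: \<iota>_coset [OF u sk] matrix_exp_0)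
  show 1: "coset u (\<pi> ?z) 1 = v"
    by (rule \<iota>_inj) (simp add: \<iota>_coset [OF u sk] \<iota>_\<pi> z gap_mult u)
  show c: "curve_in G 0 1 (coset u (\<pi> ?z))" by (rule coset_curve_in [OF u sk]) simp
  show l: "curve_length N 0 1 (coset u (\<pi> ?z)) = len (gap u v)"
    using coset_length [OF u sk, of 0 1] z by (simp add: N_def \<iota>_\<pi>)
  show "intrinsic_dist G N u v = len (gap u v)"
    using intrinsic_dist_le [OF c] intrinsic_dist_ge [OF c] by (simp add: 0 1 l)
qed

text \<open>An arc shorter than \<open>c * pi\<close> is a translate of \<open>matrix_exp y\<close>
  with \<open>norm y < pi\<close>, and then length, \<open>len\<close> and distance coincide. The
  same bound works at every parameter.\<close>

theorem coset_geodesic: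
  assumes u: "u \<in> G" and x: "\<iota> x \<in> skew_hermitian" and I: "is_interval I"
  shows "geodesic_on G N I (coset u x)"
proof -
  have "\<exists>d>0. \<forall>a b. a \<le> b \<and> curve_length N a b (coset u x) < d \<longrightarrow>
      curve_length N a b (coset u x) = intrinsic_dist G N (coset u x a) (coset u x b)"
  proof -
    obtain c where c: "c > 0" "\<And>x. x \<in> R \<Longrightarrow> c * norm x \<le> M x" by (rule definite_lower_bound, rule that)
    show ?thesis
    proof (intro exI [of _ "c * pi"] conjI allI impI)
      show "c * pi > 0" using c by simp
      fix a b assume ab: "a \<le> b \<and> curve_length N a b (coset u x) < c * pi"
      define y where "y = (b - a) *\<^sub>R \<iota> x"
      have yR: "y \<in> R" unfolding y_def by (intro scale_R \<iota>_R)
      have L: "curve_length N a b (coset u x) = M y"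
        using coset_length [OF u x] ab by (simp add: y_def scale N_def)
      have "c * norm y < c * pi" using c(2) [OF yR] ab L by linarith
      then have "norm y < pi" using c(1) by simp
      moreover have "y \<in> skew_hermitian" using x by (simp add: y_def skew_hermitian_def adjoint_scaleR)
      ultimately have sm: "small y" using small_if_norm by blast
      have "\<iota> (coset u x b) = \<iota> (coset u x a) ** matrix_exp y"
        using matrix_exp_add [OF x, of a "b - a"] by (simp add: \<iota>_coset [OF u x] y_def matrix_mul_assoc)
      then have g: "gap (coset u x a) (coset u x b) = matrix_exp y" by (intro gap_eq coset_G u x)
      note ye = small_exp [OF yR sm]
      show "curve_length N a b (coset u x) = intrinsic_dist G N (coset u x a) (coset u x b)"
        using regular_connection(5) [of "coset u x a" "coset u x b"] coset_G u x ye by (simp add: g L)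
    qed
  qed
  then show ?thesis
    unfolding geodesic_on_def using I coset_curve_in [OF u x] by (meson order_trans)
qed

lemma curve_in_subinterval: "curve_in G a b \<gamma> \<Longrightarrow> a \<le> c \<Longrightarrow> c \<le> d \<Longrightarrow> d \<le> b \<Longrightarrow> curve_in G c d \<gamma>"
  unfolding curve_in_def by (auto intro: absolutely_continuous_on_subinterval)

lemma curve_length_add:
  assumes "curve_in G a b \<gamma>" "a \<le> c" "c \<le> d" "d \<le> b"
  shows "curve_length N a d \<gamma> = curve_length N a c \<gamma> + curve_length N c d \<gamma>"
proof (rule sp.curve_length_combine [OF _ assms(2,3)])
  show "absolutely_continuous_on a d \<gamma>"
    by (rule absolutely_continuous_on_subinterval [of a b]) (use assms in \<open>auto simp: curve_in_def\<close>)
qed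

section \<open>Rigidity under strict convexity\<close>

context
  assumes strict: "strictly_convex N"
begin

text \<open>A point \<open>z\<close> of the segment and its mirror image \<open>p + q - z\<close>
  have norm at most \<open>1\<close> each and at least \<open>2\<close> together, so the whole
  segment would lie in the unit sphere.\<close>

lemma strict_R:
  assumes "x \<in> R" "y \<in> R" "M x = 1" "M y = 1" "M (x + y) \<ge> 2" shows "x = y"
proof (rule ccontr)
  assume "x \<noteq> y"
  define p q where "p = \<pi> x" and "q = \<pi> y"
  have pq: "\<iota> p = x" "\<iota> q = y" using \<iota>_\<pi> assms by (auto simp: p_def q_def)
  have N1: "N p = 1" "N q = 1" using assms pq by (auto simp: N_def)
  have N2: "N (p + q) \<ge> 2"
    using assms pq by (simp add: N_def linear_add [OF bounded_linear.linear [OF \<iota>_lin]])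
  have "closed_segment p q \<subseteq> {z. N z = 1}"
  proof
    fix z assume "z \<in> closed_segment p q"
    then obtain s where s: "0 \<le> s" "s \<le> 1" "z = (1 - s) *\<^sub>R p + s *\<^sub>R q" by (auto simp: in_segment)
    have "N z \<le> (1 - s) * 1 + s * 1"
      using sp.triangle [of "(1 - s) *\<^sub>R p" "s *\<^sub>R q"] s N1 by (simp add: sp.scale)
    moreover have "N (p + q - z) \<le> s * 1 + (1 - s) * 1"
    proof -
      have "p + q - z = s *\<^sub>R p + (1 - s) *\<^sub>R q" by (simp add: s(3) algebra_simps)
      then show ?thesis using sp.triangle [of "s *\<^sub>R p" "(1 - s) *\<^sub>R q"] s N1 by (simp add: sp.scale)
    qed
    moreover have "N (p + q) \<le> N z + N (p + q - z)" using sp.triangle [of z "p + q - z"] by simp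
    ultimately show "z \<in> {z. N z = 1}" using N2 by simp
  qed
  moreover have "p \<noteq> q" using \<open>x \<noteq> y\<close> pq by auto
  ultimately show False using strict unfolding strictly_convex_def by blast
qed

text \<open>The curve is followed backwards from its endpoint in short steps: as long as the end of a
  step is regular, the step is parallel to the remaining segment.\<close>

lemma shortest_curve_is_coset:
  assumes \<gamma>: "curve_in G a b \<gamma>" and reg: "regular (gap (\<gamma> a) (\<gamma> b))"
    and L: "curve_length N a b \<gamma> \<le> len (gap (\<gamma> a) (\<gamma> b))" and t: "t \<in> {a..b}"
  defines "z \<equiv> mlog (gap (\<gamma> a) (\<gamma> b))"
  shows "\<iota> (\<gamma> t) = \<iota> (\<gamma> a) ** matrix_exp (curve_length N a t \<gamma> *\<^sub>R (z /\<^sub>R M z))"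
proof -
  have ab: "a \<le> b" and ac: "absolutely_continuous_on a b \<gamma>" and G: "\<And>t. t \<in> {a..b} \<Longrightarrow> \<gamma> t \<in> G"
    using \<gamma> unfolding curve_in_def by auto
  have aG: "\<gamma> a \<in> G" and bG: "\<gamma> b \<in> G" using G ab by auto
  note zr = regular_mlog [OF gap_R [OF aG bG] reg, folded z_def]
  define \<tau> where "\<tau> = (\<lambda>t. curve_length N a t \<gamma>)"
  define x where "x = z /\<^sub>R M z"
  have xR: "x \<in> R" unfolding x_def by (intro scale_R zr)
  have xs: "x \<in> skew_hermitian"
    using small_skew [OF zr(1)] by (simp add: x_def skew_hermitian_def adjoint_scaleR)
  have \<tau>b: "\<tau> b = M z"
    using L len_gap_le_length [OF \<gamma>] zr by (simp add: \<tau>_def)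
  have \<tau>add: "\<tau> d = \<tau> c + curve_length N c d \<gamma>" if "a \<le> c" "c \<le> d" "d \<le> b" for c d
    unfolding \<tau>_def by (rule curve_length_add [OF \<gamma> that])
  have \<tau>0: "0 \<le> \<tau> c" for c unfolding \<tau>_def by (rule sp.curve_length_nonneg)
  have \<tau>le: "\<tau> c \<le> M z" if "a \<le> c" "c \<le> b" for c
    using \<tau>add [of c b] that \<tau>b sp.curve_length_nonneg [of c b \<gamma>] by simp
  define good where "good = (\<lambda>t. \<iota> (\<gamma> t) = \<iota> (\<gamma> a) ** matrix_exp (\<tau> t *\<^sub>R x))"
  have "continuous_on {a..b} (\<lambda>t. \<iota> (\<gamma> t))"
    by (intro bounded_linear.continuous_on [OF \<iota>_lin] absolutely_continuous_on_continuous [OF ac])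
  then have "uniformly_continuous_on {a..b} (\<lambda>t. \<iota> (\<gamma> t))"
    by (intro compact_uniformly_continuous) auto
  \<comment> \<open>\<open>2\<close> is the distance from \<open>mat 1\<close> below which
    \<open>-1\<close> cannot be an eigenvalue, so steps shorter than \<open>\<delta>\<close> have a
    logarithm.\<close>
  then obtain \<delta> where \<delta>: "\<delta> > 0" "\<And>s t. s \<in> {a..b} \<Longrightarrow> t \<in> {a..b} \<Longrightarrow> dist t s < \<delta> \<Longrightarrow> dist (\<iota> (\<gamma> t)) (\<iota> (\<gamma> s)) < 2"
    unfolding uniformly_continuous_on_def by (metis zero_less_numeral)
  have step: "good t" if t: "a \<le> t" "t \<le> t1" "t1 \<le> b" "t1 - t < \<delta>" and g1: "good t1" for t t1
  proof -
    have tG: "\<gamma> t \<in> G" "\<gamma> t1 \<in> G" using G t by auto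
    define w where "w = gap (\<gamma> a) (\<gamma> t)"
    define y where "y = mlog (gap (\<gamma> t) (\<gamma> t1))"
    \<comment> \<open>The logarithm of the position at \<open>t1\<close>, known because
      \<open>t1\<close> is good. It is a multiple of \<open>z\<close> with factor between
      \<open>0\<close> and \<open>1\<close>, hence small.\<close>
    define z' where "z' = \<tau> t1 *\<^sub>R x"
    have "norm (gap (\<gamma> t) (\<gamma> t1) - mat 1) = norm (\<iota> (\<gamma> t1) - \<iota> (\<gamma> t))"
      using gap_refl [OF tG(1)] norm_unitary_mult(1) [OF unitary_matrix_adjoint [OF G_unitary [OF tG(1)]]]
      unfolding gap_def by (metis matrix_mult_diff_right)
    also have "\<dots> < 2" using \<delta>(2) [of t t1] t by (simp add: dist_norm)
    finally have "regular (gap (\<gamma> t) (\<gamma> t1))" by (intro regular_near_1 gap_R tG)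
    note yr = regular_mlog [OF gap_R [OF tG] this, folded y_def]
    have wR: "w \<in> R" "unitary_matrix w" unfolding w_def using gap_R aG tG by auto
    have z'x: "z' = (\<tau> t1 / M z) *\<^sub>R z" by (simp add: z'_def x_def divide_inverse)
    have "\<bar>\<tau> t1 / M z\<bar> \<le> 1" using \<tau>le [of t1] \<tau>0 [of t1] t by (auto simp: divide_le_eq_1)
    then have sm: "small z'" unfolding z'x by (rule small_scaleR [OF zr(1)])
    have z'R: "z' \<in> R" unfolding z'_def by (intro scale_R xR)
    have Mz': "M z' = \<tau> t1"
      using \<tau>le [of t1] \<tau>0 [of t1] t by (cases "M z = 0") (auto simp: z'x scale)
    have "gap (\<gamma> a) (\<gamma> t1) = matrix_exp z'" using g1 aG unfolding good_def z'_def by (intro gap_eq)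
    moreover have "gap (\<gamma> a) (\<gamma> t1) = w ** gap (\<gamma> t) (\<gamma> t1)"
      unfolding w_def gap_def by (simp add: unitary_cancel(2) [OF G_unitary [OF tG(1)]] flip: matrix_mul_assoc)
    ultimately have eq: "matrix_exp z' = w ** matrix_exp y" by (simp add: yr)
    have "len w \<le> \<tau> t"
      unfolding w_def \<tau>_def by (rule len_gap_le_length) (use curve_in_subinterval [OF \<gamma>] t in auto)
    moreover have "M y \<le> curve_length N t t1 \<gamma>"
      unfolding yr(4) by (rule len_gap_le_length) (use curve_in_subinterval [OF \<gamma>] t in auto)
    moreover have "\<tau> t1 = \<tau> t + curve_length N t t1 \<gamma>" by (rule \<tau>add) (use t in auto)
    moreover have "M z' \<le> len w + M y"
      using len_mult_exp [OF wR yr(2) small_skew [OF yr(1)], of 1] small_exp(3) [OF z'R sm] eq by simp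
    \<comment> \<open>The upper bounds for \<open>len w\<close> and \<open>M y\<close> add up to
      \<open>\<tau> t1 = M z'\<close>, which the triangle inequality bounds by
      \<open>len w + M y\<close>; so both are attained.\<close>
    ultimately have len: "len w + M y \<le> M z'" and My: "M y = \<tau> t1 - \<tau> t" using Mz' by linarith+
    have "y = (\<tau> t1 - \<tau> t) *\<^sub>R x"
    proof (cases "y = 0")
      case True
      then show ?thesis using My by simp
    next
      case False
      have "M y \<noteq> 0" using False definite yr(2) by blast
      then have "\<tau> t1 > 0" "M z \<noteq> 0" using My \<tau>0 [of t] nonneg [of y] \<tau>le [of t1] \<tau>0 [of t1] t by auto
      have "y /\<^sub>R M y = z' /\<^sub>R M z'"
        by (rule split_parallel [OF strict_R z'R sm yr(2) small_skew [OF yr(1)] wR eq len False])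
      also have "\<dots> = x" unfolding Mz' using \<open>\<tau> t1 > 0\<close> by (simp add: z'_def)
      finally have "M y *\<^sub>R x = y" using \<open>M y \<noteq> 0\<close> by (metis scaleR_scaleR right_inverse scaleR_one)
      then show ?thesis using My by simp
    qed
    then have me: "matrix_exp y = matrix_exp ((\<tau> t1 - \<tau> t) *\<^sub>R x)" by simp
    have "\<iota> (\<gamma> t1) = \<iota> (\<gamma> t) ** matrix_exp ((\<tau> t1 - \<tau> t) *\<^sub>R x)"
      using gap_mult [OF tG(1), of "\<gamma> t1"] yr(3) me by simp
    moreover have "matrix_exp ((\<tau> t1 - \<tau> t) *\<^sub>R x) ** matrix_exp ((\<tau> t - \<tau> t1) *\<^sub>R x) = mat 1"
      using matrix_exp_add [OF xs, of "\<tau> t1 - \<tau> t" "\<tau> t - \<tau> t1"] by (simp add: matrix_exp_0)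
    ultimately have "\<iota> (\<gamma> t) = \<iota> (\<gamma> t1) ** matrix_exp ((\<tau> t - \<tau> t1) *\<^sub>R x)"
      by (metis matrix_mul_assoc matrix_mul_rid)
    also have "\<dots> = \<iota> (\<gamma> a) ** matrix_exp (\<tau> t *\<^sub>R x)"
      using g1 matrix_exp_add [OF xs, of "\<tau> t1" "\<tau> t - \<tau> t1"]
      by (simp add: good_def flip: matrix_mul_assoc)
    finally show "good t" by (simp add: good_def)
  qed
  have gb: "good b"
  proof (cases "M z = 0")
    \<comment> \<open>If \<open>M z = 0\<close>, then \<open>z = 0\<close>, and \<open>x\<close> is
      \<open>0\<close> by the convention for division by zero.\<close>
    case True
    then have "z = 0" using definite zr by blast
    then show ?thesis using zr(3) gap_mult [OF aG, of "\<gamma> b"] by (simp add: good_def x_def)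
  next
    case False
    then show ?thesis using zr(3) gap_mult [OF aG, of "\<gamma> b"] by (simp add: good_def x_def \<tau>b)
  qed
  \<comment> \<open>Induction backwards from \<open>b\<close> in steps of
    \<open>\<delta> / 2\<close>, strictly shorter than the admissible
    \<open>\<delta>\<close>.\<close>
  have "\<forall>t\<in>{a..b}. b - real n * (\<delta> / 2) \<le> t \<longrightarrow> good t" for n
  proof (induction n)
    case 0
    then show ?case using gb by auto
  next
    case (Suc n)
    show ?case
    proof (intro ballI impI)
      fix t assume t: "t \<in> {a..b}" and "b - real (Suc n) * (\<delta> / 2) \<le> t"
      then have tn: "b - real n * (\<delta> / 2) \<le> t + \<delta> / 2" by (simp add: algebra_simps add_divide_distrib)
      define t1 where "t1 = min b (t + \<delta> / 2)"
      have t1: "t \<le> t1" "t1 \<le> b" "t1 - t < \<delta>" using t \<delta>(1) by (auto simp: t1_def)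
      have "b - real n * (\<delta> / 2) \<le> t1" using tn \<delta>(1) by (auto simp: t1_def)
      then have "good t1" using Suc t t1 by auto
      then show "good t" using step t t1 by auto
    qed
  qed
  moreover obtain n where "(b - a) / (\<delta> / 2) < real n" using reals_Archimedean2 by blast
  then have "b - real n * (\<delta> / 2) \<le> t" using t \<delta>(1) by (auto simp: field_simps)
  ultimately have "good t" using t by blast
  then show ?thesis by (simp add: good_def \<tau>_def x_def)
qed

text \<open>Each shortest curve factors through its own arc length and the unit-speed coset
  \<open>\<beta>\<close> on \<open>{0..M z}\<close>; this is the common curve that
  \<open>same_up_to_parameter\<close> asks for.\<close>

theorem unique_shortest_curve:
  assumes u: "u \<in> G" and v: "v \<in> G" and reg: "regular (gap u v)"
  shows "\<exists>a b \<gamma>. shortest_curve G N u v a b \<gamma>"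
    and "shortest_curve G N u v a b \<gamma> \<Longrightarrow> shortest_curve G N u v c d \<eta> \<Longrightarrow>
      same_up_to_parameter {a..b} \<gamma> {c..d} \<eta>"
proof -
  note con = regular_connection [OF u v reg]
  show "\<exists>a b \<gamma>. shortest_curve G N u v a b \<gamma>"
    unfolding shortest_curve_def using con by (intro exI [of _ 0] exI [of _ 1] exI) auto
  define z where "z = mlog (gap u v)"
  define \<beta> where "\<beta> = coset u (\<pi> (z /\<^sub>R M z))"
  note zr = regular_mlog [OF gap_R [OF u v] reg, folded z_def]
  have rep: "reparametrization_of {a..b} \<gamma> {0..M z} \<beta>" if sc: "shortest_curve G N u v a b \<gamma>" for a b \<gamma>
  proof -
    have \<gamma>: "curve_in G a b \<gamma>" and ends: "\<gamma> a = u" "\<gamma> b = v" and L: "curve_length N a b \<gamma> = len (gap u v)"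
      using sc con by (auto simp: shortest_curve_def)
    have ab: "a \<le> b" and ac: "absolutely_continuous_on a b \<gamma>" using \<gamma> by (auto simp: curve_in_def)
    let ?\<tau> = "\<lambda>t. curve_length N a t \<gamma>"
    have cont: "continuous_on {a..b} ?\<tau>" by (rule sp.continuous_on_curve_length [OF ab ac])
    have mono: "?\<tau> s \<le> ?\<tau> t" if "a \<le> s" "s \<le> t" "t \<le> b" for s t
      using curve_length_add [OF \<gamma> that] sp.curve_length_nonneg [of s t \<gamma>] by simp
    have \<tau>b: "?\<tau> b = M z" using L zr by simp
    have "?\<tau> ` {a..b} = {0..M z}"
    proof
      show "?\<tau> ` {a..b} \<subseteq> {0..M z}" using mono [of _ b] \<tau>b sp.curve_length_nonneg by auto
      show "{0..M z} \<subseteq> ?\<tau> ` {a..b}"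
      proof
        fix y assume "y \<in> {0..M z}"
        then obtain t where "a \<le> t" "t \<le> b" "?\<tau> t = y"
          using IVT' [of ?\<tau> a y b] cont ab \<tau>b by auto
        then show "y \<in> ?\<tau> ` {a..b}" by auto
      qed
    qed
    moreover have "\<gamma> t = \<beta> (?\<tau> t)" if t: "t \<in> {a..b}" for t
    proof (rule \<iota>_inj)
      have xR: "z /\<^sub>R M z \<in> R" by (intro scale_R zr)
      have sk: "z /\<^sub>R M z \<in> skew_hermitian"
        using small_skew [OF zr(1)] by (simp add: skew_hermitian_def adjoint_scaleR)
      have "\<iota> (\<gamma> t) = \<iota> u ** matrix_exp (?\<tau> t *\<^sub>R (z /\<^sub>R M z))"
        using shortest_curve_is_coset [OF \<gamma> _ _ t] reg L ends by (simp add: z_def)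
      also have "\<dots> = \<iota> (\<beta> (?\<tau> t))"
        unfolding \<beta>_def using \<iota>_coset [OF u, of "\<pi> (z /\<^sub>R M z)"] \<iota>_\<pi> [OF xR] sk by simp
      finally show "\<iota> (\<gamma> t) = \<iota> (\<beta> (?\<tau> t))" .
    qed
    ultimately show ?thesis
      unfolding reparametrization_of_def using cont mono
      by (intro exI [of _ ?\<tau>]) (auto simp: mono_on_def)
  qed
  show "same_up_to_parameter {a..b} \<gamma> {c..d} \<eta>"
    if "shortest_curve G N u v a b \<gamma>" "shortest_curve G N u v c d \<eta>"
    unfolding same_up_to_parameter_def using rep that by blast
qed

text \<open>For one sufficiently small nonzero \<open>s\<close> both \<open>s *\<^sub>R x\<close>
  and \<open>s *\<^sub>R y\<close> are small, so \<open>mlog\<close> recovers them. The set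
  \<open>S\<close> accommodates one-sided parameters near an endpoint.\<close>

lemma matrix_exp_inj:
  assumes x: "x \<in> R" "x \<in> skew_hermitian" and y: "y \<in> R" "y \<in> skew_hermitian"
    and eq: "\<And>s. s \<in> S \<Longrightarrow> matrix_exp (s *\<^sub>R x) = matrix_exp (s *\<^sub>R y)"
    and S: "\<And>e. e > 0 \<Longrightarrow> \<exists>s\<in>S. s \<noteq> 0 \<and> \<bar>s\<bar> < e"
  shows "x = y"
proof -
  define r where "r = pi / (norm x + norm y + 1)"
  have pos: "norm x + norm y + 1 > 0" by (simp add: add_nonneg_pos)
  then have "r > 0" by (simp add: r_def)
  then obtain s where s: "s \<in> S" "s \<noteq> 0" "\<bar>s\<bar> < r" using S by blast
  have sm: "small (s *\<^sub>R z)" if "z \<in> skew_hermitian" "norm z \<le> norm x + norm y" for z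
  proof (rule small_if_norm)
    show "s *\<^sub>R z \<in> skew_hermitian" using that by (simp add: skew_hermitian_def adjoint_scaleR)
    have "norm (s *\<^sub>R z) \<le> \<bar>s\<bar> * (norm x + norm y + 1)" using that by (simp add: mult_left_mono)
    also have "\<dots> < r * (norm x + norm y + 1)" using s pos by (intro mult_strict_right_mono)
    also have "\<dots> = pi" using pos by (simp add: r_def)
    finally show "norm (s *\<^sub>R z) < pi" .
  qed
  have "s *\<^sub>R x = mlog (matrix_exp (s *\<^sub>R x))"
    using small_exp(2) [OF scale_R [OF x(1)] sm [OF x(2)]] by simp
  also have "\<dots> = s *\<^sub>R y"
    using small_exp(2) [OF scale_R [OF y(1)] sm [OF y(2)]] eq [OF s(1)] by simp
  finally show ?thesis using s by simp
qed

text \<open>Short arcs around \<open>t\<close> are shortest and have regular gaps, so each is a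
  coset in arc length. The point is to find one direction \<open>x\<close> for all of them.\<close>

lemma unit_speed_local_coset:
  assumes \<gamma>: "\<And>a b. a \<in> I \<Longrightarrow> b \<in> I \<Longrightarrow> a \<le> b \<Longrightarrow> curve_in G a b \<gamma>"
    and \<phi>: "\<And>a b. a \<in> I \<Longrightarrow> b \<in> I \<Longrightarrow> a \<le> b \<Longrightarrow> \<phi> b - \<phi> a = curve_length N a b \<gamma>"
    and I: "is_interval I" and t: "t \<in> I"
    and d: "d > 0" "\<And>a b. a \<in> I \<Longrightarrow> b \<in> I \<Longrightarrow> a \<le> t \<Longrightarrow> t \<le> b \<Longrightarrow> curve_length N a b \<gamma> < d \<Longrightarrow>
      curve_length N a b \<gamma> = intrinsic_dist G N (\<gamma> a) (\<gamma> b)"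
  shows "\<exists>x e. x \<in> R \<and> x \<in> skew_hermitian \<and> e > 0 \<and>
    (\<forall>q\<in>I. \<bar>\<phi> q - \<phi> t\<bar> < e \<longrightarrow> \<iota> (\<gamma> q) = \<iota> (\<gamma> t) ** matrix_exp ((\<phi> q - \<phi> t) *\<^sub>R x))"
proof -
  obtain r0 where r0: "r0 > 0" "\<And>v. v \<in> R \<Longrightarrow> unitary_matrix v \<Longrightarrow> len v < r0 \<Longrightarrow> regular v"
    by (rule short_regular, rule that)
  \<comment> \<open>Arcs with both ends within \<open>e\<close> of \<open>\<phi> t\<close> are
    shorter than \<open>2 * e\<close>, hence shortest by \<open>d\<close> and regular by
    \<open>r0\<close>.\<close>
  define e where "e = min d r0 / 2"
  have e: "e > 0" "2 * e \<le> d" "2 * e \<le> r0" using d r0 by (auto simp: e_def)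
  have GI: "\<gamma> s \<in> G" if "s \<in> I" for s using \<gamma> [OF that that] by (auto simp: curve_in_def)
  have arc: "\<exists>x. x \<in> R \<and> x \<in> skew_hermitian \<and> (\<forall>c. \<bar>c\<bar> \<le> \<phi> b - \<phi> a \<longrightarrow> small (c *\<^sub>R x)) \<and>
      (\<forall>p\<in>{a..b}. \<forall>q\<in>{a..b}. \<iota> (\<gamma> q) = \<iota> (\<gamma> p) ** matrix_exp ((\<phi> q - \<phi> p) *\<^sub>R x))"
    if ab: "a \<in> I" "b \<in> I" "a \<le> t" "t \<le> b" "\<phi> b - \<phi> a < 2 * e" for a b
  proof -
    have le: "a \<le> b" using ab by simp
    note c = \<gamma> [OF ab(1,2) le]
    have L: "curve_length N a b \<gamma> = intrinsic_dist G N (\<gamma> a) (\<gamma> b)"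
      by (rule d(2)) (use ab \<phi> [OF ab(1,2) le] e in auto)
    have reg: "regular (gap (\<gamma> a) (\<gamma> b))"
      using len_gap_le_length [OF c] \<phi> [OF ab(1,2) le] ab e by (intro r0 gap_R GI) auto
    have L': "curve_length N a b \<gamma> = len (gap (\<gamma> a) (\<gamma> b))"
      using L regular_connection(5) [OF GI GI reg] ab by simp
    define z where "z = mlog (gap (\<gamma> a) (\<gamma> b))"
    note zr = regular_mlog [OF gap_R [OF GI GI] reg, folded z_def, OF ab(1,2) ab(1,2)]
    define x where "x = z /\<^sub>R M z"
    have xR: "x \<in> R" unfolding x_def by (intro scale_R zr)
    have xs: "x \<in> skew_hermitian"
      using small_skew [OF zr(1)] by (simp add: x_def skew_hermitian_def adjoint_scaleR)
    have Mz: "\<phi> b - \<phi> a = M z" using \<phi> [OF ab(1,2) le] L' zr by simp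
    have "small (c *\<^sub>R x)" if "\<bar>c\<bar> \<le> \<phi> b - \<phi> a" for c
    proof -
      have "\<bar>c / M z\<bar> \<le> 1" using that Mz by (auto simp: abs_divide divide_le_eq_1)
      from small_scaleR [OF zr(1) this] show ?thesis by (simp add: x_def divide_inverse)
    qed
    moreover have "\<iota> (\<gamma> q) = \<iota> (\<gamma> p) ** matrix_exp ((\<phi> q - \<phi> p) *\<^sub>R x)" if pq: "p \<in> {a..b}" "q \<in> {a..b}" for p q
    proof -
      have from_a: "\<iota> (\<gamma> s) = \<iota> (\<gamma> a) ** matrix_exp ((\<phi> s - \<phi> a) *\<^sub>R x)" if s: "s \<in> {a..b}" for s
      proof -
        have "s \<in> I" using s ab I by (meson atLeastAtMost_iff mem_is_interval_1_I)
        then have "\<phi> s - \<phi> a = curve_length N a s \<gamma>" using \<phi> [of a s] ab s by auto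
        then show ?thesis using shortest_curve_is_coset [OF c reg _ s] L' by (simp add: x_def z_def)
      qed
      have "\<iota> (\<gamma> p) ** matrix_exp ((\<phi> q - \<phi> p) *\<^sub>R x) = \<iota> (\<gamma> a) ** matrix_exp (((\<phi> p - \<phi> a) + (\<phi> q - \<phi> p)) *\<^sub>R x)"
        unfolding matrix_exp_add [OF xs] from_a [OF pq(1)] by (simp add: matrix_mul_assoc)
      then show ?thesis using from_a [OF pq(2)] by simp
    qed
    ultimately show ?thesis using xR xs by blast
  qed
  show ?thesis
  proof (cases "\<exists>r\<in>I. \<phi> r \<noteq> \<phi> t \<and> \<bar>\<phi> r - \<phi> t\<bar> < e")
    \<comment> \<open>Near \<open>\<phi> t\<close> arc length takes no other value, so
      \<open>\<gamma>\<close> is constant on the parameters concerned and the direction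
      \<open>0\<close> serves.\<close>
    case False
    have "\<iota> (\<gamma> q) = \<iota> (\<gamma> t) ** matrix_exp ((\<phi> q - \<phi> t) *\<^sub>R 0)" if q: "q \<in> I" "\<bar>\<phi> q - \<phi> t\<bar> < e" for q
    proof -
      have eq: "\<phi> q = \<phi> t" using False q by blast
      define a b where "a = min q t" and "b = max q t"
      have ab: "a \<in> I" "b \<in> I" "a \<le> t" "t \<le> b" "\<phi> b - \<phi> a < 2 * e"
        using q t eq e by (auto simp: a_def b_def min_def max_def)
      from arc [OF this] obtain x where "\<forall>p\<in>{a..b}. \<forall>q\<in>{a..b}. \<iota> (\<gamma> q) = \<iota> (\<gamma> p) ** matrix_exp ((\<phi> q - \<phi> p) *\<^sub>R x)"
        by blast
      moreover have "t \<in> {a..b}" "q \<in> {a..b}" by (auto simp: a_def b_def)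
      ultimately show ?thesis using eq by (metis cancel_comm_monoid_add_class.diff_cancel scaleR_zero_left scaleR_zero_right)
    qed
    then show ?thesis
      using e subspace_0 [OF subspace_R] by (intro exI [of _ 0] exI [of _ e]) (auto simp: skew_hermitian_def vec_eq_iff)
  next
    case True
    then obtain r where r: "r \<in> I" "\<phi> r \<noteq> \<phi> t" "\<bar>\<phi> r - \<phi> t\<bar> < e" by blast
    \<comment> \<open>The direction is read off from one reference point \<open>r\<close>. An arc
      that contains \<open>t\<close>, \<open>q\<close> and \<open>r\<close> has the same direction,
      which is therefore independent of \<open>q\<close>.\<close>
    define x where "x = mlog (gap (\<gamma> t) (\<gamma> r)) /\<^sub>R (\<phi> r - \<phi> t)"
    have main: "x \<in> R \<and> x \<in> skew_hermitian \<and> \<iota> (\<gamma> q) = \<iota> (\<gamma> t) ** matrix_exp ((\<phi> q - \<phi> t) *\<^sub>R x)"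
      if q: "q \<in> I" "\<bar>\<phi> q - \<phi> t\<bar> < e" for q
    proof -
      define a b where "a = min t (min q r)" and "b = max t (max q r)"
      have abI: "a \<in> {t, q, r}" "b \<in> {t, q, r}" by (auto simp: a_def b_def min_def max_def)
      have ab: "a \<in> I" "b \<in> I" "a \<le> t" "t \<le> b" using abI q r t by (auto simp: a_def b_def)
      have "\<bar>\<phi> a - \<phi> t\<bar> < e" "\<bar>\<phi> b - \<phi> t\<bar> < e" using abI q r e by auto
      then have len: "\<phi> b - \<phi> a < 2 * e" by linarith
      from arc [OF ab len] obtain x' where x': "x' \<in> R" "x' \<in> skew_hermitian"
        and sm: "\<And>c. \<bar>c\<bar> \<le> \<phi> b - \<phi> a \<Longrightarrow> small (c *\<^sub>R x')"
        and eq: "\<And>p q. p \<in> {a..b} \<Longrightarrow> q \<in> {a..b} \<Longrightarrow> \<iota> (\<gamma> q) = \<iota> (\<gamma> p) ** matrix_exp ((\<phi> q - \<phi> p) *\<^sub>R x')"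
        by blast
      have mem: "t \<in> {a..b}" "q \<in> {a..b}" "r \<in> {a..b}" by (auto simp: a_def b_def)
      have mono: "\<phi> s \<le> \<phi> s'" if "s \<in> I" "s' \<in> I" "s \<le> s'" for s s'
        using \<phi> [OF that] sp.curve_length_nonneg [of s s' \<gamma>] by simp
      have "\<bar>\<phi> r - \<phi> t\<bar> \<le> \<phi> b - \<phi> a"
        using mono [of a r] mono [of r b] mono [of a t] mono [of t b] mem ab r t by auto
      note sme = small_exp(2) [OF scale_R [OF x'(1)] sm [OF this]]
      have "gap (\<gamma> t) (\<gamma> r) = matrix_exp ((\<phi> r - \<phi> t) *\<^sub>R x')"
        by (rule gap_eq [OF GI [OF t] eq [OF mem(1,3)]])
      then have "x = x'" using sme r by (simp add: x_def)
      then show ?thesis using x' eq [OF mem(1,2)] by simp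
    qed
    then show ?thesis using e r by (intro exI [of _ x] exI [of _ e]) blast
  qed
qed

text \<open>Continuity is local: each \<open>t\<close> has a compact subinterval of \<open>I\<close>
  that is a neighbourhood of it relative to \<open>I\<close>, and there \<open>\<phi>\<close> is an
  indefinite integral plus a constant.\<close>

lemma continuous_on_arclength:
  assumes \<gamma>: "\<And>a b. a \<in> I \<Longrightarrow> b \<in> I \<Longrightarrow> a \<le> b \<Longrightarrow> curve_in G a b \<gamma>"
    and \<phi>: "\<And>a b. a \<in> I \<Longrightarrow> b \<in> I \<Longrightarrow> a \<le> b \<Longrightarrow> \<phi> b - \<phi> a = curve_length N a b \<gamma>"
    and I: "is_interval I"
  shows "continuous_on I \<phi>"
  unfolding continuous_on_eq_continuous_within
proof
  fix t assume t: "t \<in> I"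
  \<comment> \<open>\<open>a\<close> lies left of \<open>t\<close> if \<open>I\<close> extends there
    and is \<open>t\<close> otherwise; points of \<open>I\<close> beyond \<open>l\<close> are at
    least \<open>a\<close> in both cases. The choice of \<open>b\<close> and \<open>r\<close> is
    symmetric.\<close>
  obtain a l where a: "a \<in> I" "a \<le> t" "l < t" "\<And>s. s \<in> I \<Longrightarrow> l < s \<Longrightarrow> a \<le> s"
  proof (cases "\<exists>s\<in>I. s < t")
    case True
    then obtain s where "s \<in> I" "s < t" by blast
    then show ?thesis using that [of s s] by auto
  next
    case False
    then show ?thesis using that [of t "t - 1"] t by force
  qed
  obtain b r where b: "b \<in> I" "t \<le> b" "t < r" "\<And>s. s \<in> I \<Longrightarrow> s < r \<Longrightarrow> s \<le> b"
  proof (cases "\<exists>s\<in>I. t < s")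
    case True
    then obtain s where "s \<in> I" "t < s" by blast
    then show ?thesis using that [of s s] by auto
  next
    case False
    then show ?thesis using that [of t "t + 1"] t by force
  qed
  have ab: "a \<le> b" using a b by simp
  have sub: "{a..b} \<subseteq> I" using a b I by (meson atLeastAtMost_iff mem_is_interval_1_I subsetI)
  have ac: "absolutely_continuous_on a b \<gamma>" using \<gamma> [OF a(1) b(1) ab] by (simp add: curve_in_def)
  have "continuous_on {a..b} (\<lambda>s. \<phi> a + curve_length N a s \<gamma>)"
    by (intro continuous_intros sp.continuous_on_curve_length ab ac)
  moreover have "\<phi> a + curve_length N a s \<gamma> = \<phi> s" if "s \<in> {a..b}" for s
    using \<phi> [of a s] a(1) sub that by auto
  ultimately have "continuous_on {a..b} \<phi>" by (rule continuous_on_eq)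
  then have "continuous (at t within {a..b}) \<phi>"
    using a b by (simp add: continuous_on_eq_continuous_within)
  moreover have "at t within I = at t within {a..b}"
    by (rule at_within_nhd [of t "{l<..<r}"]) (use a b sub in auto)
  ultimately show "continuous (at t within I) \<phi>" by simp
qed

text \<open>Parametrization by arc length makes the local directions comparable: they agree on
  overlaps, so direction and base point are locally constant on the connected set
  \<open>J\<close>.\<close>

theorem geodesic_is_coset:
  assumes geo: "geodesic_on G N I \<gamma>"
  shows "\<exists>u\<in>G. \<exists>x. \<iota> x \<in> skew_hermitian \<and> (\<exists>J. is_interval J \<and> same_up_to_parameter I \<gamma> J (coset u x))"
proof (cases "I = {}")
  case True
  \<comment> \<open>The empty interval also counts as a geodesic and is matched with
    \<open>J = {}\<close>.\<close>
  obtain u where u: "u \<in> G" using G_ne by blast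
  have "same_up_to_parameter I \<gamma> {} (coset u 0)"
    unfolding same_up_to_parameter_def reparametrization_of_def True by (intro exI [of _ "{}"]) (auto simp: mono_on_def)
  moreover have "\<iota> 0 = 0" by (rule linear_0 [OF bounded_linear.linear [OF \<iota>_lin]])
  ultimately show ?thesis using u
    by (intro bexI [of _ u] exI [of _ 0] conjI exI [of _ "{}"]) (auto simp: skew_hermitian_def vec_eq_iff)
next
  case False
  then obtain t0 where t0: "t0 \<in> I" by blast
  have I: "is_interval I" and \<gamma>: "\<And>a b. a \<in> I \<Longrightarrow> b \<in> I \<Longrightarrow> a \<le> b \<Longrightarrow> curve_in G a b \<gamma>"
    and short: "\<And>t. t \<in> I \<Longrightarrow> \<exists>d>0. \<forall>a\<in>I. \<forall>b\<in>I. a \<le> t \<and> t \<le> b \<and> curve_length N a b \<gamma> < d \<longrightarrow>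
        curve_length N a b \<gamma> = intrinsic_dist G N (\<gamma> a) (\<gamma> b)"
    using geo unfolding geodesic_on_def by auto
  have GI: "\<gamma> s \<in> G" if "s \<in> I" for s using \<gamma> [OF that that] by (auto simp: curve_in_def)
  \<comment> \<open>Signed arc length from a base point, because \<open>I\<close> may have no left
    end.\<close>
  define \<phi> where "\<phi> = (\<lambda>t. if t0 \<le> t then curve_length N t0 t \<gamma> else - curve_length N t t0 \<gamma>)"
  have \<phi>: "\<phi> b - \<phi> a = curve_length N a b \<gamma>" if ab: "a \<in> I" "b \<in> I" "a \<le> b" for a b
  proof -
    consider "t0 \<le> a" | "a < t0" "t0 \<le> b" | "b < t0" by linarith
    then show ?thesis
    proof cases
      case 1
      then show ?thesis using curve_length_add [OF \<gamma> [OF t0 ab(2)], of a b] ab by (simp add: \<phi>_def)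
    next
      case 2
      then show ?thesis using curve_length_add [OF \<gamma> [OF ab], of t0 b] by (simp add: \<phi>_def)
    next
      case 3
      then show ?thesis using curve_length_add [OF \<gamma> [OF ab(1) t0], of b t0] ab by (simp add: \<phi>_def)
    qed
  qed
  have mono: "\<phi> s \<le> \<phi> s'" if "s \<in> I" "s' \<in> I" "s \<le> s'" for s s'
    using \<phi> [OF that] sp.curve_length_nonneg [of s s' \<gamma>] by simp
  have cont: "continuous_on I \<phi>" by (rule continuous_on_arclength [OF \<gamma> \<phi> I])
  define J where "J = \<phi> ` I"
  have J: "is_interval J" "connected J"
    unfolding J_def using connected_continuous_image [OF cont] I by (auto simp: is_interval_connected_1)
  \<comment> \<open>An arc of length zero has \<open>len\<close> zero, hence equal ends; this makes
    the curve \<open>\<beta>\<close> in arc length well defined although \<open>\<phi>\<close> may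
    be constant on intervals.\<close>
  have fib: "\<gamma> s = \<gamma> s'" if s: "s \<in> I" "s' \<in> I" "\<phi> s = \<phi> s'" for s s'
  proof -
    have le: "\<gamma> s = \<gamma> s'" if "s \<in> I" "s' \<in> I" "\<phi> s = \<phi> s'" "s \<le> s'" for s s'
    proof -
      have "len (gap (\<gamma> s) (\<gamma> s')) \<le> 0"
        using len_gap_le_length [OF \<gamma> [OF that(1,2,4)]] \<phi> [OF that(1,2,4)] that by simp
      then have "gap (\<gamma> s) (\<gamma> s') = mat 1"
        using len_nonneg [of "gap (\<gamma> s) (\<gamma> s')"] by (intro len_eq_0 gap_R GI that) simp
      then show ?thesis using gap_mult [OF GI [OF that(1)], of "\<gamma> s'"] \<iota>_inj by simp
    qed
    then show ?thesis using s by (metis linear)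
  qed
  define \<beta> where "\<beta> = (\<lambda>p. \<gamma> (SOME t. t \<in> I \<and> \<phi> t = p))"
  have \<beta>: "\<beta> (\<phi> t) = \<gamma> t" if "t \<in> I" for t
  proof -
    have "(SOME s. s \<in> I \<and> \<phi> s = \<phi> t) \<in> I \<and> \<phi> (SOME s. s \<in> I \<and> \<phi> s = \<phi> t) = \<phi> t"
      by (rule someI [of _ t]) (use that in simp)
    then show ?thesis unfolding \<beta>_def using fib that by blast
  qed
  have \<beta>G: "\<beta> p \<in> G" if "p \<in> J" for p using that \<beta> GI by (auto simp: J_def)
  have "\<exists>x e. x \<in> R \<and> x \<in> skew_hermitian \<and> e > 0 \<and>
      (\<forall>q\<in>J. \<bar>q - p\<bar> < e \<longrightarrow> \<iota> (\<beta> q) = \<iota> (\<beta> p) ** matrix_exp ((q - p) *\<^sub>R x))" if p: "p \<in> J" for p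
  proof -
    obtain t where t: "t \<in> I" "p = \<phi> t" using p by (auto simp: J_def)
    obtain d where d: "d > 0" "\<And>a b. a \<in> I \<Longrightarrow> b \<in> I \<Longrightarrow> a \<le> t \<Longrightarrow> t \<le> b \<Longrightarrow> curve_length N a b \<gamma> < d \<Longrightarrow>
      curve_length N a b \<gamma> = intrinsic_dist G N (\<gamma> a) (\<gamma> b)"
      using short [OF t(1)] by blast
    show ?thesis
      using unit_speed_local_coset [OF \<gamma> \<phi> I t(1) d] \<beta> t by (auto simp: J_def)
  qed
  then obtain X E where X: "\<And>p. p \<in> J \<Longrightarrow> X p \<in> R" "\<And>p. p \<in> J \<Longrightarrow> X p \<in> skew_hermitian"
    and E: "\<And>p. p \<in> J \<Longrightarrow> E p > 0"
    and loc: "\<And>p q. p \<in> J \<Longrightarrow> q \<in> J \<Longrightarrow> \<bar>q - p\<bar> < E p \<Longrightarrow> \<iota> (\<beta> q) = \<iota> (\<beta> p) ** matrix_exp ((q - p) *\<^sub>R X p)"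
    by metis
  have Xloc: "X p = X q" if p: "p \<in> J" and q: "q \<in> J" "\<bar>q - p\<bar> < E p" "q \<noteq> p" for p q
  proof (rule matrix_exp_inj [OF X(1,2) [OF p] X(1,2) [OF q(1)], of "{s. q + s \<in> J \<and> \<bar>s\<bar> < E q \<and> \<bar>q + s - p\<bar> < E p}"])
    fix s assume "s \<in> {s. q + s \<in> J \<and> \<bar>s\<bar> < E q \<and> \<bar>q + s - p\<bar> < E p}"
    then have s: "q + s \<in> J" "\<bar>s\<bar> < E q" "\<bar>q + s - p\<bar> < E p" by auto
    have "\<iota> (\<beta> (q + s)) = \<iota> (\<beta> q) ** matrix_exp (s *\<^sub>R X q)" using loc [OF q(1) s(1)] s by simp
    moreover have "\<iota> (\<beta> (q + s)) = \<iota> (\<beta> q) ** matrix_exp (s *\<^sub>R X p)"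
    proof -
      have "\<iota> (\<beta> (q + s)) = \<iota> (\<beta> p) ** matrix_exp (((q - p) + s) *\<^sub>R X p)"
        using loc [OF p s(1,3)] by (simp add: algebra_simps)
      also have "\<dots> = \<iota> (\<beta> p) ** matrix_exp ((q - p) *\<^sub>R X p) ** matrix_exp (s *\<^sub>R X p)"
        unfolding matrix_exp_add [OF X(2) [OF p]] by (simp add: matrix_mul_assoc)
      finally show ?thesis using loc [OF p q(1,2)] by simp
    qed
    ultimately have "\<iota> (\<beta> q) ** matrix_exp (s *\<^sub>R X p) = \<iota> (\<beta> q) ** matrix_exp (s *\<^sub>R X q)" by simp
    then show "matrix_exp (s *\<^sub>R X p) = matrix_exp (s *\<^sub>R X q)"
      using unitary_cancel(1) [OF G_unitary [OF \<beta>G [OF q(1)]]] by metis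
  next
    fix e :: real assume e: "e > 0"
    define m where "m = min (e / 2) (min (E q / 2) \<bar>p - q\<bar>)"
    have m: "m > 0" "m < e" "m < E q" "m \<le> \<bar>p - q\<bar>" using e E [OF q(1)] q by (auto simp: m_def)
    \<comment> \<open>The step goes from \<open>q\<close> towards \<open>p\<close>, so
      \<open>q + s\<close> stays in the interval \<open>J\<close> and within the range of both local
      descriptions.\<close>
    define s where "s = (if q < p then m else - m)"
    have "q + s \<in> J"
    proof (cases "q < p")
      case True
      then show ?thesis using mem_is_interval_1_I [OF J(1) q(1) p, of "q + s"] m by (auto simp: s_def)
    next
      case False
      then show ?thesis using mem_is_interval_1_I [OF J(1) p q(1), of "q + s"] m by (auto simp: s_def)
    qed
    moreover have "\<bar>q + s - p\<bar> < E p" using m q by (auto simp: s_def)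
    ultimately show "\<exists>s\<in>{s. q + s \<in> J \<and> \<bar>s\<bar> < E q \<and> \<bar>q + s - p\<bar> < E p}. s \<noteq> 0 \<and> \<bar>s\<bar> < e"
      using m by (intro bexI [of _ s]) (auto simp: s_def)
  qed
  have near: "\<forall>\<^sub>F q in at p within J. q \<in> J \<and> \<bar>q - p\<bar> < E p \<and> q \<noteq> p" if "p \<in> J" for p
    unfolding eventually_at using E [OF that] by (intro exI [of _ "E p"]) (auto simp: dist_real_def)
  obtain p0 where p0: "p0 \<in> J" using t0 by (auto simp: J_def)
  define x where "x = X p0"
  have Xx: "X p = x" if p: "p \<in> J" for p
    unfolding x_def
  proof (rule connected_local_const [OF J(2) p p0, of X], intro ballI)
    fix p assume "p \<in> J"
    from near [OF this] show "\<forall>\<^sub>F q in at p within J. X p = X q"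
      by (rule eventually_mono) (use Xloc \<open>p \<in> J\<close> in blast)
  qed
  have x: "x \<in> R" "x \<in> skew_hermitian" using X p0 by (auto simp: x_def)
  \<comment> \<open>The position transported back to parameter \<open>0\<close> along the direction
    \<open>x\<close>; constancy of \<open>h\<close> means that the curve is a coset with this base
    point.\<close>
  define h where "h = (\<lambda>p. \<iota> (\<beta> p) ** matrix_exp ((- p) *\<^sub>R x))"
  have hc: "h p = h p0" if p: "p \<in> J" for p
  proof (rule connected_local_const [OF J(2) p p0, of h], intro ballI)
    fix p assume p: "p \<in> J"
    have "h p = h q" if q: "q \<in> J" "\<bar>q - p\<bar> < E p" for q
    proof -
      have "h q = \<iota> (\<beta> p) ** (matrix_exp ((q - p) *\<^sub>R x) ** matrix_exp ((- q) *\<^sub>R x))"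
        using loc [OF p q] Xx [OF p] by (simp add: h_def matrix_mul_assoc)
      also have "matrix_exp ((q - p) *\<^sub>R x) ** matrix_exp ((- q) *\<^sub>R x) = matrix_exp ((- p) *\<^sub>R x)"
        using matrix_exp_add [OF x(2), of "q - p" "- q"] by simp
      finally show ?thesis by (simp add: h_def)
    qed
    with near [OF p] show "\<forall>\<^sub>F q in at p within J. h p = h q"
      by (auto elim: eventually_mono)
  qed
  define u where "u = \<pi> (h p0)"
  have xp: "\<iota> (\<pi> x) = x" by (rule \<iota>_\<pi> [OF x(1)])
  have uG: "u \<in> G" unfolding u_def h_def
    by (rule G_exp [OF \<beta>G [OF p0] scale_R [OF x(1)]]) (use x(2) in \<open>simp add: skew_hermitian_def adjoint_scaleR adjoint_minus\<close>)
  have \<iota>u: "\<iota> u = h p0" unfolding u_def h_def by (intro \<iota>_\<pi> mult_R \<iota>_R exp_R x)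
  have sk: "\<iota> (\<pi> x) \<in> skew_hermitian" using x xp by simp
  have "\<gamma> t = coset u (\<pi> x) (\<phi> t)" if t: "t \<in> I" for t
  proof (rule \<iota>_inj)
    have "\<iota> (coset u (\<pi> x) (\<phi> t)) = h (\<phi> t) ** matrix_exp (\<phi> t *\<^sub>R x)"
      using \<iota>_coset [OF uG sk] xp \<iota>u hc [of "\<phi> t"] t by (simp add: J_def)
    also have "\<dots> = \<iota> (\<gamma> t) ** matrix_exp ((- \<phi> t + \<phi> t) *\<^sub>R x)"
      unfolding matrix_exp_add [OF x(2)] h_def \<beta> [OF t] by (simp add: matrix_mul_assoc)
    finally show "\<iota> (\<gamma> t) = \<iota> (coset u (\<pi> x) (\<phi> t))" by (simp add: matrix_exp_0)
  qed
  then have "reparametrization_of I \<gamma> J (coset u (\<pi> x))"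
    unfolding reparametrization_of_def using cont mono J_def by (intro exI [of _ \<phi>]) (auto simp: mono_on_def)
  moreover have "reparametrization_of J (coset u (\<pi> x)) J (coset u (\<pi> x))"
    unfolding reparametrization_of_def by (intro exI [of _ "\<lambda>t. t"]) (auto simp: mono_on_def)
  ultimately have "same_up_to_parameter I \<gamma> J (coset u (\<pi> x))" unfolding same_up_to_parameter_def by blast
  then show ?thesis using uG sk J(1) by blast
qed

end

end

subsection \<open>Schatten norms\<close>

text \<open>Strict convexity of \<open>x powr p\<close>: the tangent at \<open>s\<close> lies
  strictly below the graph except at \<open>s\<close>. The value \<open>0\<close> is treated apart
  because the mean value argument runs between positive points.\<close>

lemma tangent_powr:
  fixes s \<sigma> p :: real
  assumes p: "p > 1" and s: "s \<ge> 0" and \<sigma>: "\<sigma> \<ge> 0"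
  shows "s powr p + p * s powr (p - 1) * (\<sigma> - s) \<le> \<sigma> powr p" (is ?le)
    and "s powr p + p * s powr (p - 1) * (\<sigma> - s) = \<sigma> powr p \<Longrightarrow> \<sigma> = s"
proof -
  have strict: "s powr p + p * s powr (p - 1) * (\<sigma> - s) < \<sigma> powr p" if ne: "\<sigma> \<noteq> s"
  proof (cases "s = 0 \<or> \<sigma> = 0")
    case True
    then show ?thesis
    proof
      assume "s = 0"
      then show ?thesis using ne \<sigma> p by simp
    next
      assume "\<sigma> = 0"
      then have s0: "s > 0" using ne s by simp
      have "s powr (p - 1) * s = s powr p" using s0 by (simp add: powr_diff)
      then have "s powr p + p * s powr (p - 1) * (\<sigma> - s) = (1 - p) * s powr p"
        using \<open>\<sigma> = 0\<close> by (simp add: algebra_simps)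
      also have "\<dots> < 0" using p s0 by (simp add: mult_neg_pos)
      finally show ?thesis using \<open>\<sigma> = 0\<close> by simp
    qed
  next
    case False
    then have pos: "s > 0" "\<sigma> > 0" using s \<sigma> by auto
    have d: "((\<lambda>x. x powr p) has_real_derivative p * x powr (p - 1)) (at x)" if "x > 0" for x
      using has_real_derivative_powr [OF that, of p] .
    consider "s < \<sigma>" | "\<sigma> < s" using ne by linarith
    then show ?thesis
    proof cases
      case 1
      then obtain z where z: "s < z" "z < \<sigma>" "\<sigma> powr p - s powr p = (\<sigma> - s) * (p * z powr (p - 1))"
        using MVT2 [OF 1, of "\<lambda>x. x powr p" "\<lambda>x. p * x powr (p - 1)"] d pos by force
      have "s powr (p - 1) < z powr (p - 1)" using z pos p by (intro powr_less_mono2) auto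
      then have "(\<sigma> - s) * (p * s powr (p - 1)) < (\<sigma> - s) * (p * z powr (p - 1))"
        using 1 p by (intro mult_strict_left_mono) auto
      then show ?thesis using z by (simp add: mult_ac)
    next
      case 2
      then obtain z where z: "\<sigma> < z" "z < s" "s powr p - \<sigma> powr p = (s - \<sigma>) * (p * z powr (p - 1))"
        using MVT2 [OF 2, of "\<lambda>x. x powr p" "\<lambda>x. p * x powr (p - 1)"] d pos by force
      have "z powr (p - 1) < s powr (p - 1)" using z pos p by (intro powr_less_mono2) auto
      then have "(s - \<sigma>) * (p * z powr (p - 1)) < (s - \<sigma>) * (p * s powr (p - 1))"
        using 2 p by (intro mult_strict_left_mono) auto
      moreover have "(s - \<sigma>) * (p * s powr (p - 1)) = - (p * s powr (p - 1) * (\<sigma> - s))" by (simp add: algebra_simps)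
      ultimately show ?thesis using z by linarith
    qed
  qed
  have "p * s powr (p - 1) * (s - s) = 0" by simp
  then show ?le using strict by (cases "\<sigma> = s") (auto intro: less_imp_le)
  show "\<sigma> = s" if "s powr p + p * s powr (p - 1) * (\<sigma> - s) = \<sigma> powr p" using strict that by force
qed

text \<open>Independence of the diagonalization, applied to \<open>f\<close> after
  \<open>Re\<close>, gives the uniqueness that \<open>THE\<close> requires.\<close>

lemma hermitian_apply_diag_conj:
  assumes U: "unitary_matrix U"
  shows "hermitian_apply f (diag_conj U (\<lambda>i. of_real (d i))) = diag_conj U (\<lambda>i. of_real (f (d i)))"
proof -
  have dm: "u ** diagonal_matrix e ** adjoint_matrix u = diag_conj u (\<lambda>i. of_real (e i))" for u :: "complex^'n^'n" and e
    by (simp add: diag_conj_def diagonal_matrix_eq_cdiag)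
  show ?thesis
    unfolding hermitian_apply_def dm
  proof (rule the_equality)
    show "\<exists>u e. unitary_matrix u \<and> diag_conj U (\<lambda>i. complex_of_real (d i)) = diag_conj u (\<lambda>i. complex_of_real (e i)) \<and>
        diag_conj U (\<lambda>i. complex_of_real (f (d i))) = diag_conj u (\<lambda>i. complex_of_real ((f \<circ> e) i))"
      using U by (intro exI [of _ U] exI [of _ d]) simp
    fix B assume "\<exists>u e. unitary_matrix u \<and> diag_conj U (\<lambda>i. complex_of_real (d i)) = diag_conj u (\<lambda>i. complex_of_real (e i)) \<and>
        B = diag_conj u (\<lambda>i. complex_of_real ((f \<circ> e) i))"
    then obtain u e where u: "unitary_matrix u" "diag_conj U (\<lambda>i. complex_of_real (d i)) = diag_conj u (\<lambda>i. complex_of_real (e i))"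
      and B: "B = diag_conj u (\<lambda>i. complex_of_real (f (e i)))" by auto
    show "B = diag_conj U (\<lambda>i. complex_of_real (f (d i)))"
      unfolding B using diag_conj_comp_cong [OF U u, of "\<lambda>z. of_real (f (Re z))"] by simp
  qed
qed

lemma trace_diag_conj:
  assumes "unitary_matrix (U :: complex^'n^'n)" shows "trace (diag_conj U f) = (\<Sum>i\<in>UNIV. f i)"
proof -
  have "trace (diag_conj U f) = trace (adjoint_matrix U ** (U ** cdiag f))"
    unfolding diag_conj_def by (rule trace_mul_sym)
  also have "\<dots> = (\<Sum>i\<in>UNIV. f i)"
    by (simp add: unitary_cancel(1) [OF assms] trace_def cdiag_def)
  finally show ?thesis .
qed

text \<open>The \<open>p\<close>-th power of the norm. For \<open>p > 1\<close> it is strictly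
  convex on the whole space, whereas the norm is linear along rays.\<close>

definition schatten_power :: "real \<Rightarrow> complex^'n^'n \<Rightarrow> real" where
  "schatten_power p x = Re (trace (hermitian_apply (\<lambda>s. s powr p) (matrix_abs x)))"

lemma schatten_norm_eq: "schatten_norm p x = schatten_power p x powr (1 / p)"
  by (simp add: schatten_norm_def schatten_power_def)

lemma schatten_power_gram:
  assumes V: "unitary_matrix V" and g: "adjoint_matrix x ** x = diag_conj V (\<lambda>i. of_real ((\<sigma> i)\<^sup>2))"
    and \<sigma>: "\<And>i. \<sigma> i \<ge> 0"
  shows "schatten_power p x = (\<Sum>i\<in>UNIV. \<sigma> i powr p)"
  unfolding schatten_power_def matrix_abs_def g hermitian_apply_diag_conj [OF V] trace_diag_conj [OF V]
  using \<sigma> by simp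

text \<open>If \<open>V\<close> diagonalizes the Gram matrix, the columns of \<open>x ** V\<close>
  are orthogonal with the singular values as lengths; the nonzero ones, normalized, are completed to
  the unitary \<open>W\<close>.\<close>

lemma singular_value_decomposition:
  fixes x :: "complex^'n^'n"
  obtains W V \<sigma> where "unitary_matrix W" "unitary_matrix V" "\<And>i. (0::real) \<le> \<sigma> i"
    "x = W ** cdiag (\<lambda>i. of_real (\<sigma> i)) ** adjoint_matrix V"
proof -
  obtain V where V: "unitary_matrix V"
    and d0: "\<And>H. H \<in> {adjoint_matrix x ** x} \<Longrightarrow> \<exists>d::'n \<Rightarrow> real. H = diag_conj V (\<lambda>i. of_real (d i))"
    by (rule commuting_hermitian_diagonalization [of "{adjoint_matrix x ** x}"]) (auto simp: adjoint_mult)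
  obtain d where d: "adjoint_matrix x ** x = diag_conj V (\<lambda>i. complex_of_real (d i))"
    using d0 by blast
  define y where "y = x ** V"
  have gram: "adjoint_matrix y ** y = cdiag (\<lambda>i. of_real (d i))"
  proof -
    have "adjoint_matrix y ** y = adjoint_matrix V ** (adjoint_matrix x ** x) ** V"
      by (simp add: y_def adjoint_mult matrix_mul_assoc)
    also have "\<dots> = cdiag (\<lambda>i. of_real (d i))"
      unfolding d diag_conj_def using unitary_cancel [OF V] by (simp flip: matrix_mul_assoc)
    finally show ?thesis .
  qed
  define c where "c = (\<lambda>j. (\<chi> i. y $ i $ j) :: complex^'n)"
  have hc: "hdot (c i) (c j) = (if i = j then of_real (d j) else 0)" for i j
  proof -
    have "hdot (c i) (c j) = (adjoint_matrix y ** y) $ i $ j"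
      by (simp add: hdot_def c_def matrix_matrix_mult_def)
    then show ?thesis by (simp add: gram cdiag_def)
  qed
  have d_norm: "d j = (norm (c j))\<^sup>2" for j
    using hc [of j j] hdot_self [of "c j"] of_real_eq_iff [where 'a = complex] by (metis (mono_tags, lifting))
  define \<sigma> where "\<sigma> = (\<lambda>j. norm (c j))"
  define e where "e = (\<lambda>j. complex_of_real (inverse (\<sigma> j)) *s c j)"
  have "\<exists>e'. (\<forall>j\<in>{j. c j \<noteq> 0}. e' j = e j) \<and> (\<forall>i j. hdot (e' i) (e' j) = (if i = j then 1 else 0)) \<and>
     (\<forall>j. \<forall>H\<in>({} :: (complex^'n^'n) set). \<exists>r::real. H *v e' j = r *\<^sub>R e' j)"
  proof (rule extend_orthonormal_eigenbasis)
    fix i j assume "i \<in> {j. c j \<noteq> 0}" "j \<in> {j. c j \<noteq> 0}"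
    then show "hdot (e i) (e j) = (if i = j then 1 else 0)"
      by (auto simp: e_def hdot_scale_left hdot_scale_right hc d_norm \<sigma>_def power2_eq_square) (simp add: field_simps)?
  qed auto
  then obtain e' where e': "\<And>j. c j \<noteq> 0 \<Longrightarrow> e' j = e j" and on: "\<And>i j. hdot (e' i) (e' j) = (if i = j then 1 else 0)"
    by blast
  define W :: "complex^'n^'n" where "W = (\<chi> i j. e' j $ i)"
  have W: "unitary_matrix W" unfolding W_def by (rule unitary_matrix_columns [OF on])
  have "c j = complex_of_real (\<sigma> j) *s e' j" for j
  proof (cases "c j = 0")
    case True
    then show ?thesis by (simp add: \<sigma>_def)
  next
    case False
    then show ?thesis using e' [OF False] by (simp add: e_def \<sigma>_def vec_eq_iff)
  qed
  then have "y = W ** cdiag (\<lambda>i. of_real (\<sigma> i))"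
    by (simp add: vec_eq_iff matrix_matrix_mult_def cdiag_def W_def if_distrib [where f = "\<lambda>x. _ * x"] c_def mult.commute cong: if_cong)
  then have "x = W ** cdiag (\<lambda>i. of_real (\<sigma> i)) ** adjoint_matrix V"
    using unitary_cancel(3) [OF V, of x] by (simp add: y_def)
  then show ?thesis using that [OF W V, of \<sigma>] by (simp add: \<sigma>_def)
qed

lemma schatten_power_svd:
  assumes "unitary_matrix W" "unitary_matrix V" "\<And>i. \<sigma> i \<ge> 0"
    "x = W ** cdiag (\<lambda>i. of_real (\<sigma> i)) ** adjoint_matrix V"
  shows "schatten_power p x = (\<Sum>i\<in>UNIV. \<sigma> i powr p)"
proof (rule schatten_power_gram [OF assms(2) _ assms(3)])
  have "adjoint_matrix x ** x = V ** cdiag (\<lambda>i. of_real (\<sigma> i)) ** (adjoint_matrix W ** W) ** cdiag (\<lambda>i. of_real (\<sigma> i)) ** adjoint_matrix V"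
    by (simp add: assms(4) adjoint_mult cdiag_adjoint matrix_mul_assoc)
  also have "\<dots> = V ** (cdiag (\<lambda>i. of_real (\<sigma> i)) ** cdiag (\<lambda>i. of_real (\<sigma> i))) ** adjoint_matrix V"
    using assms(1) by (simp add: unitary_matrix_def matrix_mul_assoc)
  finally show "adjoint_matrix x ** x = diag_conj V (\<lambda>i. of_real ((\<sigma> i)\<^sup>2))"
    by (simp add: cdiag_mult diag_conj_def power2_eq_square)
qed

text \<open>The pairing with two unitaries is dominated by the doubly stochastic
  weights \<open>m\<close>, so Jensen's inequality applies, and both inequalities have explicit equality cases.\<close>

lemma schatten_power_tangent:
  fixes x A B :: "complex^'n^'n"
  assumes p: "p > 1" and A: "unitary_matrix A" and B: "unitary_matrix B" and s: "\<And>j. s j \<ge> 0"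
  defines "Y \<equiv> adjoint_matrix A ** x ** B"
  defines "T \<equiv> \<Sum>j\<in>UNIV. s j powr p + p * s j powr (p - 1) * (Re (Y $ j $ j) - s j)"
  shows "T \<le> schatten_power p x"
    and "T = schatten_power p x \<Longrightarrow> x = A ** cdiag (\<lambda>j. of_real (s j)) ** adjoint_matrix B"
proof -
  obtain W V \<sigma> where W: "unitary_matrix W" and V: "unitary_matrix V" and \<sigma>: "\<And>i. (0::real) \<le> \<sigma> i"
    and x: "x = W ** cdiag (\<lambda>i. of_real (\<sigma> i)) ** adjoint_matrix V"
    by (rule singular_value_decomposition [of x], rule that)
  define P where "P = adjoint_matrix A ** W"
  define Q where "Q = adjoint_matrix V ** B"
  have PQ: "unitary_matrix P" "unitary_matrix Q"
    unfolding P_def Q_def by (intro unitary_matrix_mult unitary_matrix_adjoint A B W V)+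
  have Y: "Y $ j $ l = (\<Sum>i\<in>UNIV. P $ j $ i * of_real (\<sigma> i) * Q $ i $ l)" for j l
  proof -
    have "Y = P ** cdiag (\<lambda>i. of_real (\<sigma> i)) ** Q"
      by (simp add: Y_def x P_def Q_def matrix_mul_assoc)
    then show ?thesis
      by (simp add: matrix_matrix_mult_def cdiag_def if_distrib [where f = "\<lambda>x. _ * x"] cong: if_cong)
  qed
  \<comment> \<open>The mean of two doubly stochastic families is doubly stochastic. It dominates
    \<open>Re (P $ j $ i * Q $ i $ j)\<close>, and the identity \<open>gap\<close> measures the
    excess as a square.\<close>
  define m where "m = (\<lambda>j i. ((cmod (P $ j $ i))\<^sup>2 + (cmod (Q $ i $ j))\<^sup>2) / 2)"
  have m0: "m j i \<ge> 0" for j i by (simp add: m_def)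
  have rows: "(\<Sum>i\<in>UNIV. (cmod (U $ j $ i))\<^sup>2) = 1" "(\<Sum>j\<in>UNIV. (cmod (U $ j $ i))\<^sup>2) = 1"
    if "unitary_matrix U" for U :: "complex^'n^'n" and i j
    using unitary_row_sum [OF that, of j] unitary_row_sum [OF unitary_matrix_adjoint [OF that], of i] by simp_all
  have m1: "(\<Sum>i\<in>UNIV. m j i) = 1" "(\<Sum>j\<in>UNIV. m j i) = 1" for i j
    using rows [OF PQ(1)] rows [OF PQ(2)] by (simp_all add: m_def sum.distrib flip: sum_divide_distrib)
  have gap: "2 * (m j i - Re (P $ j $ i * Q $ i $ j)) = (cmod (cnj (P $ j $ i) - Q $ i $ j))\<^sup>2" for j i
    unfolding m_def cmod_power2 by (simp add: power2_eq_square algebra_simps)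
  have gap0: "0 \<le> m j i - Re (P $ j $ i * Q $ i $ j)" for j i
  proof -
    have "0 \<le> 2 * (m j i - Re (P $ j $ i * Q $ i $ j))" unfolding gap by simp
    then show ?thesis by (simp only: zero_le_mult_iff) simp
  qed
  \<comment> \<open>The difference to be shown nonnegative, split into terms: the first summand is
    the slack in the tangent inequality, the second the slack in the product bound.\<close>
  define t where "t = (\<lambda>j i. m j i * (\<sigma> i powr p - (s j powr p + p * s j powr (p - 1) * (\<sigma> i - s j)))
      + p * s j powr (p - 1) * (\<sigma> i * (m j i - Re (P $ j $ i * Q $ i $ j))))"
  have t1: "0 \<le> m j i * (\<sigma> i powr p - (s j powr p + p * s j powr (p - 1) * (\<sigma> i - s j)))" for j i
    using m0 tangent_powr(1) [OF p s \<sigma>] by simp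
  have t2: "0 \<le> p * s j powr (p - 1) * (\<sigma> i * (m j i - Re (P $ j $ i * Q $ i $ j)))" for j i
    using p \<sigma> gap0 by simp
  have diff: "schatten_power p x - T = (\<Sum>j\<in>UNIV. \<Sum>i\<in>UNIV. t j i)"
  proof -
    have "schatten_power p x = (\<Sum>i\<in>UNIV. \<Sum>j\<in>UNIV. m j i * \<sigma> i powr p)"
      unfolding schatten_power_svd [OF W V \<sigma> x] using m1 by (simp flip: sum_distrib_right)
    then have 1: "schatten_power p x = (\<Sum>j\<in>UNIV. \<Sum>i\<in>UNIV. m j i * \<sigma> i powr p)"
      by (subst sum.swap)
    have "s j powr p + p * s j powr (p - 1) * (Re (Y $ j $ j) - s j) =
      (\<Sum>i\<in>UNIV. m j i * (s j powr p - p * s j powr (p - 1) * s j) + p * s j powr (p - 1) * (\<sigma> i * Re (P $ j $ i * Q $ i $ j)))" for j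
    proof -
      have "Re (Y $ j $ j) = (\<Sum>i\<in>UNIV. \<sigma> i * Re (P $ j $ i * Q $ i $ j))"
        unfolding Y Re_sum
        by (intro sum.cong refl) (simp add: algebra_simps)
      then show ?thesis
        by (simp only: sum.distrib m1 flip: sum_distrib_left sum_distrib_right) (simp add: algebra_simps)
    qed
    then show ?thesis
      unfolding T_def 1 t_def by (simp flip: sum_subtractf) (simp add: algebra_simps)
  qed
  have tn: "0 \<le> t j i" for j i unfolding t_def using t1 t2 by (rule add_nonneg_nonneg)
  then have "0 \<le> (\<Sum>j\<in>UNIV. \<Sum>i\<in>UNIV. t j i)" by (intro sum_nonneg)
  then show "T \<le> schatten_power p x" using diff by linarith
  assume "T = schatten_power p x"
  then have "(\<Sum>j\<in>UNIV. \<Sum>i\<in>UNIV. t j i) = 0" using diff by simp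
  then have "t j i = 0" for j i
    using tn by (simp add: sum_nonneg_eq_0_iff sum_nonneg)
  then have z1: "m j i * (\<sigma> i powr p - (s j powr p + p * s j powr (p - 1) * (\<sigma> i - s j))) = 0"
    and z2: "p * s j powr (p - 1) * (\<sigma> i * (m j i - Re (P $ j $ i * Q $ i $ j))) = 0" for j i
    using t1 [of j i] t2 [of j i] unfolding t_def by (smt (verit))+
  have eq\<sigma>: "\<sigma> i = s j" if "m j i \<noteq> 0" for i j
    using z1 [of j i] that tangent_powr(2) [OF p s \<sigma>, of j i] by simp
  have P0: "m j i \<noteq> 0" if "P $ j $ i \<noteq> 0" for i j
  proof -
    have "m j i > 0" using that by (simp add: m_def add_pos_nonneg)
    then show ?thesis by simp
  qed
  \<comment> \<open>Vanishing slack gives \<open>\<sigma> i = s j\<close> wherever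
    \<open>P $ j $ i\<close> is nonzero, and for \<open>s j \<noteq> 0\<close> makes row
    \<open>j\<close> of \<open>P\<close> the conjugate of column \<open>j\<close> of
    \<open>Q\<close>; unitarity of \<open>Q\<close> then makes \<open>Y\<close> diagonal.\<close>
  have "Y $ j $ l = (if j = l then of_real (s j) else 0)" for j l
  proof -
    have PS: "P $ j $ i * of_real (\<sigma> i) = of_real (s j) * P $ j $ i" for i
      using eq\<sigma> P0 by (cases "P $ j $ i = 0") auto
    have Yj: "Y $ j $ l = of_real (s j) * (\<Sum>i\<in>UNIV. P $ j $ i * Q $ i $ l)"
      unfolding Y PS by (simp add: sum_distrib_left mult_ac)
    show ?thesis
    proof (cases "s j = 0")
      case True
      then show ?thesis using Yj by auto
    next
      case False
      have "P $ j $ i = cnj (Q $ i $ j)" for i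
      proof -
        have "m j i - Re (P $ j $ i * Q $ i $ j) = 0"
        proof (cases "m j i = 0")
          case True
          then have "P $ j $ i = 0" using P0 by blast
          then show ?thesis using True by simp
        next
          case nz: False
          then show ?thesis using z2 [of j i] eq\<sigma> [OF nz] False s [of j] p by simp
        qed
        then have "cnj (P $ j $ i) = Q $ i $ j" using gap [of j i] by simp
        then show ?thesis by (metis complex_cnj_cnj)
      qed
      then have "(\<Sum>i\<in>UNIV. P $ j $ i * Q $ i $ l) = (adjoint_matrix Q ** Q) $ j $ l"
        by (simp add: matrix_matrix_mult_def)
      also have "\<dots> = (if j = l then 1 else 0)" using PQ(2) by (simp add: unitary_matrix_def mat_def)
      finally show ?thesis using Yj by simp
    qed
  qed
  then have "Y = cdiag (\<lambda>j. of_real (s j))" by (simp add: vec_eq_iff cdiag_def)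
  moreover have "x = A ** Y ** adjoint_matrix B"
    unfolding Y_def by (simp add: matrix_mul_assoc unitary_cancel(6) [OF A])
      (simp add: unitary_cancel(6) [OF B] flip: matrix_mul_assoc)
  ultimately show "x = A ** cdiag (\<lambda>j. of_real (s j)) ** adjoint_matrix B" by simp
qed

text \<open>The functional \<open>T\<close> from the singular values of the convex combination
  \<open>m\<close> is affine, exact at \<open>m\<close>, and below the power everywhere. If equality
  holds, \<open>T\<close> is also exact at \<open>x\<close> and \<open>y\<close>, which identifies
  both with \<open>m\<close>.\<close>

lemma schatten_power_convex:
  fixes x y :: "complex^'n^'n"
  assumes p: "p > 1" and t: "0 < t" "t < 1"
  shows "schatten_power p ((1 - t) *\<^sub>R x + t *\<^sub>R y) \<le> (1 - t) * schatten_power p x + t * schatten_power p y"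
    and "schatten_power p ((1 - t) *\<^sub>R x + t *\<^sub>R y) = (1 - t) * schatten_power p x + t * schatten_power p y \<Longrightarrow> x = y"
proof -
  define m where "m = (1 - t) *\<^sub>R x + t *\<^sub>R y"
  obtain A B s where A: "unitary_matrix A" and B: "unitary_matrix B" and s: "\<And>i. (0::real) \<le> s i"
    and m: "m = A ** cdiag (\<lambda>i. of_real (s i)) ** adjoint_matrix B"
    by (rule singular_value_decomposition [of m], rule that)
  define T where "T = (\<lambda>x. \<Sum>j\<in>UNIV. s j powr p + p * s j powr (p - 1) * (Re ((adjoint_matrix A ** x ** B) $ j $ j) - s j))"
  have "adjoint_matrix A ** m ** B = cdiag (\<lambda>i. of_real (s i))"
    unfolding m by (simp add: matrix_mul_assoc unitary_cancel(5) [OF A]) (simp add: unitary_cancel(5) [OF B] flip: matrix_mul_assoc)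
  then have diag: "Re ((adjoint_matrix A ** m ** B) $ j $ j) = s j" for j by (simp add: cdiag_def)
  have aff: "adjoint_matrix A ** m ** B = (1 - t) *\<^sub>R (adjoint_matrix A ** x ** B) + t *\<^sub>R (adjoint_matrix A ** y ** B)"
    by (simp add: m_def matrix_mult_add_left matrix_mult_add_right matrix_mult_scaleR_left matrix_mult_scaleR_right)
  have "(1 - t) * (Re ((adjoint_matrix A ** x ** B) $ j $ j) - s j) + t * (Re ((adjoint_matrix A ** y ** B) $ j $ j) - s j) = 0" for j
    using diag [of j] unfolding aff by (simp add: algebra_simps)
  then have lin: "(1 - t) * (s j powr p + p * s j powr (p - 1) * (Re ((adjoint_matrix A ** x ** B) $ j $ j) - s j)) +
      t * (s j powr p + p * s j powr (p - 1) * (Re ((adjoint_matrix A ** y ** B) $ j $ j) - s j)) = s j powr p" for j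
  proof -
    fix j
    let ?a = "Re ((adjoint_matrix A ** x ** B) $ j $ j) - s j" and ?b = "Re ((adjoint_matrix A ** y ** B) $ j $ j) - s j"
    assume *: "\<And>j. (1 - t) * (Re ((adjoint_matrix A ** x ** B) $ j $ j) - s j) + t * (Re ((adjoint_matrix A ** y ** B) $ j $ j) - s j) = 0"
    have "(1 - t) * (s j powr p + p * s j powr (p - 1) * ?a) + t * (s j powr p + p * s j powr (p - 1) * ?b)
      = s j powr p + p * s j powr (p - 1) * ((1 - t) * ?a + t * ?b)" by (simp add: algebra_simps)
    then show "(1 - t) * (s j powr p + p * s j powr (p - 1) * ?a) + t * (s j powr p + p * s j powr (p - 1) * ?b) = s j powr p"
      using * [of j] by simp
  qed
  have TT: "(1 - t) * T x + t * T y = schatten_power p m"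
    unfolding T_def sum_distrib_left schatten_power_svd [OF A B s m] sum.distrib [symmetric] lin ..
  have le: "T x \<le> schatten_power p x" "T y \<le> schatten_power p y"
    unfolding T_def using schatten_power_tangent(1) [OF p A B, of s] s by blast+
  have le': "(1 - t) * T x \<le> (1 - t) * schatten_power p x" "t * T y \<le> t * schatten_power p y"
    using le t by (auto intro: mult_left_mono)
  then show "schatten_power p ((1 - t) *\<^sub>R x + t *\<^sub>R y) \<le> (1 - t) * schatten_power p x + t * schatten_power p y"
    using TT by (simp add: m_def)
  assume "schatten_power p ((1 - t) *\<^sub>R x + t *\<^sub>R y) = (1 - t) * schatten_power p x + t * schatten_power p y"
  then have "(1 - t) * T x = (1 - t) * schatten_power p x" "t * T y = t * schatten_power p y"
    using TT le' unfolding m_def by linarith+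
  then have "T x = schatten_power p x" "T y = schatten_power p y" using t by auto
  then have "x = m" "y = m"
    unfolding T_def m using schatten_power_tangent(2) [OF p A B, of s] s by blast+
  then show "x = y" by simp
qed

section \<open>Norm axioms and strict convexity of the Schatten norms\<close>

lemma schatten_power_nonneg: "0 \<le> schatten_power p (x :: complex^'n^'n)"
proof -
  obtain W V \<sigma> where svd: "unitary_matrix W" "unitary_matrix V" "\<And>i. (0::real) \<le> \<sigma> i"
    "x = W ** cdiag (\<lambda>i. of_real (\<sigma> i)) ** adjoint_matrix V"
    by (rule singular_value_decomposition [of x], rule that)
  show ?thesis unfolding schatten_power_svd [OF svd] by (simp add: sum_nonneg)
qed

lemma schatten_power_eq_0_iff: "schatten_power p (x :: complex^'n^'n) = 0 \<longleftrightarrow> x = 0"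
proof -
  obtain W V \<sigma> where svd: "unitary_matrix W" "unitary_matrix V" "\<And>i. (0::real) \<le> \<sigma> i"
    "x = W ** cdiag (\<lambda>i. of_real (\<sigma> i)) ** adjoint_matrix V"
    by (rule singular_value_decomposition [of x], rule that)
  have x: "adjoint_matrix W ** x ** V = cdiag (\<lambda>i. of_real (\<sigma> i))"
    unfolding svd(4) by (simp add: matrix_mul_assoc unitary_cancel(5) [OF svd(1)])
      (simp add: unitary_cancel(5) [OF svd(2)] flip: matrix_mul_assoc)
  have "schatten_power p x = 0 \<longleftrightarrow> (\<forall>i. \<sigma> i = 0)"
    unfolding schatten_power_svd [OF svd] by (simp add: sum_nonneg_eq_0_iff)
  also have "\<dots> \<longleftrightarrow> x = 0"
  proof
    assume "\<forall>i. \<sigma> i = 0"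
    then have "cdiag (\<lambda>i. complex_of_real (\<sigma> i)) = 0" by (simp add: cdiag_def vec_eq_iff)
    then show "x = 0" unfolding svd(4) by simp
  next
    assume "x = 0"
    then have c: "cdiag (\<lambda>i. complex_of_real (\<sigma> i)) = 0" using x by simp
    show "\<forall>i. \<sigma> i = 0"
    proof
      fix i
      have "cdiag (\<lambda>i. complex_of_real (\<sigma> i)) $ i $ i = 0" by (simp add: c)
      then show "\<sigma> i = 0" by (simp add: cdiag_def)
    qed
  qed
  finally show ?thesis .
qed

lemma schatten_power_scale:
  "schatten_power p (map_matrix ((*) c) x) = cmod c powr p * schatten_power p (x :: complex^'n^'n)"
proof -
  obtain W V \<sigma> where svd: "unitary_matrix W" "unitary_matrix V" "\<And>i. (0::real) \<le> \<sigma> i"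
    "x = W ** cdiag (\<lambda>i. of_real (\<sigma> i)) ** adjoint_matrix V"
    by (rule singular_value_decomposition [of x], rule that)
  have "adjoint_matrix (map_matrix ((*) c) x) ** map_matrix ((*) c) x
      = map_matrix ((*) (cnj c * c)) (adjoint_matrix x ** x)"
    unfolding map_matrix_adjoint map_matrix_mult_left map_matrix_mult_right by (simp add: vec_eq_iff mult_ac)
  also have "adjoint_matrix x ** x = diag_conj V (\<lambda>i. of_real ((\<sigma> i)\<^sup>2))"
  proof -
    have "adjoint_matrix x ** x = V ** cdiag (\<lambda>i. of_real (\<sigma> i)) ** (adjoint_matrix W ** W) ** cdiag (\<lambda>i. of_real (\<sigma> i)) ** adjoint_matrix V"
      by (simp add: svd(4) adjoint_mult cdiag_adjoint matrix_mul_assoc)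
    also have "\<dots> = V ** (cdiag (\<lambda>i. of_real (\<sigma> i)) ** cdiag (\<lambda>i. of_real (\<sigma> i))) ** adjoint_matrix V"
      using svd(1) by (simp add: unitary_matrix_def matrix_mul_assoc)
    finally show ?thesis by (simp add: cdiag_mult diag_conj_def power2_eq_square)
  qed
  also have "cnj c * c = of_real ((cmod c)\<^sup>2)" using complex_norm_square [of c] by (simp add: mult.commute)
  finally have "adjoint_matrix (map_matrix ((*) c) x) ** map_matrix ((*) c) x = diag_conj V (\<lambda>i. of_real ((cmod c * \<sigma> i)\<^sup>2))"
    by (simp add: map_matrix_diag_conj power_mult_distrib)
  then have "schatten_power p (map_matrix ((*) c) x) = (\<Sum>i\<in>UNIV. (cmod c * \<sigma> i) powr p)"
    by (rule schatten_power_gram [OF svd(2)]) (simp add: svd(3))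
  then show ?thesis unfolding schatten_power_svd [OF svd] using svd(3) by (simp add: powr_mult sum_distrib_left)
qed

lemma schatten_power_unitary:
  assumes u: "unitary_matrix u" and v: "unitary_matrix v"
  shows "schatten_power p (u ** x ** v) = schatten_power p (x :: complex^'n^'n)"
proof -
  obtain W V \<sigma> where svd: "unitary_matrix W" "unitary_matrix V" "\<And>i. (0::real) \<le> \<sigma> i"
    "x = W ** cdiag (\<lambda>i. of_real (\<sigma> i)) ** adjoint_matrix V"
    by (rule singular_value_decomposition [of x], rule that)
  have "u ** x ** v = (u ** W) ** cdiag (\<lambda>i. of_real (\<sigma> i)) ** adjoint_matrix (adjoint_matrix v ** V)"
    by (simp add: svd(4) adjoint_mult matrix_mul_assoc)
  then have "schatten_power p (u ** x ** v) = (\<Sum>i\<in>UNIV. \<sigma> i powr p)"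
    by (rule schatten_power_svd [rotated 3]) (intro unitary_matrix_mult unitary_matrix_adjoint u v svd)+
  then show ?thesis by (simp add: schatten_power_svd [OF svd])
qed

lemma map_matrix_of_real: "map_matrix ((*) (complex_of_real c)) x = c *\<^sub>R x"
  by (simp add: vec_eq_iff scaleR_conv_of_real [where 'a = complex])

lemma schatten_norm_scale:
  assumes "p > 1"
  shows "schatten_norm p (map_matrix ((*) c) x) = cmod c * schatten_norm p (x :: complex^'n^'n)"
  unfolding schatten_norm_eq schatten_power_scale
  using assms schatten_power_nonneg [of p x] by (simp add: powr_mult powr_powr)

lemma schatten_norm_scaleR: "p > 1 \<Longrightarrow> schatten_norm p (c *\<^sub>R x) = \<bar>c\<bar> * schatten_norm p (x :: complex^'n^'n)"
  using schatten_norm_scale [of p "of_real c" x] by (simp add: map_matrix_of_real)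

lemma schatten_norm_eq_0_iff: "p > 1 \<Longrightarrow> schatten_norm p (x :: complex^'n^'n) = 0 \<longleftrightarrow> x = 0"
  by (simp add: schatten_norm_eq schatten_power_eq_0_iff)

lemma schatten_power_of_norm:
  "p > 1 \<Longrightarrow> schatten_power p (x :: complex^'n^'n) = schatten_norm p x powr p"
  using schatten_power_nonneg [of p x] by (simp add: schatten_norm_eq powr_powr)

text \<open>Minkowski's inequality from convexity of the \<open>p\<close>-th power, applied to the
  two matrices scaled to norm \<open>1\<close>.\<close>

lemma schatten_norm_triangle:
  fixes x y :: "complex^'n^'n"
  assumes p: "p > 1" shows "schatten_norm p (x + y) \<le> schatten_norm p x + schatten_norm p y"
proof -
  define a b where "a = schatten_norm p x" and "b = schatten_norm p y"
  have nn: "a \<ge> 0" "b \<ge> 0" by (simp_all add: a_def b_def schatten_norm_eq)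
  show ?thesis
  proof (cases "a = 0 \<or> b = 0")
    case True
    then have "x = 0 \<or> y = 0" using schatten_norm_eq_0_iff [OF p] by (auto simp: a_def b_def)
    then show ?thesis using nn by (auto simp: a_def b_def)
  next
    case False
    then have pos: "a > 0" "b > 0" using nn by auto
    \<comment> \<open>With this weight the convex combination of the normalized matrices is a
      multiple of \<open>x + y\<close>.\<close>
    define t where "t = b / (a + b)"
    have t: "0 < t" "t < 1" using pos by (auto simp: t_def)
    have "a + b \<noteq> 0" using pos by simp
    then have "1 - t = a / (a + b)" by (simp add: t_def field_simps)
    then have ta: "(1 - t) / a = 1 / (a + b)" "t / b = 1 / (a + b)" using pos by (simp_all add: t_def)
    have "(1 - t) *\<^sub>R (x /\<^sub>R a) + t *\<^sub>R (y /\<^sub>R b) = (x + y) /\<^sub>R (a + b)"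
      using ta by (simp add: divide_inverse scaleR_add_right)
    then have "schatten_power p ((x + y) /\<^sub>R (a + b)) \<le> (1 - t) * schatten_power p (x /\<^sub>R a) + t * schatten_power p (y /\<^sub>R b)"
      using schatten_power_convex(1) [OF p t, of "x /\<^sub>R a" "y /\<^sub>R b"] by simp
    also have "schatten_power p (x /\<^sub>R a) = 1"
      using pos by (simp add: schatten_power_of_norm [OF p] schatten_norm_scaleR [OF p] flip: a_def)
    also have "schatten_power p (y /\<^sub>R b) = 1"
      using pos by (simp add: schatten_power_of_norm [OF p] schatten_norm_scaleR [OF p] flip: b_def)
    finally have "schatten_power p ((x + y) /\<^sub>R (a + b)) \<le> 1" by simp
    then have "schatten_norm p ((x + y) /\<^sub>R (a + b)) \<le> 1"
      unfolding schatten_norm_eq using schatten_power_nonneg [of p "(x + y) /\<^sub>R (a + b)"] p by (intro powr_le1) auto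
    moreover have "schatten_norm p ((x + y) /\<^sub>R (a + b)) = schatten_norm p (x + y) / (a + b)"
      using schatten_norm_scaleR [OF p, of "inverse (a + b)" "x + y"] pos by (simp add: divide_inverse mult.commute)
    ultimately have "schatten_norm p (x + y) \<le> a + b" using pos by (simp add: divide_le_eq_1)
    then show ?thesis by (simp add: a_def b_def)
  qed
qed

theorem schatten_norm_invariant:
  assumes p: "p > 1" shows "invariant_norm unitary_group (schatten_norm p :: complex^'n^'n \<Rightarrow> real)"
  unfolding invariant_norm_def matrix_norm_def unitary_group_def
  using schatten_norm_eq_0_iff [OF p] schatten_norm_scale [OF p] schatten_norm_triangle [OF p]
  by (auto simp: schatten_norm_eq schatten_power_unitary)

theorem schatten_norm_strictly_convex:
  assumes p: "p > 1" shows "strictly_convex (schatten_norm p :: complex^'n^'n \<Rightarrow> real)"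
  unfolding strictly_convex_def
proof
  assume "\<exists>x y :: complex^'n^'n. x \<noteq> y \<and> closed_segment x y \<subseteq> {z. schatten_norm p z = 1}"
  then obtain x y :: "complex^'n^'n" where xy: "x \<noteq> y" and seg: "closed_segment x y \<subseteq> {z. schatten_norm p z = 1}" by blast
  have one: "schatten_power p z = 1" if "z \<in> closed_segment x y" for z
    using seg that schatten_power_of_norm [OF p, of z] by auto
  have "(1 - 1/2) *\<^sub>R x + (1/2) *\<^sub>R y \<in> closed_segment x y"
    unfolding in_segment by (intro exI [of _ "1/2"]) simp
  then have "schatten_power p ((1 - 1/2) *\<^sub>R x + (1/2) *\<^sub>R y) = (1 - 1/2) * schatten_power p x + (1/2) * schatten_power p y"
    using one ends_in_segment by simp
  then show False using schatten_power_convex(2) [OF p, of "1/2" x y] xy by simp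
qed

subsection \<open>The unitary group\<close>

text \<open>An eigenvalue \<open>-1\<close> would give a nonzero spectral projection that
  annihilates the invertible matrix \<open>v - mat (- 1)\<close>.\<close>

lemma regular_if_spectrum:
  assumes v: "unitary_matrix v" and sp: "- 1 \<notin> matrix_spectrum v" shows "regular v"
proof -
  obtain U f where U: "unitary_matrix U" "v = diag_conj U f" "\<And>i. cmod (f i) = 1"
    by (rule unitary_diagonalization [OF v], rule that)
  have "v - mat (- 1) = diag_conj U (\<lambda>i. f i + 1)"
  proof -
    have "v - mat (- 1) = v + mat 1" by (simp add: vec_eq_iff mat_def)
    then show ?thesis by (simp add: U(2) diag_conj_1 [OF U(1), symmetric] diag_conj_add)
  qed
  moreover have "invertible (v - mat (- 1))" using sp by (simp add: matrix_spectrum_def)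
  ultimately obtain B where B: "diag_conj U (\<lambda>i. f i + 1) ** B = mat 1" unfolding invertible_def by metis
  have "f i \<noteq> - 1" for i
  proof
    assume fi: "f i = - 1"
    have "diag_conj U (\<lambda>j. if j = i then 1 else 0) ** diag_conj U (\<lambda>i. f i + 1) = diag_conj U (\<lambda>j. 0)"
      unfolding diag_conj_mult [OF U(1)] by (intro arg_cong [of _ _ "diag_conj U"] ext) (simp add: fi)
    then have "diag_conj U (\<lambda>j. if j = i then 1 else 0) ** (diag_conj U (\<lambda>i. f i + 1) ** B) = 0"
      by (simp add: matrix_mul_assoc)
    then have "diag_conj U (\<lambda>j. if j = i then 1 else 0) = diag_conj U (\<lambda>j. 0)" by (simp add: B)
    from fun_cong [OF diag_conj_inj [OF U(1) this], of i] show False by simp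
  qed
  then show ?thesis unfolding regular_def using U by blast
qed

lemma unitary_geometry:
  assumes N: "invariant_norm unitary_group N"
  shows "curve_geometry N (UNIV :: (complex^'n^'n) set) (\<lambda>x. x) (\<lambda>x. x) unitary_group"
proof unfold_locales
  have mn: "matrix_norm N" and inv: "\<And>u v x. unitary_matrix u \<Longrightarrow> unitary_matrix v \<Longrightarrow> N (u ** x ** v) = N x"
    using N by (auto simp: invariant_norm_def unitary_group_def)
  show "N (x + y) \<le> N x + N y" for x y using mn by (simp add: matrix_norm_def)
  show "N (c *\<^sub>R x) = \<bar>c\<bar> * N x" for c x
  proof -
    have "N (map_matrix ((*) (of_real c)) x) = norm (complex_of_real c) * N x"
      using mn unfolding matrix_norm_def by blast
    then show ?thesis by (simp add: map_matrix_of_real)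
  qed
  show "N x = 0 \<Longrightarrow> x = 0" for x using mn by (simp add: matrix_norm_def)
  show "N (a ** x ** b) = N x" if "unitary_matrix a" "unitary_matrix b" for a b x using inv that .
  show "unitary_group \<noteq> ({} :: (complex^'n^'n) set)"
  proof -
    have "mat 1 \<in> (unitary_group :: (complex^'n^'n) set)" by (simp add: unitary_group_def)
    then show ?thesis by blast
  qed
  show "u ** matrix_exp x \<in> unitary_group" if "u \<in> unitary_group" "x \<in> skew_hermitian" for u x :: "complex^'n^'n"
    using that unitary_matrix_exp [OF that(2), of 1] unitary_matrix_mult by (auto simp: unitary_group_def)
qed (auto simp: unitary_group_def intro: exI [of _ 1])

theorem unitary_group_geodesics:
  fixes N :: "complex^'n^'n \<Rightarrow> real"
  assumes N: "invariant_norm unitary_group N"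
  shows "(\<forall>u\<in>unitary_group. \<forall>x\<in>skew_hermitian. \<forall>I. is_interval I \<longrightarrow>
            geodesic_on unitary_group N I (\<lambda>t. u ** matrix_exp (t *\<^sub>R x))) \<and>
         (strictly_convex N \<longrightarrow>
            (\<forall>I \<gamma>. geodesic_on unitary_group N I \<gamma> \<longrightarrow>
               (\<exists>u\<in>unitary_group. \<exists>x\<in>skew_hermitian. \<exists>J. is_interval J \<and>
                  same_up_to_parameter I \<gamma> J (\<lambda>t. u ** matrix_exp (t *\<^sub>R x))))) \<and>
         (strictly_convex N \<longrightarrow>
            (\<forall>u\<in>unitary_group. \<forall>v\<in>unitary_group. -1 \<notin> matrix_spectrum (matrix_inv u ** v) \<longrightarrow>
               (\<exists>a b \<gamma>. shortest_curve unitary_group N u v a b \<gamma>) \<and>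
               (\<forall>a b \<gamma> c d \<eta>.
                  shortest_curve unitary_group N u v a b \<gamma> \<and>
                  shortest_curve unitary_group N u v c d \<eta> \<longrightarrow>
                  same_up_to_parameter {a..b} \<gamma> {c..d} \<eta>)))"
proof -
  interpret g: curve_geometry N UNIV "\<lambda>x. x" "\<lambda>x. x" unitary_group
    by (rule unitary_geometry [OF N])
  have gN: "g.N = N" by (rule ext) (simp add: g.N_def)
  have gc: "g.coset u x = (\<lambda>t. u ** matrix_exp (t *\<^sub>R x))" for u x by (rule ext) (simp add: g.coset_def)
  have reg: "regular (g.gap u v)"
    if "u \<in> unitary_group" "v \<in> unitary_group" "- 1 \<notin> matrix_spectrum (matrix_inv u ** v)" for u v
  proof (rule regular_if_spectrum)
    show "unitary_matrix (g.gap u v)" using g.gap_R that by blast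
    show "- 1 \<notin> matrix_spectrum (g.gap u v)"
      using that by (simp add: g.gap_def matrix_inv_unitary unitary_group_def)
  qed
  show ?thesis
  proof (intro conjI impI ballI allI)
    show "geodesic_on unitary_group N I (\<lambda>t. u ** matrix_exp (t *\<^sub>R x))"
      if "u \<in> unitary_group" "x \<in> skew_hermitian" "is_interval I" for u x I
      using g.coset_geodesic [of u x I] that unfolding gN gc by simp
    show "\<exists>u\<in>unitary_group. \<exists>x\<in>skew_hermitian. \<exists>J. is_interval J \<and>
            same_up_to_parameter I \<gamma> J (\<lambda>t. u ** matrix_exp (t *\<^sub>R x))"
      if sc: "strictly_convex N" and geo: "geodesic_on unitary_group N I \<gamma>" for I \<gamma>
    proof -
      obtain u x J where "u \<in> unitary_group" "x \<in> skew_hermitian" "is_interval J"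
        "same_up_to_parameter I \<gamma> J (g.coset u x)"
        using g.geodesic_is_coset sc geo unfolding gN by blast
      then show ?thesis unfolding gc by blast
    qed
    fix u v :: "complex^'n^'n"
    assume sc: "strictly_convex N" and uv: "u \<in> unitary_group" "v \<in> unitary_group"
      and sp: "- 1 \<notin> matrix_spectrum (matrix_inv u ** v)"
    show "\<exists>a b \<gamma>. shortest_curve unitary_group N u v a b \<gamma>"
      using g.unique_shortest_curve(1) [OF _ uv reg [OF uv sp]] sc unfolding gN by simp
    show "same_up_to_parameter {a..b} \<gamma> {c..d} \<eta>"
      if "shortest_curve unitary_group N u v a b \<gamma> \<and> shortest_curve unitary_group N u v c d \<eta>" for a b \<gamma> c d \<eta>
      using g.unique_shortest_curve(2) [OF _ uv reg [OF uv sp]] sc that unfolding gN by simp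
  qed
qed

subsection \<open>The special orthogonal group\<close>

definition real_part :: "complex^'n^'m \<Rightarrow> real^'n^'m" where
  "real_part = map_matrix Re"

definition real_matrices :: "(complex^'n^'n) set" where
  "real_matrices = {x. map_matrix cnj x = x}"

lemma complexify_nth [simp]: "complexify x $ i $ j = of_real (x $ i $ j)"
  by (simp add: complexify_def)

lemma real_part_nth [simp]: "real_part x $ i $ j = Re (x $ i $ j)"
  by (simp add: real_part_def)

lemma real_part_complexify [simp]: "real_part (complexify x) = x"
  by (simp add: vec_eq_iff)

lemma complexify_real_part: "x \<in> real_matrices \<Longrightarrow> complexify (real_part x) = x"
  by (simp add: vec_eq_iff real_matrices_def complex_eq_iff)

lemma complexify_real [simp]: "complexify x \<in> real_matrices"
  by (simp add: real_matrices_def vec_eq_iff)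

lemma complexify_mult: "complexify (A ** B) = complexify A ** complexify B" for A B :: "real^'n^'n"
  by (simp add: vec_eq_iff matrix_matrix_mult_def)

lemma complexify_transpose: "complexify (transpose A) = adjoint_matrix (complexify A)" for A :: "real^'n^'n"
  by (simp add: vec_eq_iff transpose_def)

lemma complexify_mat_1 [simp]: "complexify (mat 1) = mat 1"
  by (simp add: vec_eq_iff mat_def)

lemma complexify_inj: "complexify A = complexify B \<Longrightarrow> A = B"
  by (simp add: vec_eq_iff)

lemma complexify_scaleR: "complexify (c *\<^sub>R A) = c *\<^sub>R complexify A"
  by (simp add: vec_eq_iff scaleR_conv_of_real [where 'a = complex])

lemma bounded_linear_complexify: "bounded_linear (complexify :: real^'n^'n \<Rightarrow> complex^'n^'n)"
  unfolding linear_conv_bounded_linear [symmetric]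
  by (rule linearI) (simp_all add: complexify_scaleR, simp add: vec_eq_iff)

lemma bounded_linear_real_part: "bounded_linear (real_part :: complex^'n^'n \<Rightarrow> real^'n^'n)"
  unfolding linear_conv_bounded_linear [symmetric]
  by (rule linearI) (simp_all add: vec_eq_iff)

lemma unitary_complexify_iff: "unitary_matrix (complexify A) \<longleftrightarrow> orthogonal_matrix A" for A :: "real^'n^'n"
  unfolding unitary_matrix_def orthogonal_matrix_def complexify_transpose [symmetric] complexify_mult [symmetric]
    complexify_mat_1 [symmetric]
  using complexify_inj by metis

lemma orthogonal_real_part: "x \<in> real_matrices \<Longrightarrow> unitary_matrix x \<Longrightarrow> orthogonal_matrix (real_part x)"
  by (metis complexify_real_part unitary_complexify_iff)

lemma skew_complexify_iff: "complexify x \<in> skew_hermitian \<longleftrightarrow> x \<in> skew_symmetric" for x :: "real^'n^'n"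
proof -
  have "complexify (- x) = - complexify x" by (simp add: vec_eq_iff)
  then show ?thesis
    unfolding skew_hermitian_def skew_symmetric_def mem_Collect_eq complexify_transpose [symmetric]
    using complexify_inj by metis
qed

lemma real_part_mult: "x \<in> real_matrices \<Longrightarrow> y \<in> real_matrices \<Longrightarrow> real_part (x ** y) = real_part x ** real_part y"
  by (metis complexify_mult complexify_real_part real_part_complexify)

lemma map_matrix_cnj_mult: "map_matrix cnj (A ** B) = map_matrix cnj A ** map_matrix cnj B" for A B :: "complex^'n^'n"
  by (simp add: vec_eq_iff matrix_matrix_mult_def)

lemma real_matrices_mult: "x \<in> real_matrices \<Longrightarrow> y \<in> real_matrices \<Longrightarrow> x ** y \<in> real_matrices"
  by (simp add: real_matrices_def map_matrix_cnj_mult)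

lemma map_matrix_cnj_diag_conj: "map_matrix cnj (diag_conj U f) = diag_conj (map_matrix cnj U) (\<lambda>i. cnj (f i))"
  by (simp add: vec_eq_iff diag_conj_nth)

lemma unitary_map_matrix_cnj:
  assumes "unitary_matrix (U :: complex^'n^'n)" shows "unitary_matrix (map_matrix cnj U)"
proof (rule unitary_matrixI)
  have "adjoint_matrix (map_matrix cnj U) ** map_matrix cnj U = map_matrix cnj (adjoint_matrix U ** U)"
    unfolding map_matrix_cnj_mult by (rule arg_cong [of _ _ "\<lambda>y. y ** _"]) (simp add: vec_eq_iff)
  also have "\<dots> = mat 1" using assms by (simp add: unitary_matrix_def vec_eq_iff mat_def)
  finally show "adjoint_matrix (map_matrix cnj U) ** map_matrix cnj U = mat 1" .
qed

text \<open>Conjugating a diagonalization of a real matrix gives another one of the same matrix;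
  independence of the diagonalization then turns the symmetry of \<open>\<phi>\<close> into
  realness.\<close>

lemma real_matrices_calculus:
  assumes U: "unitary_matrix U" and R: "diag_conj U f \<in> real_matrices" and \<phi>: "\<And>z. \<phi> (cnj z) = cnj (\<phi> z)"
  shows "diag_conj U (\<lambda>i. \<phi> (f i)) \<in> real_matrices"
proof -
  have "diag_conj (map_matrix cnj U) (\<lambda>i. cnj (f i)) = diag_conj U f"
    using R by (simp add: real_matrices_def map_matrix_cnj_diag_conj)
  from diag_conj_comp_cong [OF unitary_map_matrix_cnj [OF U] U this, of \<phi>]
  show ?thesis by (simp add: real_matrices_def map_matrix_cnj_diag_conj \<phi>)
qed

lemma orthogonal_algebra:
  fixes N :: "real^'n^'n \<Rightarrow> real"
  assumes N: "invariant_norm orthogonal_group N"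
  shows "invariant_geometry (\<lambda>x. N (real_part x)) real_matrices"
proof unfold_locales
  have mn: "matrix_norm N" and inv: "\<And>u v x. orthogonal_matrix u \<Longrightarrow> orthogonal_matrix v \<Longrightarrow> N (u ** x ** v) = N x"
    using N by (auto simp: invariant_norm_def orthogonal_group_def)
  show "N (real_part (x + y)) \<le> N (real_part x) + N (real_part y)" for x y
    using mn by (simp add: matrix_norm_def linear_add [OF bounded_linear.linear [OF bounded_linear_real_part]])
  show "N (real_part (c *\<^sub>R x)) = \<bar>c\<bar> * N (real_part x)" for c x
  proof -
    have "N (map_matrix ((*) c) (real_part x)) = norm c * N (real_part x)"
      using mn unfolding matrix_norm_def by blast
    moreover have "map_matrix ((*) c) (real_part x) = real_part (c *\<^sub>R x)" by (simp add: vec_eq_iff)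
    ultimately show ?thesis by simp
  qed
  show "subspace (real_matrices :: (complex^'n^'n) set)"
    by (auto simp: subspace_def real_matrices_def vec_eq_iff)
  show "mat 1 \<in> (real_matrices :: (complex^'n^'n) set)"
    using complexify_real [of "mat 1"] by simp
  show "x ** y \<in> real_matrices" if "x \<in> real_matrices" "y \<in> real_matrices" for x y :: "complex^'n^'n"
    using that by (rule real_matrices_mult)
  show "adjoint_matrix x \<in> real_matrices" if "x \<in> real_matrices" for x :: "complex^'n^'n"
    using that by (simp add: real_matrices_def vec_eq_iff)
  show "diag_conj U (\<lambda>i. \<phi> (f i)) \<in> real_matrices"
    if "unitary_matrix U" "diag_conj U f \<in> real_matrices" "\<And>z. \<phi> (cnj z) = cnj (\<phi> z)" for U :: "complex^'n^'n" and f \<phi>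
    using that by (rule real_matrices_calculus)
  show "x = 0" if "x \<in> real_matrices" "N (real_part x) = 0" for x
  proof -
    have "real_part x = 0" using mn that by (simp add: matrix_norm_def)
    then have "complexify (real_part x) = 0" by (simp add: vec_eq_iff)
    then show ?thesis using complexify_real_part [OF that(1)] by simp
  qed
  show "N (real_part (a ** x ** b)) = N (real_part x)"
    if "a \<in> real_matrices" "unitary_matrix a" "b \<in> real_matrices" "unitary_matrix b" "x \<in> real_matrices" for a b x
    using inv [OF orthogonal_real_part orthogonal_real_part] that by (simp add: real_part_mult real_matrices_mult)
qed

lemma special_orthogonal_geometry:
  fixes N :: "real^'n^'n \<Rightarrow> real"
  assumes N: "invariant_norm orthogonal_group N"
  shows "curve_geometry (\<lambda>x. N (real_part x)) real_matrices complexify real_part special_orthogonal_group"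
proof -
  interpret g: invariant_geometry "\<lambda>x. N (real_part x)" real_matrices by (rule orthogonal_algebra [OF N])
  show ?thesis
  proof (intro curve_geometry.intro curve_geometry_axioms.intro g.invariant_geometry_axioms)
    show "bounded_linear (complexify :: real^'n^'n \<Rightarrow> complex^'n^'n)" by (rule bounded_linear_complexify)
    show "bounded_linear (real_part :: complex^'n^'n \<Rightarrow> real^'n^'n)" by (rule bounded_linear_real_part)
    show "unitary_matrix (complexify u)" if "u \<in> special_orthogonal_group" for u :: "real^'n^'n"
      using that by (simp add: special_orthogonal_group_def unitary_complexify_iff)
    have "mat 1 \<in> (special_orthogonal_group :: (real^'n^'n) set)"
      by (simp add: special_orthogonal_group_def orthogonal_matrix_id)
    then show "(special_orthogonal_group :: (real^'n^'n) set) \<noteq> {}" by blast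
    show "real_part (complexify u ** matrix_exp x) \<in> special_orthogonal_group"
      if u: "u \<in> special_orthogonal_group" and x: "x \<in> real_matrices" "x \<in> skew_hermitian" for u :: "real^'n^'n" and x
    proof -
      \<comment> \<open>The exponential is the square of \<open>h\<close>, whose real part is
        orthogonal with determinant \<open>1\<close> or \<open>-1\<close>; so the product with
        \<open>u\<close> has determinant \<open>1\<close>.\<close>
      define h where "h = matrix_exp ((1 / 2) *\<^sub>R x)"
      have h: "h \<in> real_matrices" "unitary_matrix h"
        unfolding h_def using g.exp_R [OF x] unitary_matrix_exp [OF x(2)] by auto
      have oh: "orthogonal_matrix (real_part h)" by (rule orthogonal_real_part [OF h])
      have ex: "matrix_exp x = h ** h"
        unfolding h_def using matrix_exp_add [OF x(2), of "1/2" "1/2"] by simp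
      have eq: "real_part (complexify u ** matrix_exp x) = u ** (real_part h ** real_part h)"
        unfolding ex using h by (simp add: real_part_mult real_matrices_mult)
      have "det (real_part h) = 1 \<or> det (real_part h) = - 1" by (rule det_orthogonal_matrix [OF oh])
      then have "det (real_part h) * det (real_part h) = 1" by auto
      then show ?thesis
        using u oh unfolding eq special_orthogonal_group_def
        by (auto simp: det_mul intro: orthogonal_matrix_mul)
    qed
  qed (auto simp: complexify_real_part)
qed

text \<open>The powers correspond under \<open>complexify\<close>, and the bounded linear map
  \<open>real_part\<close> carries the convergent complex series to the real one.\<close>

lemma complexify_matrix_exp:
  fixes x :: "real^'n^'n"
  assumes x: "complexify x \<in> skew_hermitian"
  shows "real_part (matrix_exp (complexify x)) = matrix_exp x"
proof -
  obtain U d where U: "unitary_matrix U" and xU: "complexify x = diag_conj U (\<lambda>i. \<i> * of_real (d i))"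
    by (rule skew_hermitian_diagonalization [OF x], rule that)
  have pow: "((**) (complexify x) ^^ k) (mat 1) = complexify (((**) x ^^ k) (mat 1))" for k
    by (induction k) (simp_all add: complexify_mult)
  have "(\<lambda>k. (((**) (complexify x) ^^ k) (mat 1)) /\<^sub>R fact k) sums matrix_exp (complexify x)"
    unfolding xU matrix_exp_diag_conj [OF U] by (rule matrix_exp_sums_diag_conj [OF U])
  from bounded_linear.sums [OF bounded_linear_real_part this]
  have "(\<lambda>k. (((**) x ^^ k) (mat 1)) /\<^sub>R fact k) sums real_part (matrix_exp (complexify x))"
    unfolding pow complexify_scaleR [symmetric] by simp
  then show ?thesis unfolding matrix_exp_def [of x] by (rule sums_unique)
qed

theorem special_orthogonal_group_geodesics:
  fixes N :: "real^'n^'n \<Rightarrow> real"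
  assumes N: "invariant_norm orthogonal_group N"
  shows "(\<forall>u\<in>special_orthogonal_group. \<forall>x\<in>skew_symmetric. \<forall>I. is_interval I \<longrightarrow>
            geodesic_on special_orthogonal_group N I (\<lambda>t. u ** matrix_exp (t *\<^sub>R x))) \<and>
         (strictly_convex N \<longrightarrow>
            (\<forall>I \<gamma>. geodesic_on special_orthogonal_group N I \<gamma> \<longrightarrow>
               (\<exists>u\<in>special_orthogonal_group. \<exists>x\<in>skew_symmetric. \<exists>J. is_interval J \<and>
                  same_up_to_parameter I \<gamma> J (\<lambda>t. u ** matrix_exp (t *\<^sub>R x))))) \<and>
         (strictly_convex N \<longrightarrow>
            (\<forall>u\<in>special_orthogonal_group. \<forall>v\<in>special_orthogonal_group. -1 \<notin> matrix_spectrum (complexify (matrix_inv u ** v)) \<longrightarrow>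
               (\<exists>a b \<gamma>. shortest_curve special_orthogonal_group N u v a b \<gamma>) \<and>
               (\<forall>a b \<gamma> c d \<eta>.
                  shortest_curve special_orthogonal_group N u v a b \<gamma> \<and>
                  shortest_curve special_orthogonal_group N u v c d \<eta> \<longrightarrow>
                  same_up_to_parameter {a..b} \<gamma> {c..d} \<eta>)))"
proof -
  interpret g: curve_geometry "\<lambda>x. N (real_part x)" real_matrices complexify real_part special_orthogonal_group
    by (rule special_orthogonal_geometry [OF N])
  have gN: "g.N = N" by (rule ext) (simp add: g.N_def)
  have gc: "g.coset u x = (\<lambda>t. u ** matrix_exp (t *\<^sub>R x))"
    if "u \<in> special_orthogonal_group" "x \<in> skew_symmetric" for u x
  proof
    fix t
    have x: "complexify x \<in> skew_hermitian" using that skew_complexify_iff by blast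
    then have tx: "complexify (t *\<^sub>R x) \<in> skew_hermitian"
      by (simp add: complexify_scaleR skew_hermitian_def adjoint_scaleR)
    have "g.coset u x t = real_part (complexify u) ** real_part (matrix_exp (t *\<^sub>R complexify x))"
      unfolding g.coset_def by (rule real_part_mult) (use g.exp_R [OF _ x] in auto)
    then show "g.coset u x t = u ** matrix_exp (t *\<^sub>R x)"
      using complexify_matrix_exp [OF tx] by (simp add: complexify_scaleR)
  qed
  have reg: "regular (g.gap u v)"
    if uv: "u \<in> special_orthogonal_group" "v \<in> special_orthogonal_group"
      and sp: "- 1 \<notin> matrix_spectrum (complexify (matrix_inv u ** v))" for u v
  proof (rule regular_if_spectrum)
    show "unitary_matrix (g.gap u v)" using g.gap_R uv by blast
    have "orthogonal_matrix u" using uv by (simp add: special_orthogonal_group_def)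
    then have "matrix_inv u = transpose u"
      unfolding orthogonal_matrix_def matrix_inv_def
      by (intro some_equality) (auto, metis matrix_mul_assoc matrix_mul_lid matrix_mul_rid)
    then have "g.gap u v = complexify (matrix_inv u ** v)"
      by (simp add: g.gap_def complexify_mult complexify_transpose)
    then show "- 1 \<notin> matrix_spectrum (g.gap u v)" using sp by simp
  qed
  have a: "geodesic_on special_orthogonal_group N I (\<lambda>t. u ** matrix_exp (t *\<^sub>R x))"
    if "u \<in> special_orthogonal_group" "x \<in> skew_symmetric" "is_interval I" for u x I
    using g.coset_geodesic [OF that(1) _ that(3)] that skew_complexify_iff gc unfolding gN by metis
  have b: "\<exists>u\<in>special_orthogonal_group. \<exists>x\<in>skew_symmetric. \<exists>J. is_interval J \<and>
                  same_up_to_parameter I \<gamma> J (\<lambda>t. u ** matrix_exp (t *\<^sub>R x))"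
    if sc: "strictly_convex N" and geo: "geodesic_on special_orthogonal_group N I \<gamma>" for I \<gamma>
  proof -
    obtain u x J where "u \<in> special_orthogonal_group" "complexify x \<in> skew_hermitian" "is_interval J"
      "same_up_to_parameter I \<gamma> J (g.coset u x)"
      using g.geodesic_is_coset sc geo unfolding gN by blast
    then show ?thesis using gc skew_complexify_iff by metis
  qed
  show ?thesis
  proof (intro conjI impI ballI allI)
    fix u v :: "real^'n^'n"
    assume sc: "strictly_convex N" and uv: "u \<in> special_orthogonal_group" "v \<in> special_orthogonal_group"
      and sp: "- 1 \<notin> matrix_spectrum (complexify (matrix_inv u ** v))"
    show "\<exists>a b \<gamma>. shortest_curve special_orthogonal_group N u v a b \<gamma>"
      using g.unique_shortest_curve(1) [OF _ uv reg [OF uv sp]] sc unfolding gN by simp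
    show "same_up_to_parameter {a..b} \<gamma> {c..d} \<eta>"
      if "shortest_curve special_orthogonal_group N u v a b \<gamma> \<and> shortest_curve special_orthogonal_group N u v c d \<eta>"
      for a b \<gamma> c d \<eta>
      using g.unique_shortest_curve(2) [OF _ uv reg [OF uv sp]] sc that unfolding gN by simp
  qed (use a b in auto)
qed

section \<open>Schatten norms on real matrices\<close>

lemma strictly_convex_complexify:
  assumes "strictly_convex N" shows "strictly_convex (\<lambda>x :: real^'n^'n. N (complexify x))"
  unfolding strictly_convex_def
proof
  assume "\<exists>x y :: real^'n^'n. x \<noteq> y \<and> closed_segment x y \<subseteq> {z. N (complexify z) = 1}"
  then obtain x y :: "real^'n^'n" where xy: "x \<noteq> y" "closed_segment x y \<subseteq> {z. N (complexify z) = 1}" by blast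
  have "closed_segment (complexify x) (complexify y) = complexify ` closed_segment x y"
    by (rule closed_segment_linear_image [OF bounded_linear.linear [OF bounded_linear_complexify]])
  then have "closed_segment (complexify x) (complexify y) \<subseteq> {z. N z = 1}" using xy(2) by auto
  moreover have "complexify x \<noteq> complexify y" using xy(1) complexify_inj by blast
  ultimately show False using assms unfolding strictly_convex_def by blast
qed

lemma schatten_norm_orthogonal_invariant:
  assumes p: "p > 1" shows "invariant_norm orthogonal_group (\<lambda>x :: real^'n^'n. schatten_norm p (complexify x))"
proof -
  have add: "complexify (x + y) = complexify x + complexify y" for x y :: "real^'n^'n" by (simp add: vec_eq_iff)
  have sc: "complexify (map_matrix ((*) c) x) = map_matrix ((*) (of_real c)) (complexify x)" for c and x :: "real^'n^'n"
    by (simp add: vec_eq_iff)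
  have z: "complexify x = 0 \<longleftrightarrow> x = 0" for x :: "real^'n^'n" by (simp add: vec_eq_iff)
  have un: "schatten_norm p (u ** x ** v) = schatten_norm p x" if "unitary_matrix u" "unitary_matrix v" for u v x :: "complex^'n^'n"
    using schatten_power_unitary [OF that] by (simp add: schatten_norm_eq)
  have nn: "0 \<le> schatten_norm p x" for x :: "complex^'n^'n" by (simp add: schatten_norm_eq)
  show ?thesis
    unfolding invariant_norm_def matrix_norm_def orthogonal_group_def
    by (simp add: nn add sc z complexify_mult un unitary_complexify_iff schatten_norm_eq_0_iff [OF p]
        schatten_norm_scale [OF p] schatten_norm_triangle [OF p])
qed

theorem proposition6:
  shows
    "((\<forall>N :: complex^'n^'n \<Rightarrow> real. invariant_norm unitary_group N \<longrightarrow>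
         (\<forall>u\<in>unitary_group. \<forall>x\<in>skew_hermitian. \<forall>I. is_interval I \<longrightarrow>
            geodesic_on unitary_group N I (\<lambda>t. u ** matrix_exp (t *\<^sub>R x))) \<and>
         (strictly_convex N \<longrightarrow>
            (\<forall>I \<gamma>. geodesic_on unitary_group N I \<gamma> \<longrightarrow>
               (\<exists>u\<in>unitary_group. \<exists>x\<in>skew_hermitian. \<exists>J. is_interval J \<and>
                  same_up_to_parameter I \<gamma> J (\<lambda>t. u ** matrix_exp (t *\<^sub>R x))))) \<and>
         (strictly_convex N \<longrightarrow>
            (\<forall>u\<in>unitary_group. \<forall>v\<in>unitary_group. -1 \<notin> matrix_spectrum (matrix_inv u ** v) \<longrightarrow>
               (\<exists>a b \<gamma>. shortest_curve unitary_group N u v a b \<gamma>) \<and>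
               (\<forall>a b \<gamma> c d \<eta>.
                  shortest_curve unitary_group N u v a b \<gamma> \<and>
                  shortest_curve unitary_group N u v c d \<eta> \<longrightarrow>
                  same_up_to_parameter {a..b} \<gamma> {c..d} \<eta>)))) \<and>
     (\<forall>p>1. invariant_norm unitary_group (schatten_norm p :: complex^'n^'n \<Rightarrow> real) \<and>
        strictly_convex (schatten_norm p :: complex^'n^'n \<Rightarrow> real)))
     \<and>
     ((\<forall>N :: real^'n^'n \<Rightarrow> real. invariant_norm orthogonal_group N \<longrightarrow>
         (\<forall>u\<in>special_orthogonal_group. \<forall>x\<in>skew_symmetric. \<forall>I. is_interval I \<longrightarrow>
            geodesic_on special_orthogonal_group N I (\<lambda>t. u ** matrix_exp (t *\<^sub>R x))) \<and>
         (strictly_convex N \<longrightarrow>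
            (\<forall>I \<gamma>. geodesic_on special_orthogonal_group N I \<gamma> \<longrightarrow>
               (\<exists>u\<in>special_orthogonal_group. \<exists>x\<in>skew_symmetric. \<exists>J. is_interval J \<and>
                  same_up_to_parameter I \<gamma> J (\<lambda>t. u ** matrix_exp (t *\<^sub>R x))))) \<and>
         (strictly_convex N \<longrightarrow>
            (\<forall>u\<in>special_orthogonal_group. \<forall>v\<in>special_orthogonal_group. -1 \<notin> matrix_spectrum (complexify (matrix_inv u ** v)) \<longrightarrow>
               (\<exists>a b \<gamma>. shortest_curve special_orthogonal_group N u v a b \<gamma>) \<and>
               (\<forall>a b \<gamma> c d \<eta>.
                  shortest_curve special_orthogonal_group N u v a b \<gamma> \<and>
                  shortest_curve special_orthogonal_group N u v c d \<eta> \<longrightarrow>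
                  same_up_to_parameter {a..b} \<gamma> {c..d} \<eta>)))) \<and>
     (\<forall>p>1. invariant_norm orthogonal_group (\<lambda>x :: real^'n^'n. schatten_norm p (complexify x)) \<and>
        strictly_convex (\<lambda>x :: real^'n^'n. schatten_norm p (complexify x))))"
  by (rule conjI; rule conjI; intro allI impI;
      (rule unitary_group_geodesics special_orthogonal_group_geodesics |
       intro conjI schatten_norm_invariant schatten_norm_strictly_convex
         schatten_norm_orthogonal_invariant strictly_convex_complexify); assumption)

end
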